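(* Let $s_1,s_2\in\mathbb R$, $0<\vec q<\vec p<\infty$, $0<\vec r<\infty$, $\vec\alpha_1=(\alpha_1^1,\dots,\alpha_n^1)\in\mathbb R^n$, $\vec\alpha_2=(\alpha_1^2,\dots,\alpha_n^2)\in\mathbb R^n$ and $0<\theta,\beta\le\infty$. Suppose that $$\alpha_i^2\ge\alpha_i^1>-\frac1{p_i},\quad i\in\{1,\dots,n\},\qquad\text{and}\qquad s_1-\frac1{\mathbf p}-\boldsymbol\alpha_1\le s_2-\frac1{\mathbf q}-\boldsymbol\alpha_2.$$ Then $$\dot E_{\vec q}^{\vec\alpha_2,\vec r}F_\theta^{s_2}\hookrightarrow\dot E_{\vec p}^{\vec\alpha_1,\vec r}F_\beta^{s_1}.$$
   Context: Conventions: inequalities between vectors are componentwise; sums with exponent $\infty$ are replaced by suprema; $\frac1{\mathbf p}=\sum_i\frac1{p_i}$, $\frac1{\mathbf q}=\sum_i\frac1{q_i}$, $\boldsymbol\alpha_j=\sum_i\alpha_i^j$. $X\hookrightarrow Y$ means $X\subset Y$ with $\|f\|_Y\le C\|f\|_X$ for all $f\in X$. Mixed-norm Herz spaces: for $k\in\mathbb Z$ let $R_k=\{t\in\mathbb R:2^{k-1}\le|t|<2^k\}$. For $0<p,q\le\infty$, $\alpha\in\mathbb R$ and measurable $g$ on $\mathbb R$, $\|g\|_{\dot K_p^{\alpha,q}}=\big(\sum_{k\in\mathbb Z}2^{k\alpha q}\|g\chi_{R_k}\|_{L^p(\mathbb R)}^q\big)^{1/q}$. The space $\dot E_{\vec p}^{\vec\alpha,\vec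 q}(\mathbb R^n)$ consists of all measurable $f$ on $\mathbb R^n$ with $\|f\|_{\dot E_{\vec p}^{\vec\alpha,\vec q}(\mathbb R^n)}=\big\|\cdots\|f\|_{\dot K_{p_1}^{\alpha_1,q_1}}\cdots\big\|_{\dot K_{p_n}^{\alpha_n,q_n}}<\infty$, where the $\dot K_{p_i}^{\alpha_i,q_i}$-quasi-norm is taken in the variable $x_i$, successively for $i=1,\dots,n$ ($x_1$ innermost). Triebel–Lizorkin-type spaces: fix $\Phi,\varphi\in\mathcal S(\mathbb R^n)$ with $\operatorname{supp}\mathcal F\Phi\subset\{|\xi|\le2\}$, $|\mathcal F\Phi(\xi)|\ge c>0$ for $|\xi|\le\frac53$, $\operatorname{supp}\mathcal F\varphi\subset\{\frac12\le|\xi|\le2\}$, $|\mathcal F\varphi(\xi)|\ge c>0$ for $\frac35\le|\xi|\le\frac53$. Put $\varphi_0=\Phi$, $\varphi_k=2^{kn}\varphi(2^k\cdot)$ for $k\ge1$. For $0<\vec p,\vec q<\infty$, $\dot E_{\vec p}^{\vec\alpha,\vec q}F_\beta^s$ is the set of $f\in\mathcal S'(\mathbb R^n)$ with quasi-norm $\big\|\big(\sum_{k\ge0}2^{ks\beta}|\varphi_k*f|^\beta\big)^{1/\beta}\big\|_{\dot E_{\vec p}^{\vec\alpha,\vec q}(\mathbb R^n)}<\infty$. *)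

theory Defs
  imports "HOL-Analysis.Analysis" "HOL-Probability.Essential_Supremum"
begin

section \<open>Lebesgue and sequence quasi-norms with values in [0,\<infinity>]\<close>

text \<open>Only used for exponents \<open>a > 0\<close>.\<close>

definition ennreal_powr :: "ennreal \<Rightarrow> real \<Rightarrow> ennreal" where
  "ennreal_powr x a = (if x = \<infinity> then \<infinity> else ennreal (enn2real x powr a))"

definition Lp_norm :: "ennreal \<Rightarrow> 'a measure \<Rightarrow> ('a \<Rightarrow> ennreal) \<Rightarrow> ennreal" where
  "Lp_norm p M g =
     (if p = \<infinity> then esssup M g
      else ennreal_powr (\<integral>\<^sup>+ t. ennreal_powr (g t) (enn2real p) \<partial>M) (1 / enn2real p))"

definition lq_norm :: "ennreal \<Rightarrow> ('k \<Rightarrow> ennreal) \<Rightarrow> ennreal" where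
  "lq_norm q a =
     (if q = \<infinity> then (SUP k. a k)
      else ennreal_powr (\<Sum>\<^sub>\<infinity>k. ennreal_powr (a k) (enn2real q)) (1 / enn2real q))"


section \<open>Mixed-norm Herz spaces\<close>

text \<open>The quasi-norms below are applied to nonnegative functions, that is, to moduli. This is no
  restriction, since the Herz quasi-norm of \<open>g\<close> depends only on \<open>\<bar>g\<bar>\<close>.\<close>

definition dyadic_annulus :: "int \<Rightarrow> real set" where
  "dyadic_annulus k = {t. 2 powi (k - 1) \<le> \<bar>t\<bar> \<and> \<bar>t\<bar> < 2 powi k}"

definition herz_norm :: "real \<Rightarrow> ennreal \<Rightarrow> ennreal \<Rightarrow> (real \<Rightarrow> ennreal) \<Rightarrow> ennreal" where
  "herz_norm \<alpha> p q g =
     lq_norm q (\<lambda>k::int. ennreal (2 powr (of_int k * \<alpha>)) *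
                  Lp_norm p lebesgue (\<lambda>t. g t * indicator (dyadic_annulus k) t))"

definition upd_coord :: "real ^ 'n \<Rightarrow> 'n \<Rightarrow> real \<Rightarrow> real ^ 'n" where
  "upd_coord x i t = (\<chi> j. if j = i then t else x $ j)"

text \<open>Replaces the dependence on the listed coordinates by the Herz quasi-norm in those
  coordinates, the head of the list being the innermost one.\<close>

primrec iterated_herz_norm ::
  "real ^ 'n \<Rightarrow> ennreal ^ 'n \<Rightarrow> ennreal ^ 'n \<Rightarrow> 'n list \<Rightarrow> (real ^ 'n \<Rightarrow> ennreal) \<Rightarrow> real ^ 'n \<Rightarrow> ennreal"
where
  "iterated_herz_norm \<alpha> p q [] f = f"
| "iterated_herz_norm \<alpha> p q (i # js) f =
     iterated_herz_norm \<alpha> p q js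
       (\<lambda>x. herz_norm (\<alpha> $ i) (p $ i) (q $ i) (\<lambda>t. f (upd_coord x i t)))"

text \<open>The linear order on the index type fixes the order \<open>x\<^sub>1, \<dots>, x\<^sub>n\<close> of the variables. Once all
  coordinates have been treated the function is constant, so its value at \<open>0\<close> is the quasi-norm.\<close>

definition mixed_herz_norm ::
  "real ^ 'n::{finite,linorder} \<Rightarrow> ennreal ^ 'n::{finite,linorder} \<Rightarrow> ennreal ^ 'n::{finite,linorder} \<Rightarrow>
   (real ^ 'n::{finite,linorder} \<Rightarrow> ennreal) \<Rightarrow> ennreal"
where
  "mixed_herz_norm \<alpha> p q f = iterated_herz_norm \<alpha> p q (sorted_list_of_set UNIV) f 0"


section \<open>Schwartz functions and tempered distributions\<close>

definition partial_deriv :: "'n \<Rightarrow> (real ^ 'n::finite \<Rightarrow> complex) \<Rightarrow> real ^ 'n \<Rightarrow> complex" where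
  "partial_deriv i f = (\<lambda>x. frechet_derivative f (at x) (axis i 1))"

primrec partial_derivs :: "'n list \<Rightarrow> (real ^ 'n::finite \<Rightarrow> complex) \<Rightarrow> real ^ 'n \<Rightarrow> complex" where
  "partial_derivs [] f = f"
| "partial_derivs (i # js) f = partial_deriv i (partial_derivs js f)"

definition schwartz :: "(real ^ 'n::finite \<Rightarrow> complex) set" where
  "schwartz = {f. \<forall>js. (\<forall>x. partial_derivs js f differentiable (at x)) \<and>
       (\<forall>N::nat. bdd_above (range (\<lambda>x. (1 + norm x) ^ N * cmod (partial_derivs js f x))))}"

definition schwartz_seminorm :: "nat \<Rightarrow> (real ^ 'n::finite \<Rightarrow> complex) \<Rightarrow> real" where
  "schwartz_seminorm N f =
     (SUP (js, x) \<in> {js. length js \<le> N} \<times> UNIV. (1 + norm x) ^ N * cmod (partial_derivs js f x))"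

text \<open>Continuous linear functionals on \<^const>\<open>schwartz\<close>, normalised by extensionality
  outside this set, so that distinct elements are distinct distributions.\<close>

definition tempered_distributions :: "((real ^ 'n::finite \<Rightarrow> complex) \<Rightarrow> complex) set" where
  "tempered_distributions = {u. u \<in> extensional schwartz \<and>
     (\<forall>f\<in>schwartz. \<forall>g\<in>schwartz. \<forall>a b. u (\<lambda>x. a * f x + b * g x) = a * u f + b * u g) \<and>
     (\<exists>N C. \<forall>f\<in>schwartz. cmod (u f) \<le> C * schwartz_seminorm N f)}"

definition convolve ::
  "(real ^ 'n::finite \<Rightarrow> complex) \<Rightarrow> ((real ^ 'n \<Rightarrow> complex) \<Rightarrow> complex) \<Rightarrow> real ^ 'n \<Rightarrow> complex"
where
  "convolve \<phi> u x = u (\<lambda>y. \<phi> (x - y))"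

definition fourier :: "(real ^ 'n::finite \<Rightarrow> complex) \<Rightarrow> real ^ 'n \<Rightarrow> complex" where
  "fourier f \<xi> = of_real ((2 * pi) powr (- real CARD('n) / 2)) *
     (\<integral>x. exp (- \<i> * of_real (x \<bullet> \<xi>)) * f x \<partial>lborel)"

definition supp :: "(real ^ 'n::finite \<Rightarrow> complex) \<Rightarrow> (real ^ 'n) set" where
  "supp f = closure {x. f x \<noteq> 0}"


section \<open>Triebel-Lizorkin-type spaces built on mixed-norm Herz spaces\<close>

definition littlewood_paley_pair ::
  "(real ^ 'n::finite \<Rightarrow> complex) \<Rightarrow> (real ^ 'n \<Rightarrow> complex) \<Rightarrow> bool"
where
  "littlewood_paley_pair \<Phi> \<phi> \<longleftrightarrow>
     \<Phi> \<in> schwartz \<and> \<phi> \<in> schwartz \<and>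
     supp (fourier \<Phi>) \<subseteq> {\<xi>. norm \<xi> \<le> 2} \<and>
     (\<exists>c>0. \<forall>\<xi>. norm \<xi> \<le> 5/3 \<longrightarrow> cmod (fourier \<Phi> \<xi>) \<ge> c) \<and>
     supp (fourier \<phi>) \<subseteq> {\<xi>. 1/2 \<le> norm \<xi> \<and> norm \<xi> \<le> 2} \<and>
     (\<exists>c>0. \<forall>\<xi>. 3/5 \<le> norm \<xi> \<and> norm \<xi> \<le> 5/3 \<longrightarrow> cmod (fourier \<phi> \<xi>) \<ge> c)"

definition lp_piece ::
  "(real ^ 'n::finite \<Rightarrow> complex) \<Rightarrow> (real ^ 'n \<Rightarrow> complex) \<Rightarrow> nat \<Rightarrow> real ^ 'n \<Rightarrow> complex"
where
  "lp_piece \<Phi> \<phi> k =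
     (if k = 0 then \<Phi> else (\<lambda>x. 2 ^ (k * CARD('n)) * \<phi> (2 ^ k *\<^sub>R x)))"

definition herz_TL_norm ::
  "(real ^ 'n::{finite,linorder} \<Rightarrow> complex) \<Rightarrow> (real ^ 'n::{finite,linorder} \<Rightarrow> complex) \<Rightarrow>
   real ^ 'n::{finite,linorder} \<Rightarrow> real ^ 'n::{finite,linorder} \<Rightarrow>
   real ^ 'n::{finite,linorder} \<Rightarrow> real \<Rightarrow> ennreal \<Rightarrow>
   ((real ^ 'n::{finite,linorder} \<Rightarrow> complex) \<Rightarrow> complex) \<Rightarrow> ennreal"
where
  "herz_TL_norm \<Phi> \<phi> \<alpha> p q s \<beta> f =
     mixed_herz_norm \<alpha> (\<chi> i. ennreal (p $ i)) (\<chi> i. ennreal (q $ i))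
       (\<lambda>x. lq_norm \<beta> (\<lambda>k::nat. ennreal (2 powr (real k * s) *
                                         cmod (convolve (lp_piece \<Phi> \<phi> k) f x))))"

definition herz_TL_space ::
  "(real ^ 'n::{finite,linorder} \<Rightarrow> complex) \<Rightarrow> (real ^ 'n::{finite,linorder} \<Rightarrow> complex) \<Rightarrow>
   real ^ 'n::{finite,linorder} \<Rightarrow> real ^ 'n::{finite,linorder} \<Rightarrow>
   real ^ 'n::{finite,linorder} \<Rightarrow> real \<Rightarrow> ennreal \<Rightarrow>
   ((real ^ 'n::{finite,linorder} \<Rightarrow> complex) \<Rightarrow> complex) set"
where
  "herz_TL_space \<Phi> \<phi> \<alpha> p q s \<beta> =
     {f \<in> tempered_distributions. herz_TL_norm \<Phi> \<phi> \<alpha> p q s \<beta> f < \<infinity>}"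

definition continuously_embedded ::
  "'a set \<Rightarrow> ('a \<Rightarrow> ennreal) \<Rightarrow> 'a set \<Rightarrow> ('a \<Rightarrow> ennreal) \<Rightarrow> bool"
where
  "continuously_embedded X norm_X Y norm_Y \<longleftrightarrow>
     X \<subseteq> Y \<and> (\<exists>C::real. C > 0 \<and> (\<forall>f\<in>X. norm_Y f \<le> ennreal C * norm_X f))"

end

theory Submission
  imports Defs "HOL-Probability.Probability"
begin

text \<open>
  Raising everything to a small power \<open>a\<close> turns all Herz norms involved into genuine norms, which are countably
  subadditive. Each piece \<open>f\<^sub>k\<close> is band-limited at frequency \<open>2 ^ k\<close>, hence equals in every coordinate a weighted sum of its
  samples along any translate of a lattice of step \<open>2 powr (- k - 1)\<close>, with rapidly decaying weights. Since \<open>a \<le> 1\<close>, such a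
  discrete formula survives taking \<open>a\<close>-th powers, and averaging over the translates bounds \<open>\<bar>f\<^sub>k\<bar> powr a\<close> by a weighted mean
  of itself. This avoids maximal functions.

  The coordinates are then treated one at a time, the innermost first and with the other norms untouched. As functions of
  the current variable, let \<open>W\<close> be the norm of \<open>sup\<^sub>k 2 powr (a k s) \<bar>f\<^sub>k\<bar> powr a\<close> in the preceding variables and \<open>V\<^sub>k\<close> that of its
  \<open>k\<close>-th member. The mean value bound gives \<open>V\<^sub>k \<le> min W (C 2 powr (k / Q) D\<^sub>j)\<close> on the \<open>j\<close>-th annulus as long as
  \<open>2 powr (- k)\<close> does not exceed its radius, and the series over \<open>k\<close> of these minima, weighted by \<open>2 powr (- k (1 / Q - 1 / P))\<close>,
  is at most a multiple of \<open>W powr (Q / P) D\<^sub>j powr (1 - Q / P)\<close>. For the remaining \<open>k\<close> the annulus lies within distance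
  \<open>2 powr (- k)\<close> of the origin, where \<open>V\<^sub>k\<close> has a constant bound, and \<open>\<alpha>1 > - 1 / P\<close> makes these contributions summable.
  Each step thus passes from a supremum over \<open>k\<close> to a sum over \<open>k\<close>, which is why the fine indices play no role.
\<close>

section \<open>Powers and Lebesgue norms in the extended nonnegative reals\<close>

text \<open>The exponent \<open>a\<close> meets several demands at once: q / a and r / a must be at
  least 1 for Minkowski's inequality, \<open>a \<le> \<beta>\<close> lets a sum of a-th powers
  dominate the target fine norm, and a (\<alpha>2 + 1 / q) < 1 becomes \<alpha>2 < 1 - 1 / Q after
  rescaling. The last condition makes mass near the origin harmless in the averages; its counterpart
  \<alpha>2 > - 1 / Q, for mass far out, is inherited from \<alpha>1 > - 1 / P. Together they make
  the interaction of two annuli decay geometrically in the distance of their indices, so that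
  Young's inequality on the integers handles the exponent R.

  In the sampling formula two rates of decay compete. Taking a-th powers needs weights of a fixed
  order M > 2 / a with a constant shared by all distributions, whereas applying a distribution of
  order N termwise needs weights summable against (1 + |t|)^N, with N unbounded. The weights are
  therefore products of two groups of rescaled sinc factors: the first fixes the constant, the
  second provides convergence.\<close>

lemma ennreal_powr_top [simp]: "ennreal_powr \<infinity> a = \<infinity>"
  by (simp add: ennreal_powr_def)

lemma ennreal_powr_top' [simp]: "ennreal_powr top a = top"
  by (simp add: ennreal_powr_def)

lemma ennreal_powr_ennreal: "0 \<le> x \<Longrightarrow> ennreal_powr (ennreal x) a = ennreal (x powr a)"
  by (simp add: ennreal_powr_def)

lemma ennreal_powr_0 [simp]: "ennreal_powr 0 a = 0"
  by (simp add: ennreal_powr_def)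

lemma ennreal_powr_one [simp]: "ennreal_powr 1 a = 1"
  by (simp add: ennreal_powr_def)

lemma ennreal_powr_1 [simp]: "ennreal_powr x 1 = x"
  by (cases x) (auto simp: ennreal_powr_def top_unique)

lemma ennreal_powr_mono: "0 \<le> a \<Longrightarrow> x \<le> y \<Longrightarrow> ennreal_powr x a \<le> ennreal_powr y a"
  by (cases x; cases y) (auto simp: ennreal_powr_def top_unique powr_mono2)

lemma ennreal_powr_powr: "ennreal_powr (ennreal_powr x a) b = ennreal_powr x (a * b)"
  by (cases x) (auto simp: ennreal_powr_def powr_powr)

lemma ennreal_powr_mult:
  "0 < a \<Longrightarrow> ennreal_powr (x * y) a = ennreal_powr x a * ennreal_powr y a"
  by (cases x; cases y)
     (auto simp: ennreal_powr_def powr_mult ennreal_mult[symmetric] ennreal_top_mult ennreal_mult_top)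

lemma ennreal_powr_eq_0_iff [simp]: "ennreal_powr x a = 0 \<longleftrightarrow> x = 0"
  by (cases x) (auto simp: ennreal_powr_def)

lemma ennreal_powr_le_iff: "0 < a \<Longrightarrow> ennreal_powr x a \<le> y \<longleftrightarrow> x \<le> ennreal_powr y (1 / a)"
  using ennreal_powr_mono[of a x "ennreal_powr y (1/a)"]
    ennreal_powr_mono[of "1/a" "ennreal_powr x a" y]
  by (auto simp: ennreal_powr_powr)

lemma ennreal_powr_SUP:
  assumes "0 < a"
  shows "ennreal_powr (SUP i\<in>I. f i) a = (SUP i\<in>I. ennreal_powr (f i) a)"
proof (rule antisym)
  show "ennreal_powr (SUP i\<in>I. f i) a \<le> (SUP i\<in>I. ennreal_powr (f i) a)"
    unfolding ennreal_powr_le_iff[OF assms]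
  proof (rule SUP_least)
    fix i assume "i \<in> I"
    then show "f i \<le> ennreal_powr (SUP i\<in>I. ennreal_powr (f i) a) (1 / a)"
      unfolding ennreal_powr_le_iff[OF assms, symmetric] by (rule SUP_upper)
  qed
  show "(SUP i\<in>I. ennreal_powr (f i) a) \<le> ennreal_powr (SUP i\<in>I. f i) a"
    using assms by (intro SUP_least ennreal_powr_mono SUP_upper) auto
qed

lemma borel_measurable_ennreal_powr [measurable (raw)]:
  assumes "f \<in> borel_measurable M"
  shows "(\<lambda>x. ennreal_powr (f x) a) \<in> borel_measurable M"
  using assms unfolding ennreal_powr_def by measurable

text \<open>The fractions u / (u + v) and v / (u + v) sum to 1 and lie in [0, 1], so raising them to
  a power at most 1 can only enlarge them.\<close>

lemma ennreal_powr_add_le: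
  assumes "0 < a" "a \<le> 1"
  shows "ennreal_powr (x + y) a \<le> ennreal_powr x a + ennreal_powr y a"
proof (cases "x = \<infinity> \<or> y = \<infinity>")
  case False
  then obtain u v where uv: "x = ennreal u" "y = ennreal v" "0 \<le> u" "0 \<le> v"
    by (cases x; cases y) auto
  have "(u + v) powr a \<le> u powr a + v powr a"
  proof (cases "u + v = 0")
    case False
    then have s: "u + v > 0" using uv by auto
    have "u / (u+v) \<le> (u/(u+v)) powr a" "v / (u+v) \<le> (v/(u+v)) powr a"
      using powr_mono'[of a 1 "u/(u+v)"] powr_mono'[of a 1 "v/(u+v)"] assms uv s by auto
    moreover have "u/(u+v) + v/(u+v) = 1" using s by (simp flip: add_divide_distrib)
    ultimately have "1 \<le> (u/(u+v)) powr a + (v/(u+v)) powr a" by linarith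
    then show ?thesis using s uv by (simp add: powr_divide field_simps)
  qed (use uv in auto)
  then show ?thesis using uv by (simp add: ennreal_powr_ennreal ennreal_plus[symmetric] del: ennreal_plus)
qed auto

lemma ennreal_suminf_ge: "h k \<le> (\<Sum>k. h k)" for h :: "nat \<Rightarrow> ennreal"
  using sum_le_suminf[of h "{k}"] by (simp only: summableI finite.intros) simp

lemma ennreal_powr_suminf_le:
  assumes "0 < a" "a \<le> 1"
  shows "ennreal_powr (\<Sum>n. x n) a \<le> (\<Sum>n. ennreal_powr (x n) a)"
proof -
  have fin: "ennreal_powr (sum x {..<N}) a \<le> (\<Sum>n<N. ennreal_powr (x n) a)" for N
  proof (induction N)
    case (Suc N)
    then show ?case using ennreal_powr_add_le[OF assms, of "sum x {..<N}" "x N"] 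
      by (simp) (meson add_right_mono order_trans)
  qed auto
  have "ennreal_powr (\<Sum>n. x n) a = (SUP N. ennreal_powr (sum x {..<N}) a)"
    using assms by (simp add: suminf_eq_SUP ennreal_powr_SUP)
  also have "\<dots> \<le> (\<Sum>n. ennreal_powr (x n) a)"
    by (intro SUP_least order_trans[OF fin] sum_le_suminf) auto
  finally show ?thesis .
qed

text \<open>Convexity of the power, applied to u / l and v / (1 - l) with weights l and 1 - l. The
  parameter l stays free so that it can later be fitted to the ratio of two norms, which yields the
  triangle inequality with constant 1.\<close>

lemma ennreal_powr_add_le_convex:
  assumes "1 \<le> p" "0 < l" "l < 1"
  shows "ennreal_powr (x + y) p \<le>
    ennreal (l powr (1 - p)) * ennreal_powr x p + ennreal ((1 - l) powr (1 - p)) * ennreal_powr y p"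
proof (cases "x = \<infinity> \<or> y = \<infinity>")
  case True
  then show ?thesis using assms by (auto simp: ennreal_mult_top)
next
  case False
  then obtain u v where uv: "x = ennreal u" "y = ennreal v" "0 \<le> u" "0 \<le> v"
    by (cases x; cases y) auto
  consider "u = 0" | "v = 0" | "u > 0" "v > 0" using uv by linarith
  then have "(u+v) powr p \<le> l powr (1-p) * u powr p + (1-l) powr (1-p) * v powr p"
  proof cases
    case 3
    have "(l *\<^sub>R (u/l) + (1-l) *\<^sub>R (v/(1-l))) powr p \<le> l * (u/l) powr p + (1-l) * (v/(1-l)) powr p"
    using convex_onD[OF powr_convex[OF assms(1)], of "1 - l" "u/l" "v/(1-l)"] assms 3 by auto
  also have "l *\<^sub>R (u/l) + (1-l) *\<^sub>R (v/(1-l)) = u + v" using assms by simp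
  also have "l * (u/l) powr p = l powr (1-p) * u powr p"
    using assms uv by (simp add: powr_divide powr_diff field_simps)
  also have "(1-l) * (v/(1-l)) powr p = (1-l) powr (1-p) * v powr p"
    using assms uv by (simp add: powr_divide powr_diff)
  finally show ?thesis .
  next
    case 1
    have "1 \<le> (1-l) powr (1-p)" using assms powr_mono'[of "1-p" 0 "1-l"] by simp
    then show ?thesis using 1 mult_right_mono[of 1 "(1-l) powr (1-p)" "v powr p"] by simp
  next
    case 2
    have "1 \<le> l powr (1-p)" using assms powr_mono'[of "1-p" 0 l] by simp
    then show ?thesis using 2 mult_right_mono[of 1 "l powr (1-p)" "u powr p"] by simp
  qed
  then show ?thesis using uv
    by (simp add: ennreal_powr_ennreal ennreal_plus[symmetric] ennreal_mult[symmetric] del: ennreal_plus)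
qed

section \<open>Minkowski's inequality for Lebesgue norms\<close>

lemma Lp_norm_ennreal:
  "0 \<le> p \<Longrightarrow> Lp_norm (ennreal p) M g = ennreal_powr (\<integral>\<^sup>+ t. ennreal_powr (g t) p \<partial>M) (1 / p)"
  by (simp add: Lp_norm_def)

lemma Lp_norm_mono: "0 \<le> p \<Longrightarrow> (\<And>t. f t \<le> g t) \<Longrightarrow> Lp_norm (ennreal p) M f \<le> Lp_norm (ennreal p) M g"
  by (auto simp: Lp_norm_ennreal intro!: ennreal_powr_mono nn_integral_mono)

lemma Lp_norm_cmult:
  assumes "0 < p" "f \<in> borel_measurable M"
  shows "Lp_norm (ennreal p) M (\<lambda>t. c * f t) = c * Lp_norm (ennreal p) M f"
  using assms by (simp add: Lp_norm_ennreal ennreal_powr_mult nn_integral_cmult ennreal_powr_powr)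

lemma Lp_norm_eq_0_iff:
  assumes "0 < p" "f \<in> borel_measurable M"
  shows "Lp_norm (ennreal p) M f = 0 \<longleftrightarrow> (AE t in M. f t = 0)"
  using assms by (simp add: Lp_norm_ennreal nn_integral_0_iff_AE)

lemma Lp_norm_powr:
  assumes "0 < p" "0 < a"
  shows "ennreal_powr (Lp_norm (ennreal p) M f) a = Lp_norm (ennreal (p / a)) M (\<lambda>t. ennreal_powr (f t) a)"
  using assms by (simp add: Lp_norm_ennreal ennreal_powr_powr)

lemma Lp_norm_cong_AE:
  "0 \<le> p \<Longrightarrow> (AE t in M. f t = g t) \<Longrightarrow> Lp_norm (ennreal p) M f = Lp_norm (ennreal p) M g"
  by (auto simp: Lp_norm_ennreal intro!: arg_cong2[where f=ennreal_powr] nn_integral_cong_AE)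

lemma Lp_norm_add_le:
  assumes p: "1 \<le> p" and [measurable]: "f \<in> borel_measurable M" "g \<in> borel_measurable M"
  shows "Lp_norm (ennreal p) M (\<lambda>t. f t + g t) \<le> Lp_norm (ennreal p) M f + Lp_norm (ennreal p) M g"
    (is "?N (\<lambda>t. f t + g t) \<le> ?N f + ?N g")
proof -
  have p0: "0 < p" using p by simp
  consider "?N f = \<infinity> \<or> ?N g = \<infinity>" | "?N f = 0" | "?N g = 0"
    | a b where "?N f = ennreal a" "?N g = ennreal b" "a > 0" "b > 0"
    by (cases "?N f"; cases "?N g") (auto simp: less_le)
  then show ?thesis
  proof cases
    case 2
    then have "AE t in M. f t + g t = g t"
      using Lp_norm_eq_0_iff[OF p0, of f M] by (auto elim!: AE_mp)
    from Lp_norm_cong_AE[OF _ this, of p] show ?thesis using p0 2 by simp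
  next
    case 3
    then have "AE t in M. f t + g t = f t"
      using Lp_norm_eq_0_iff[OF p0, of g M] by (auto elim!: AE_mp)
    from Lp_norm_cong_AE[OF _ this, of p] show ?thesis using p0 3 by simp
  next
    case (4 a b)
    \<comment> \<open>With l equal to the share of \<open>f\<close> in the sum of the norms, the two
      convexity weights recombine to exactly (a + b) powr p. The degenerate norms 0 and \<infinity>
      are split off beforehand because l must lie strictly between 0 and 1.\<close>
    define l where "l = a / (a + b)"
    have l: "0 < l" "l < 1" "1 - l = b / (a+b)" using 4 by (auto simp: l_def field_simps)
    have fa: "(\<integral>\<^sup>+ t. ennreal_powr (f t) p \<partial>M) = ennreal (a powr p)"
      and ga: "(\<integral>\<^sup>+ t. ennreal_powr (g t) p \<partial>M) = ennreal (b powr p)"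
      using p0 arg_cong[OF 4(1), of "\<lambda>x. ennreal_powr x p"]
        arg_cong[OF 4(2), of "\<lambda>x. ennreal_powr x p"] 4(3,4)
      by (simp_all add: Lp_norm_ennreal ennreal_powr_powr ennreal_powr_ennreal)
    have "(\<integral>\<^sup>+ t. ennreal_powr (f t + g t) p \<partial>M) \<le>
      (\<integral>\<^sup>+ t. ennreal (l powr (1 - p)) * ennreal_powr (f t) p + ennreal ((1 - l) powr (1 - p)) * ennreal_powr (g t) p \<partial>M)"
      by (intro nn_integral_mono ennreal_powr_add_le_convex p l)
    also have "\<dots> = ennreal (l powr (1 - p)) * ennreal (a powr p) + ennreal ((1 - l) powr (1 - p)) * ennreal (b powr p)"
      by (simp add: nn_integral_add nn_integral_cmult fa ga)
    also have "\<dots> = ennreal (l powr (1 - p) * a powr p + (1 - l) powr (1 - p) * b powr p)"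
      by (simp add: ennreal_mult)
    also have "l powr (1 - p) * a powr p + (1 - l) powr (1 - p) * b powr p = (a + b) powr p"
    proof -
      have aux: "(c / (a + b)) powr (1 - p) * c powr p = (a+b) powr (p - 1) * c" if "c > 0" for c
      proof -
        have "(a+b) powr (p-1) = 1 / (a+b) powr (1-p)"
          using powr_minus_divide[of "a+b" "1-p"] by simp
        moreover have "c powr (1-p) * c powr p = c"
          using that powr_add[of c "1-p" p] by simp
        ultimately show ?thesis using 4 that by (simp add: powr_divide)
      qed
      have "l powr (1 - p) * a powr p = (a+b) powr (p - 1) * a"
        unfolding l_def using 4 by (intro aux) auto
      moreover have "(1-l) powr (1 - p) * b powr p = (a+b) powr (p - 1) * b"
        unfolding l(3) using 4 by (intro aux) auto
      moreover have "(a+b) powr (p - 1) * (a+b) = (a+b) powr p"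
        using 4 by (simp add: powr_diff)
      ultimately show ?thesis by (simp add: distrib_left)
    qed
    finally have "?N (\<lambda>t. f t + g t) \<le> ennreal_powr (ennreal ((a+b) powr p)) (1/p)"
      using p0 by (simp add: Lp_norm_ennreal ennreal_powr_mono)
    also have "\<dots> = ?N f + ?N g"
      using 4 p0 by (simp add: ennreal_powr_ennreal powr_powr)
    finally show ?thesis .
  qed auto
qed

text \<open>Finite sums follow by induction; the passage to the limit is monotone convergence, since
  \<open>ennreal_powr\<close> commutes with suprema.\<close>

lemma Lp_norm_suminf_le:
  fixes f :: "nat \<Rightarrow> 'a \<Rightarrow> ennreal"
  assumes p: "1 \<le> p" and [measurable]: "\<And>n. f n \<in> borel_measurable M"
  shows "Lp_norm (ennreal p) M (\<lambda>t. \<Sum>n. f n t) \<le> (\<Sum>n. Lp_norm (ennreal p) M (f n))"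
proof -
  have fin: "Lp_norm (ennreal p) M (\<lambda>t. \<Sum>n<N. f n t) \<le> (\<Sum>n<N. Lp_norm (ennreal p) M (f n))" for N
  proof (induction N)
    case 0
    then show ?case using p by (simp add: Lp_norm_ennreal)
  next
    case (Suc N)
    then show ?case using Lp_norm_add_le[OF p, of "\<lambda>t. \<Sum>n<N. f n t" M "f N"]
      by simp (meson add_right_mono order_trans)
  qed
  have "(\<integral>\<^sup>+ t. ennreal_powr (\<Sum>n. f n t) p \<partial>M) = (\<integral>\<^sup>+ t. (SUP N. ennreal_powr (\<Sum>n<N. f n t) p) \<partial>M)"
    using p by (simp add: suminf_eq_SUP ennreal_powr_SUP)
  also have "\<dots> = (SUP N. \<integral>\<^sup>+ t. ennreal_powr (\<Sum>n<N. f n t) p \<partial>M)"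
    using p by (intro nn_integral_monotone_convergence_SUP)
      (auto simp: incseq_def le_fun_def intro!: ennreal_powr_mono sum_mono2)
  finally have "Lp_norm (ennreal p) M (\<lambda>t. \<Sum>n. f n t) = (SUP N. Lp_norm (ennreal p) M (\<lambda>t. \<Sum>n<N. f n t))"
    using p by (simp add: Lp_norm_ennreal ennreal_powr_SUP)
  also have "\<dots> \<le> (\<Sum>n. Lp_norm (ennreal p) M (f n))"
    by (intro SUP_least order_trans[OF fin] sum_le_suminf) auto
  finally show ?thesis .
qed

section \<open>Sequence norms as Lebesgue norms over counting measure\<close>

lemma nn_integral_count_space_eq_suminf:
  assumes "bij e"
  shows "(\<integral>\<^sup>+ m. f m \<partial>count_space UNIV) = (\<Sum>n::nat. f (e n))"
  by (simp add: nn_integral_bij_count_space[OF assms, symmetric] nn_integral_count_space_nat)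

lemma infsum_eq_nn_integral_count_space:
  fixes f :: "'k \<Rightarrow> ennreal" and e :: "nat \<Rightarrow> 'k"
  assumes "bij e"
  shows "infsum f UNIV = (\<integral>\<^sup>+ m. f m \<partial>count_space UNIV)"
proof -
  have "infsum f UNIV = infsum (\<lambda>n. f (e n)) UNIV"
    using infsum_reindex_bij_betw[OF assms, of f] by simp
  also have "((\<lambda>n. f (e n)) has_sum infsum (\<lambda>n. f (e n)) UNIV) UNIV"
    by (intro has_sum_infsum nonneg_summable_on_complete) auto
  then have "infsum (\<lambda>n. f (e n)) UNIV = (\<Sum>n. f (e n))"
    using has_sum_imp_sums sums_unique by blast
  finally show ?thesis
    by (simp add: nn_integral_count_space_eq_suminf[OF assms])
qed

text \<open>With sequences treated as functions on a counting space, one Minkowski inequality serves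
  both the inner and the outer norm of a Herz space.\<close>

lemma lq_norm_eq_Lp_norm:
  fixes e :: "nat \<Rightarrow> 'k"
  assumes "bij e" "0 \<le> q"
  shows "lq_norm (ennreal q) f = Lp_norm (ennreal q) (count_space (UNIV :: 'k set)) f"
  using assms by (simp add: lq_norm_def Lp_norm_ennreal infsum_eq_nn_integral_count_space[OF assms(1)])

lemma lq_norm_int: "0 \<le> q \<Longrightarrow> lq_norm (ennreal q) (f :: int \<Rightarrow> ennreal) = Lp_norm (ennreal q) (count_space UNIV) f"
  by (rule lq_norm_eq_Lp_norm[OF bij_int_decode])

lemma lq_norm_nat: "0 \<le> q \<Longrightarrow> lq_norm (ennreal q) (f :: nat \<Rightarrow> ennreal) = Lp_norm (ennreal q) (count_space UNIV) f"
  by (rule lq_norm_eq_Lp_norm[OF bij_id])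

section \<open>Herz norms\<close>

text \<open>The piece is taken over \<open>lborel\<close> instead of \<open>lebesgue\<close>:
  completing a measure does not change nonnegative integrals, and Fubini arguments as well as Borel
  measurability are more convenient there.\<close>

definition herz_piece :: "real \<Rightarrow> real \<Rightarrow> (real \<Rightarrow> ennreal) \<Rightarrow> int \<Rightarrow> ennreal" where
  "herz_piece \<alpha> p g k = ennreal (2 powr (of_int k * \<alpha>)) *
     Lp_norm (ennreal p) lborel (\<lambda>t. g t * indicator (dyadic_annulus k) t)"

lemma herz_norm_eq:
  assumes "0 \<le> p" "0 \<le> q"
  shows "herz_norm \<alpha> (ennreal p) (ennreal q) g = Lp_norm (ennreal q) (count_space UNIV) (herz_piece \<alpha> p g)"
  using assms by (simp add: herz_norm_def lq_norm_int herz_piece_def[abs_def] Lp_norm_ennreal nn_integral_completion)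

lemma dyadic_annulus_sets [measurable]: "dyadic_annulus k \<in> sets borel"
  unfolding dyadic_annulus_def by measurable

lemma herz_norm_mono:
  assumes "0 \<le> p" "0 \<le> q" "\<And>t. f t \<le> g t"
  shows "herz_norm \<alpha> (ennreal p) (ennreal q) f \<le> herz_norm \<alpha> (ennreal p) (ennreal q) g"
  using assms by (simp add: herz_norm_eq)
    (auto intro!: Lp_norm_mono mult_left_mono mult_right_mono simp: herz_piece_def)

lemma herz_norm_cmult:
  assumes "0 < p" "0 < q" and [measurable]: "f \<in> borel_measurable borel"
  shows "herz_norm \<alpha> (ennreal p) (ennreal q) (\<lambda>t. c * f t) = c * herz_norm \<alpha> (ennreal p) (ennreal q) f"
proof -
  have "herz_piece \<alpha> p (\<lambda>t. c * f t) k = c * herz_piece \<alpha> p f k" for k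
    unfolding herz_piece_def using assms by (simp add: mult.assoc Lp_norm_cmult mult.left_commute)
  then have "herz_piece \<alpha> p (\<lambda>t. c * f t) = (\<lambda>k. c * herz_piece \<alpha> p f k)" by auto
  then show ?thesis using assms by (simp add: herz_norm_eq Lp_norm_cmult)
qed

lemma herz_norm_suminf_le:
  fixes f :: "nat \<Rightarrow> real \<Rightarrow> ennreal"
  assumes "1 \<le> p" "1 \<le> q" and [measurable]: "\<And>n. f n \<in> borel_measurable borel"
  shows "herz_norm \<alpha> (ennreal p) (ennreal q) (\<lambda>t. \<Sum>n. f n t) \<le> (\<Sum>n. herz_norm \<alpha> (ennreal p) (ennreal q) (f n))"
proof -
  have "herz_piece \<alpha> p (\<lambda>t. \<Sum>n. f n t) k \<le> (\<Sum>n. herz_piece \<alpha> p (f n) k)" for k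
    unfolding herz_piece_def ennreal_suminf_cmult ennreal_suminf_multc[symmetric]
    using assms by (intro mult_left_mono Lp_norm_suminf_le) auto
  then have "Lp_norm (ennreal q) (count_space UNIV) (herz_piece \<alpha> p (\<lambda>t. \<Sum>n. f n t)) \<le>
      Lp_norm (ennreal q) (count_space UNIV) (\<lambda>k. \<Sum>n. herz_piece \<alpha> p (f n) k)"
    using assms by (intro Lp_norm_mono) auto
  also have "\<dots> \<le> (\<Sum>n. Lp_norm (ennreal q) (count_space UNIV) (herz_piece \<alpha> p (f n)))"
    using assms by (intro Lp_norm_suminf_le) auto
  finally show ?thesis using assms by (simp add: herz_norm_eq)
qed

lemma herz_norm_powr:
  assumes "0 < p" "0 < q" "0 < a"
  shows "ennreal_powr (herz_norm \<alpha> (ennreal p) (ennreal q) g) a =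
    herz_norm (a * \<alpha>) (ennreal (p / a)) (ennreal (q / a)) (\<lambda>t. ennreal_powr (g t) a)"
proof -
  have "ennreal_powr (herz_piece \<alpha> p g k) a = herz_piece (a * \<alpha>) (p / a) (\<lambda>t. ennreal_powr (g t) a) k" for k
  proof -
    have "ennreal_powr (g t * indicator (dyadic_annulus k) t) a =
        ennreal_powr (g t) a * indicator (dyadic_annulus k) t" for t
      by (auto split: split_indicator)
    then show ?thesis unfolding herz_piece_def
      using assms by (simp add: ennreal_powr_mult Lp_norm_powr ennreal_powr_ennreal powr_powr mult_ac)
  qed
  then have "(\<lambda>k. ennreal_powr (herz_piece \<alpha> p g k) a) = herz_piece (a * \<alpha>) (p / a) (\<lambda>t. ennreal_powr (g t) a)"
    by auto
  then show ?thesis using assms by (simp add: herz_norm_eq Lp_norm_powr)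
qed

lemma borel_measurable_Lp_norm:
  assumes "sigma_finite_measure M" "case_prod F \<in> borel_measurable (N \<Otimes>\<^sub>M M)" "0 \<le> p"
  shows "(\<lambda>x. Lp_norm (ennreal p) M (F x)) \<in> borel_measurable N"
proof -
  interpret sigma_finite_measure M by fact
  have [measurable]: "(\<lambda>(x, y). ennreal_powr (F x y) p) \<in> borel_measurable (N \<Otimes>\<^sub>M M)"
    using borel_measurable_ennreal_powr[OF assms(2), of p] by (simp add: case_prod_beta)
  show ?thesis using assms(3) by (simp add: Lp_norm_ennreal)
qed

lemma borel_measurable_herz_norm:
  assumes [measurable]: "case_prod F \<in> borel_measurable (N \<Otimes>\<^sub>M borel)" and "0 \<le> p" "0 \<le> q"
  shows "(\<lambda>x. herz_norm \<alpha> (ennreal p) (ennreal q) (F x)) \<in> borel_measurable N"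
proof -
  have m: "(\<lambda>(x,t). F x t * indicator (dyadic_annulus k) t) \<in> borel_measurable (N \<Otimes>\<^sub>M lborel)" for k
    by (simp add: case_prod_beta) measurable
  have [measurable]: "(\<lambda>x. herz_piece \<alpha> p (F x) k) \<in> borel_measurable N" for k
  proof -
    have [measurable]: "(\<lambda>x. Lp_norm (ennreal p) lborel (\<lambda>t. F x t * indicator (dyadic_annulus k) t)) \<in> borel_measurable N"
      by (rule borel_measurable_Lp_norm[OF _ m]) (use assms in \<open>auto simp: lborel.sigma_finite_measure_axioms\<close>)
    show ?thesis unfolding herz_piece_def by measurable
  qed
  show ?thesis using assms(2,3)
    by (simp add: herz_norm_eq Lp_norm_ennreal nn_integral_count_space_eq_suminf[OF bij_int_decode])
qed

section \<open>Geometric convolutions and interpolated sums\<close>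

lemma suminf_le_nn_integral_count_space:
  fixes e :: "nat \<Rightarrow> 'k"
  assumes "inj e"
  shows "(\<Sum>k. f (e k)) \<le> (\<integral>\<^sup>+ m. f m \<partial>count_space UNIV)"
proof -
  have "(\<Sum>k. f (e k)) = (\<integral>\<^sup>+ m. f m \<partial>count_space (range e))"
    by (simp add: nn_integral_bij_count_space[OF inj_on_imp_bij_betw[OF assms], symmetric] nn_integral_count_space_nat)
  also have "\<dots> \<le> (\<integral>\<^sup>+ m. f m \<partial>count_space UNIV)"
    by (subst nn_integral_count_space_indicator) (auto intro!: nn_integral_mono split: split_indicator)
  finally show ?thesis .
qed

definition geom_mass :: "real \<Rightarrow> ennreal" where
  "geom_mass \<gamma> = (\<integral>\<^sup>+ d. ennreal (2 powr (- \<gamma> * \<bar>of_int d\<bar>)) \<partial>count_space (UNIV :: int set))"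

lemma geom_mass_finite:
  assumes "0 < \<gamma>"
  shows "geom_mass \<gamma> < \<infinity>"
proof -
  let ?f = "\<lambda>n::nat. ennreal ((2 powr (- \<gamma>)) ^ n)"
  \<comment> \<open>The nonnegative and the nonpositive indices are summed separately; d = 0 is
    counted twice, which an upper bound allows.\<close>
  have "geom_mass \<gamma> \<le> (\<integral>\<^sup>+ d. (\<Sum>n. ?f n * indicator {int n} d) + (\<Sum>n. ?f n * indicator {- int n} d) \<partial>count_space UNIV)"
    unfolding geom_mass_def
  proof (intro nn_integral_mono)
    fix d :: int
    have e: "ennreal (2 powr (- \<gamma> * \<bar>of_int d\<bar>)) = ?f (nat \<bar>d\<bar>)"
      by (subst powr_realpow[symmetric]) (auto simp: powr_powr)
    have "?f n * indicator {int n} d \<le> (\<Sum>n. ?f n * indicator {int n} d)"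
      "?f n * indicator {- int n} d \<le> (\<Sum>n. ?f n * indicator {- int n} d)" for n
      by (rule ennreal_suminf_ge)+
    from this[of "nat \<bar>d\<bar>"]
    show "ennreal (2 powr (- \<gamma> * \<bar>of_int d\<bar>)) \<le> (\<Sum>n. ?f n * indicator {int n} d) + (\<Sum>n. ?f n * indicator {- int n} d)"
      unfolding e by (cases "d \<ge> 0") (auto intro: add_increasing2 add_increasing)
  qed
  also have "\<dots> = (\<Sum>n. ?f n) + (\<Sum>n. ?f n)"
    by (simp add: nn_integral_add nn_integral_suminf nn_integral_cmult)
  also have "\<dots> < \<infinity>"
  proof -
    have "summable (\<lambda>n. (2 powr (- \<gamma>)) ^ n)" using assms by (intro summable_geometric) (simp add: powr_less_one)
    then show ?thesis by (simp add: suminf_ennreal2 ennreal_suminf_neq_top less_top[symmetric])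
  qed
  finally show ?thesis .
qed

lemma nn_integral_int_shift:
  "(\<integral>\<^sup>+ m. f (m + d :: int) \<partial>count_space UNIV) = (\<integral>\<^sup>+ m. f m \<partial>count_space UNIV)"
  by (rule nn_integral_bij_count_space) (auto intro!: bij_betwI[where g="\<lambda>x. x - d"])

lemma geom_mass_shift:
  "(\<integral>\<^sup>+ m. ennreal (2 powr (- \<gamma> * \<bar>of_int (m - j)\<bar>)) \<partial>count_space (UNIV :: int set)) = geom_mass \<gamma>"
  using nn_integral_int_shift[of "\<lambda>m. ennreal (2 powr (- \<gamma> * \<bar>of_int m\<bar>))" "-j"]
  by (simp add: geom_mass_def)

text \<open>Young's inequality on the integers: the convolution is a weighted sum of translates of
  \<open>b\<close>, to which Minkowski's inequality and translation invariance apply.\<close>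

lemma Lp_norm_geom_convolution:
  assumes "1 \<le> R"
  shows "Lp_norm (ennreal R) (count_space (UNIV :: int set))
      (\<lambda>j. \<integral>\<^sup>+ m. ennreal (2 powr (- \<gamma> * \<bar>of_int (m - j)\<bar>)) * b m \<partial>count_space UNIV)
    \<le> geom_mass \<gamma> * Lp_norm (ennreal R) (count_space UNIV) b"
proof -
  let ?g = "\<lambda>d::int. ennreal (2 powr (- \<gamma> * \<bar>of_int d\<bar>))"
  have shift: "Lp_norm (ennreal R) (count_space UNIV) (\<lambda>j. b (j + d)) = Lp_norm (ennreal R) (count_space UNIV) b" for d
    using assms nn_integral_int_shift[of "\<lambda>j. ennreal_powr (b j) R" d] by (simp add: Lp_norm_ennreal)
  have "(\<integral>\<^sup>+ m. ?g (m - j) * b m \<partial>count_space UNIV) = (\<Sum>n. ?g (int_decode n) * b (j + int_decode n))" for j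
    using nn_integral_int_shift[of "\<lambda>m. ?g (m - j) * b m" j]
    by (subst (asm) nn_integral_count_space_eq_suminf[OF bij_int_decode]) (simp add: add.commute)
  then have "Lp_norm (ennreal R) (count_space UNIV) (\<lambda>j. \<integral>\<^sup>+ m. ?g (m - j) * b m \<partial>count_space UNIV)
     = Lp_norm (ennreal R) (count_space UNIV) (\<lambda>j. \<Sum>n. ?g (int_decode n) * b (j + int_decode n))" by simp
  also have "\<dots> \<le> (\<Sum>n. Lp_norm (ennreal R) (count_space UNIV) (\<lambda>j. ?g (int_decode n) * b (j + int_decode n)))"
    using assms by (intro Lp_norm_suminf_le) auto
  also have "\<dots> = (\<Sum>n. ?g (int_decode n)) * Lp_norm (ennreal R) (count_space UNIV) b"
    using assms by (simp add: Lp_norm_cmult shift)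
  also have "(\<Sum>n. ?g (int_decode n)) = geom_mass \<gamma>"
    unfolding geom_mass_def by (simp only: nn_integral_count_space_eq_suminf[OF bij_int_decode])
  finally show ?thesis .
qed

text \<open>The two regimes of the minimum cross at \<open>k = Q log\<^sub>2 (w / D)\<close>, away from which the terms decay geometrically.\<close>

lemma suminf_min_le:
  assumes "0 < Q" "Q < P"
  obtains C where "0 < C" and "\<And>w D. (\<Sum>k. ennreal (2 powr (- real k * (1/Q - 1/P))) * min w (ennreal (2 powr (real k / Q)) * D))
    \<le> ennreal C * (ennreal_powr w (Q/P) * ennreal_powr D (1 - Q/P))"
proof -
  define \<eta> where "\<eta> = 1/Q - 1/P"
  \<comment> \<open>The slower of the two decay rates: below the crossing the terms grow like 2 powr
    (k / P), above it they decrease like 2 powr (- k \<eta>).\<close>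
  define \<gamma> where "\<gamma> = min (1/P) \<eta>"
  have \<eta>: "0 < \<eta>" using assms by (simp add: \<eta>_def field_simps)
  have \<gamma>: "0 < \<gamma>" "\<gamma> \<le> 1/P" "\<gamma> \<le> \<eta>" using assms \<eta> by (auto simp: \<gamma>_def)
  obtain G where G: "geom_mass \<gamma> = ennreal G" "0 \<le> G"
    using geom_mass_finite[OF \<gamma>(1)] by (cases "geom_mass \<gamma>") auto
  \<comment> \<open>The summand 1 makes \<open>C\<close> visibly positive, so that the right-hand
    side really is infinite when one of w and D is infinite and the other nonzero.\<close>
  define C where "C = 2 powr \<gamma> * G + 1"
  have "(\<Sum>k. ennreal (2 powr (- real k * \<eta>)) * min w (ennreal (2 powr (real k / Q)) * D))
    \<le> ennreal C * (ennreal_powr w (Q/P) * ennreal_powr D (1 - Q/P))" for w D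
  proof -
    consider "w = 0 \<or> D = 0" | "w \<noteq> 0" "D \<noteq> 0" "w = \<infinity> \<or> D = \<infinity>" | w' D' where "w = ennreal w'" "D = ennreal D'" "0 < w'" "0 < D'"
      by (cases w; cases D) (auto simp: less_le)
    then show ?thesis
    proof cases
      case 2
      have "ennreal_powr w (Q/P) \<noteq> 0" "ennreal_powr D (1-Q/P) \<noteq> 0" "ennreal C \<noteq> 0"
        using 2 G by (auto simp: C_def add_pos_nonneg intro!: add_nonneg_pos)
      then have "ennreal C * (ennreal_powr w (Q/P) * ennreal_powr D (1 - Q/P)) = \<infinity>"
        using 2(3) by (auto simp: ennreal_mult_top ennreal_top_mult)
      then show ?thesis by simp
    next
      case (3 w' D')
      define x where "x = Q * log 2 (w' / D')"
      \<comment> \<open>The common value of the two regimes at the crossing, which turns out to be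
        the interpolated quantity w powr (Q / P) * D powr (1 - Q / P).\<close>
      define E where "E = D' * 2 powr (x / P)"
      have w': "w' = D' * 2 powr (x / Q)" using assms 3 by (simp add: x_def)
      have "w' powr (Q/P) * D' powr (1 - Q/P) = E"
        using assms 3 unfolding w' E_def by (simp add: powr_mult powr_powr powr_diff)
      then have E: "ennreal_powr w (Q/P) * ennreal_powr D (1 - Q/P) = ennreal E"
        using 3 by (simp add: ennreal_powr_ennreal ennreal_mult[symmetric])
      have E0: "E > 0" using 3 by (simp add: E_def)
      have le: "2 powr (- real k * \<eta>) * min w' (2 powr (real k / Q) * D') \<le> 
        (2 powr \<gamma> * E) * 2 powr (- \<gamma> * \<bar>of_int (int k - \<lfloor>x\<rfloor>)\<bar>)" for k :: nat
      proof -
        have "2 powr (- real k * \<eta>) * min w' (2 powr (real k / Q) * D') \<le> E * 2 powr (- \<gamma> * \<bar>real k - x\<bar>)"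
        proof (cases "real k \<le> x")
          case True
          have "2 powr (- real k * \<eta>) * min w' (2 powr (real k / Q) * D') \<le> 2 powr (- real k * \<eta>) * (2 powr (real k / Q) * D')"
            by (intro mult_left_mono) auto
          also have "\<dots> = D' * 2 powr (real k / P)"
            by (simp add: powr_add[symmetric] \<eta>_def algebra_simps)
          also have "\<dots> = E * 2 powr ((real k - x) * (1/P))"
            by (simp add: E_def powr_add[symmetric] diff_divide_distrib)
          also have "\<dots> \<le> E * 2 powr (- \<gamma> * \<bar>real k - x\<bar>)"
            using True E0 \<gamma> mult_left_mono[OF \<gamma>(2), of "x - real k"] by (auto simp: algebra_simps)
          finally show ?thesis .
        next
          case False
          have "2 powr (- real k * \<eta>) * min w' (2 powr (real k / Q) * D') \<le> 2 powr (- real k * \<eta>) * w'"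
            by (intro mult_left_mono) auto
          also have "\<dots> = E * 2 powr (- \<eta> * (real k - x))"
            by (simp add: E_def w' powr_add[symmetric] \<eta>_def algebra_simps diff_divide_distrib)
          also have "\<dots> \<le> E * 2 powr (- \<gamma> * \<bar>real k - x\<bar>)"
            using False E0 \<gamma> mult_right_mono[OF \<gamma>(3), of "real k - x"] by auto
          finally show ?thesis .
        qed
        \<comment> \<open>Rounding the crossing point down to an integer costs the factor 2 powr
          \<gamma> and makes \<open>geom_mass\<close> applicable.\<close>
        also have "\<dots> \<le> E * 2 powr (\<gamma> + - \<gamma> * \<bar>of_int (int k - \<lfloor>x\<rfloor>)\<bar>)"
        proof -
          have "\<bar>of_int (int k - \<lfloor>x\<rfloor>)\<bar> \<le> 1 + \<bar>real k - x\<bar>" by simp linarith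
          from mult_left_mono[OF this, of \<gamma>] show ?thesis using \<gamma> E0 by (auto simp: algebra_simps)
        qed
        also have "\<dots> = (2 powr \<gamma> * E) * 2 powr (- \<gamma> * \<bar>of_int (int k - \<lfloor>x\<rfloor>)\<bar>)"
          by (simp only: powr_add mult_ac)
        finally show ?thesis .
      qed
      have "(\<Sum>k. ennreal (2 powr (- real k * \<eta>)) * min w (ennreal (2 powr (real k / Q)) * D)) \<le>
         (\<Sum>k. ennreal (2 powr \<gamma> * E) * ennreal (2 powr (- \<gamma> * \<bar>of_int (int k - \<lfloor>x\<rfloor>)\<bar>)))"
      proof (intro suminf_le allI)
        fix k :: nat
        have "min w (ennreal (2 powr (real k / Q)) * D) = ennreal (min w' (2 powr (real k / Q) * D'))"
          using 3 by (simp add: ennreal_mult[symmetric] min_def)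
        then show "ennreal (2 powr (- real k * \<eta>)) * min w (ennreal (2 powr (real k / Q)) * D) \<le>
           ennreal (2 powr \<gamma> * E) * ennreal (2 powr (- \<gamma> * \<bar>of_int (int k - \<lfloor>x\<rfloor>)\<bar>))"
          using le[of k] 3 E0 by (simp add: ennreal_mult[symmetric] ennreal_leI del: of_int_diff)
      qed auto
      also have "\<dots> = ennreal (2 powr \<gamma> * E) * (\<Sum>k. ennreal (2 powr (- \<gamma> * \<bar>of_int (int k - \<lfloor>x\<rfloor>)\<bar>)))"
        by simp
      also have "\<dots> \<le> ennreal (2 powr \<gamma> * E) * geom_mass \<gamma>"
        unfolding geom_mass_shift[symmetric, of \<gamma> "\<lfloor>x\<rfloor>"]
        by (intro mult_left_mono suminf_le_nn_integral_count_space[of int "\<lambda>m. ennreal (2 powr (- \<gamma> * \<bar>of_int (m - \<lfloor>x\<rfloor>)\<bar>))"]) auto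
      also have "\<dots> \<le> ennreal C * ennreal E"
        using E0 G by (auto simp: C_def ennreal_mult[symmetric] algebra_simps intro!: ennreal_leI)
      finally show ?thesis unfolding E .
    qed auto
  qed
  moreover have "0 < C" using G by (simp add: C_def add_nonneg_pos)
  ultimately show ?thesis using that unfolding \<eta>_def by blast
qed

text \<open>Hoelder's inequality for a kernel of height s and mass A, by cutting \<open>W\<close> at
  a level l: values up to l are charged to the mass, and larger ones satisfy W \<le> l powr (1 - Q)
  * W powr Q and are charged to the height. The factor that vanishes with \<open>W\<close> confines
  both hypotheses on the kernel to the set where \<open>W\<close> lives, later one annulus.\<close>

lemma nn_integral_kernel_le:
  assumes Q: "1 \<le> Q" and [measurable]: "W \<in> borel_measurable M" "\<kappa> \<in> borel_measurable M"
    and \<kappa>: "\<And>y. W y \<noteq> 0 \<Longrightarrow> 0 \<le> \<kappa> y \<and> \<kappa> y \<le> s"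
    and A: "(\<integral>\<^sup>+ y. ennreal (\<kappa> y) * (if W y = 0 then 0 else 1) \<partial>M) \<le> ennreal A"
    and pos: "0 < A" "0 < s"
  shows "(\<integral>\<^sup>+ y. ennreal (\<kappa> y) * W y \<partial>M) \<le> ennreal (2 * A powr (1 - 1/Q) * s powr (1/Q)) * Lp_norm (ennreal Q) M W"
proof -
  let ?N = "Lp_norm (ennreal Q) M W"
  have Q0: "0 < Q" using Q by simp
  consider "?N = \<infinity>" | "?N = 0" | N where "?N = ennreal N" "0 < N" by (cases ?N) (auto simp: less_le)
  then show ?thesis
  proof cases
    case 1
    have "0 < 2 * A powr (1 - 1/Q) * s powr (1/Q)" using pos by simp
    then show ?thesis using 1 pos by (simp add: ennreal_mult_top)
  next
    case 2
    then have "AE y in M. ennreal (\<kappa> y) * W y = 0" using Lp_norm_eq_0_iff[OF Q0, of W M] by auto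
    then have "(\<integral>\<^sup>+ y. ennreal (\<kappa> y) * W y \<partial>M) = (\<integral>\<^sup>+ y. 0 \<partial>M)" by (rule nn_integral_cong_AE)
    then show ?thesis by simp
  next
    case (3 N)
    \<comment> \<open>The level at which both charges are equal, whence the factor 2 in the
      bound.\<close>
    define l where "l = (s / A) powr (1/Q) * N"
    have l: "0 < l" using pos 3 by (simp add: l_def)
    have WN: "(\<integral>\<^sup>+ y. ennreal_powr (W y) Q \<partial>M) = ennreal (N powr Q)"
      using arg_cong[OF 3(1), of "\<lambda>x. ennreal_powr x Q"] Q0 3(2)
      by (simp add: Lp_norm_ennreal ennreal_powr_powr ennreal_powr_ennreal)
    have pt: "ennreal (\<kappa> y) * W y \<le> ennreal l * (ennreal (\<kappa> y) * (if W y = 0 then 0 else 1)) +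
        ennreal (s * l powr (1 - Q)) * ennreal_powr (W y) Q" for y
    proof (cases "W y = 0")
      case False
      note kb = \<kappa>[OF this]
      show ?thesis
      proof (cases "W y")
        case top
        have "0 < s * l powr (1 - Q)" using pos l by simp
        then show ?thesis using top pos l by (simp add: ennreal_mult_top)
      next
        case (real w)
        have "\<kappa> y * w \<le> l * \<kappa> y + s * l powr (1 - Q) * w powr Q"
        proof (cases "w \<le> l")
          case True
          then have "\<kappa> y * w \<le> l * \<kappa> y" using kb mult_left_mono[OF True, of "\<kappa> y"] by (simp add: mult.commute)
          moreover have "0 \<le> s * l powr (1 - Q) * w powr Q" using pos by simp
          ultimately show ?thesis by linarith
        next
          case False
          have "w = w powr (1-Q) * w powr Q" using False l powr_add[of w "1-Q" Q] by simp
          also have "\<dots> \<le> l powr (1-Q) * w powr Q"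
            using False l Q by (intro mult_right_mono powr_mono2') auto
          finally have "s * w \<le> s * (l powr (1-Q) * w powr Q)" using pos by simp
          moreover have "\<kappa> y * w \<le> s * w" using kb real by (intro mult_right_mono) auto
          ultimately show ?thesis using kb l by (simp add: mult.assoc add_increasing)
        qed
        then show ?thesis using False real kb l pos
          by (simp add: ennreal_powr_ennreal ennreal_mult[symmetric] ennreal_plus[symmetric] del: ennreal_plus)
      qed
    qed simp
    have "(\<integral>\<^sup>+ y. ennreal (\<kappa> y) * W y \<partial>M) \<le> ennreal l * (\<integral>\<^sup>+ y. ennreal (\<kappa> y) * (if W y = 0 then 0 else 1) \<partial>M)
        + ennreal (s * l powr (1 - Q)) * ennreal (N powr Q)"
      by (subst WN[symmetric], subst nn_integral_cmult[symmetric], simp, subst nn_integral_cmult[symmetric], simp,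
          subst nn_integral_add[symmetric]) (auto intro!: nn_integral_mono pt)
    also have "\<dots> \<le> ennreal l * ennreal A + ennreal (s * l powr (1 - Q)) * ennreal (N powr Q)"
      by (intro add_right_mono mult_left_mono A) auto
    also have "\<dots> = ennreal (l * A + s * l powr (1 - Q) * N powr Q)"
      using l pos by (simp add: ennreal_mult)
    also have "l * A = A powr (1 - 1/Q) * s powr (1/Q) * N"
      using pos by (simp add: l_def powr_divide powr_diff)
    also have "s * l powr (1 - Q) * N powr Q = A powr (1 - 1/Q) * s powr (1/Q) * N"
    proof -
      have "l powr (1-Q) = ((s / A) powr (1/Q)) powr (1-Q) * N powr (1-Q)"
        using pos 3 by (simp add: l_def powr_mult)
      also have "((s / A) powr (1/Q)) powr (1-Q) = (s/A) powr (1/Q - 1)"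
        using Q0 by (simp add: powr_powr diff_divide_distrib)
      also have "\<dots> = s powr (1/Q) / s * (A powr (1 - 1/Q))"
        using pos powr_minus_divide[of A "1 - 1/Q"] by (simp add: powr_divide powr_diff)
      finally have "s * l powr (1-Q) * N powr Q = A powr (1-1/Q) * s powr (1/Q) * (N powr (1-Q) * N powr Q)"
        using pos by simp
      also have "N powr (1-Q) * N powr Q = N" using 3 powr_add[of N "1-Q" Q] by simp
      finally show ?thesis .
    qed
    finally show ?thesis using pos 3 by (simp add: ennreal_mult[symmetric] mult_ac)
  qed
qed

section \<open>Averages over dyadic annuli\<close>

text \<open>This is pi times the Poisson kernel of height 1 / l. Its total mass does not depend on
  l.\<close>

definition cauchy_kernel :: "real \<Rightarrow> real \<Rightarrow> real" where
  "cauchy_kernel l v = l / (1 + (l * v)\<^sup>2)"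

lemma cauchy_kernel_measurable [measurable]: "cauchy_kernel l \<in> borel_measurable borel"
  unfolding cauchy_kernel_def[abs_def] by measurable

lemma integrable_1_over_1_plus_square: "integrable lborel (\<lambda>v::real. 1 / (1 + v\<^sup>2))"
  using integrable_inverse_1_plus_square by (simp add: set_integrable_def inverse_eq_divide)

lemma nn_integral_inverse_1_plus_square:
  "(\<integral>\<^sup>+ v. ennreal (1 / (1 + v\<^sup>2)) \<partial>lborel) = ennreal pi"
proof -
  have "(LBINT v. 1 / (1 + v\<^sup>2)) = pi"
    using LBINT_inverse_1_plus_square
    by (simp add: interval_lebesgue_integral_def set_lebesgue_integral_def inverse_eq_divide)
  then show ?thesis using integrable_1_over_1_plus_square by (subst nn_integral_eq_integral) auto
qed

lemma nn_integral_dilation: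
  fixes f :: "real \<Rightarrow> ennreal"
  assumes [measurable]: "f \<in> borel_measurable borel" and l: "0 < l"
  shows "(\<integral>\<^sup>+ v. f v \<partial>lborel) = ennreal l * (\<integral>\<^sup>+ y. f (l * (t - y)) \<partial>lborel)"
  using nn_integral_real_affine[of f "- l" "l * t"] l by (simp add: algebra_simps)

lemma nn_integral_cauchy_kernel:
  assumes "0 < l"
  shows "(\<integral>\<^sup>+ y. ennreal (cauchy_kernel l (t - y)) \<partial>lborel) = ennreal pi"
proof -
  have "(\<integral>\<^sup>+ y. ennreal (cauchy_kernel l (t - y)) \<partial>lborel) = ennreal l * (\<integral>\<^sup>+ y. ennreal (1 / (1 + (l * (t - y))\<^sup>2)) \<partial>lborel)"
    using assms by (subst nn_integral_cmult[symmetric]) (auto simp: cauchy_kernel_def ennreal_mult[symmetric] intro!: nn_integral_cong)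
  also have "\<dots> = ennreal pi"
    by (subst nn_integral_dilation[symmetric, of "\<lambda>v. ennreal (1 / (1 + v\<^sup>2))"])
      (use assms in \<open>auto simp: nn_integral_inverse_1_plus_square\<close>)
  finally show ?thesis .
qed

lemma powi_eq_powr: "(2::real) powi k = 2 powr of_int k"
  by (simp add: powr_real_of_int')

lemma dyadic_annulus_iff:
  "t \<in> dyadic_annulus k \<longleftrightarrow> 2 powr (of_int k - 1) \<le> \<bar>t\<bar> \<and> \<bar>t\<bar> < 2 powr (of_int k)"
  unfolding dyadic_annulus_def by (simp add: powi_eq_powr)

lemma dyadic_annulus_ex1:
  assumes "t \<noteq> 0"
  shows "\<exists>!k. t \<in> dyadic_annulus k"
proof -
  have "t \<in> dyadic_annulus k \<longleftrightarrow> k = \<lfloor>log 2 \<bar>t\<bar>\<rfloor> + 1" for k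
  proof -
    have "t \<in> dyadic_annulus k \<longleftrightarrow> of_int k - 1 \<le> log 2 \<bar>t\<bar> \<and> log 2 \<bar>t\<bar> < of_int k"
      using assms by (simp add: dyadic_annulus_iff le_log_iff log_less_iff)
    also have "\<dots> \<longleftrightarrow> k = \<lfloor>log 2 \<bar>t\<bar>\<rfloor> + 1" by linarith
    finally show ?thesis .
  qed
  then show ?thesis by auto
qed

lemma emeasure_dyadic_annulus_le: "emeasure lborel (dyadic_annulus k) \<le> ennreal (2 powr (of_int k + 1))"
proof -
  have "emeasure lborel (dyadic_annulus k) \<le> emeasure lborel {- (2 powr of_int k) .. (2::real) powr of_int k}"
    by (intro emeasure_mono) (auto simp: dyadic_annulus_iff)
  also have "\<dots> = ennreal (2 powr (of_int k + 1))" by (simp add: powr_add)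
  finally show ?thesis .
qed

text \<open>The annuli partition the line without the origin, and a single point is a null
  set.\<close>

lemma nn_integral_dyadic_decomposition:
  assumes [measurable]: "f \<in> borel_measurable borel"
  shows "(\<integral>\<^sup>+ y. f y \<partial>lborel) = (\<integral>\<^sup>+ m. (\<integral>\<^sup>+ y. f y * indicator (dyadic_annulus m) y \<partial>lborel) \<partial>count_space UNIV)"
proof -
  have pt: "f y = (\<Sum>n. f y * indicator (dyadic_annulus (int_decode n)) y)" if y0: "y \<noteq> 0" for y
  proof -
    obtain k where k: "y \<in> dyadic_annulus m \<longleftrightarrow> m = k" for m
      using dyadic_annulus_ex1[OF y0] by auto
    have "(\<Sum>n. f y * indicator (dyadic_annulus (int_decode n)) y) =
       (\<integral>\<^sup>+ m. f y * indicator (dyadic_annulus m) y \<partial>count_space UNIV)"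
      by (rule nn_integral_count_space_eq_suminf[OF bij_int_decode, symmetric])
    also have "\<dots> = (\<integral>\<^sup>+ m. f y * indicator {k} m \<partial>count_space UNIV)"
      by (intro nn_integral_cong) (auto simp: k split: split_indicator)
    finally show ?thesis by (simp add: nn_integral_cmult)
  qed
  have "AE y in lborel. f y = (\<Sum>n. f y * indicator (dyadic_annulus (int_decode n)) y)"
    using AE_lborel_singleton[of "0::real"] by eventually_elim (rule pt)
  then have "(\<integral>\<^sup>+ y. f y \<partial>lborel) = (\<integral>\<^sup>+ y. (\<Sum>n. f y * indicator (dyadic_annulus (int_decode n)) y) \<partial>lborel)"
    by (rule nn_integral_cong_AE)
  also have "\<dots> = (\<Sum>n. \<integral>\<^sup>+ y. f y * indicator (dyadic_annulus (int_decode n)) y \<partial>lborel)"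
    by (intro nn_integral_suminf) auto
  also have "\<dots> = (\<integral>\<^sup>+ m. (\<integral>\<^sup>+ y. f y * indicator (dyadic_annulus m) y \<partial>lborel) \<partial>count_space UNIV)"
    by (rule nn_integral_count_space_eq_suminf[OF bij_int_decode, symmetric])
  finally show ?thesis .
qed

lemma cauchy_kernel_far:
  assumes "0 < l" "0 < d" "d \<le> \<bar>v\<bar>"
  shows "cauchy_kernel l v \<le> 1 / (l * d\<^sup>2)"
proof -
  have "d\<^sup>2 \<le> v\<^sup>2" using assms by (metis abs_le_square_iff abs_of_pos)
  then have "l\<^sup>2 * d\<^sup>2 \<le> 1 + (l * v)\<^sup>2" using assms by (simp add: power_mult_distrib add_increasing)
  then have "cauchy_kernel l v \<le> l / (l\<^sup>2 * d\<^sup>2)"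
    unfolding cauchy_kernel_def using assms by (intro divide_left_mono) (auto simp: add_pos_nonneg)
  also have "\<dots> = 1 / (l * d\<^sup>2)" using assms by (simp add: power2_eq_square)
  finally show ?thesis .
qed

lemma cauchy_kernel_le: "0 < l \<Longrightarrow> cauchy_kernel l v \<le> l"
  unfolding cauchy_kernel_def by (simp add: divide_le_eq add_pos_nonneg)

lemma cauchy_kernel_nonneg: "0 < l \<Longrightarrow> 0 \<le> cauchy_kernel l v"
  unfolding cauchy_kernel_def by simp

text \<open>The mass of \<open>W\<close> on the annulus of index \<open>m\<close> contributes to the average at scale \<open>2 powr (-k)\<close> around
  \<open>t\<close> as if \<open>t\<close> had size \<open>2 powr l\<close>, where \<open>l\<close> is the larger of the two logarithmic sizes.\<close>

lemma cauchy_average_annulus_le: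
  fixes W :: "real \<Rightarrow> ennreal" and k :: nat and j m :: int
  assumes Q: "1 \<le> Q" and a: "- 1 / Q < \<alpha>" "0 < \<epsilon>" "\<epsilon> \<le> 1" "\<epsilon> \<le> 1 - 1 / Q - \<alpha>"
    and W [measurable]: "W \<in> borel_measurable borel" and t: "t \<in> dyadic_annulus j"
    and l: "l = max j (- int k)"
  shows "(\<integral>\<^sup>+ y. ennreal (cauchy_kernel (2 ^ (k + 1)) (t - y)) * (W y * indicator (dyadic_annulus m) y) \<partial>lborel)
    \<le> ennreal (2 ^ 8 * 2 powr (\<bar>\<alpha>\<bar>) * 2 powr (real k / Q) * 2 powr (- of_int l * \<alpha>))
       * (ennreal (2 powr (- \<epsilon> * \<bar>of_int (m - l)\<bar>)) * herz_piece \<alpha> Q W m)"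
proof -
  let ?\<kappa> = "\<lambda>y. cauchy_kernel (2 ^ (k + 1)) (t - y)" and ?W = "\<lambda>y. W y * indicator (dyadic_annulus m) y"
  let ?u = "1 - 1/Q"
  let ?E = "real k / Q - of_int l * \<alpha> - \<epsilon> * \<bar>of_int (m - l)\<bar> + of_int m * \<alpha>"
    and ?I = "\<integral>\<^sup>+ y. ennreal (?\<kappa> y) * ?W y \<partial>lborel" and ?L = "Lp_norm (ennreal Q) lborel ?W"
  let ?K = "2 ^ 8 * 2 powr \<bar>\<alpha>\<bar> * 2 powr ?E"
  have u: "0 \<le> ?u" "?u \<le> 1" using Q by auto
  have lam: "(2::real) ^ (k+1) = 2 powr (real k + 1)" by (simp add: powr_add powr_realpow)
  have kl: "0 \<le> real k + of_int l" using l by (simp add: max_def)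
  have tl: "\<bar>t\<bar> < 2 powr (of_int l)"
    using t l by (auto simp: dyadic_annulus_iff intro: less_le_trans)
  have supp: "y \<in> dyadic_annulus m" if "?W y \<noteq> 0" for y
    using that by (auto split: split_indicator_asm)
  have gen: "?I \<le> ennreal (2 * A powr (1 - 1/Q) * s powr (1/Q)) * ?L"
    if "\<And>y. y \<in> dyadic_annulus m \<Longrightarrow> ?\<kappa> y \<le> s" "0 < s" "0 < A"
     "(\<integral>\<^sup>+ y. ennreal (?\<kappa> y) * (if ?W y = 0 then 0 else 1) \<partial>lborel) \<le> ennreal A" for s A
  proof (rule nn_integral_kernel_le[OF Q])
    show "0 \<le> ?\<kappa> y \<and> ?\<kappa> y \<le> s" if "?W y \<noteq> 0" for y
      using supp[OF that] \<open>\<And>y. y \<in> dyadic_annulus m \<Longrightarrow> ?\<kappa> y \<le> s\<close>[of y] by (simp add: cauchy_kernel_nonneg)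
    show "?W \<in> borel_measurable lborel" "?\<kappa> \<in> borel_measurable lborel" by measurable
  qed (use that in blast)+
  \<comment> \<open>The mass of the kernel on the annulus is estimated by s times a bound for the
    length, after which the powers of s coming from mass and height multiply to s itself.\<close>
  have far: "?I \<le> ennreal (4 * 2 powr (of_int m * ?u) * s) * ?L"
    if s: "\<And>y. y \<in> dyadic_annulus m \<Longrightarrow> ?\<kappa> y \<le> s" "0 < s" for s
  proof -
    have "(\<integral>\<^sup>+ y. ennreal (?\<kappa> y) * (if ?W y = 0 then 0 else 1) \<partial>lborel) \<le> (\<integral>\<^sup>+ y. ennreal s * indicator (dyadic_annulus m) y \<partial>lborel)"
      using s(1) by (intro nn_integral_mono) (auto intro!: ennreal_leI split: split_indicator)
    also have "\<dots> \<le> ennreal s * ennreal (2 powr (of_int m + 1))"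
      by (simp add: nn_integral_cmult mult_left_mono emeasure_dyadic_annulus_le)
    also have "\<dots> = ennreal (s * 2 powr (of_int m + 1))" using s(2) by (simp add: ennreal_mult)
    finally have "?I \<le> ennreal (2 * (s * 2 powr (of_int m + 1)) powr ?u * s powr (1/Q)) * ?L"
      using s by (intro gen) auto
    also have "2 * (s * 2 powr (of_int m + 1)) powr ?u * s powr (1/Q) = 2 * 2 powr ((of_int m + 1) * ?u) * s"
    proof -
      have h1: "s powr ?u * s powr (1/Q) = s" using s(2) powr_add[of s ?u "1/Q"] by simp
      have h2: "(s * 2 powr (of_int m + 1)) powr ?u = s powr ?u * 2 powr ((of_int m + 1) * ?u)"
        using s(2) by (simp only: powr_mult powr_powr)
      have "2 * (s * 2 powr (of_int m + 1)) powr ?u * s powr (1/Q) = 2 * 2 powr ((of_int m + 1) * ?u) * (s powr ?u * s powr (1/Q))"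
        unfolding h2 by (simp only: mult_ac)
      then show ?thesis unfolding h1 .
    qed
    also have "\<dots> \<le> 4 * 2 powr (of_int m * ?u) * s"
    proof -
      have "2 powr ((of_int m + 1) * ?u) \<le> 2 powr (1 + of_int m * ?u)" using u by (simp add: algebra_simps)
      also have "\<dots> = 2 * 2 powr (of_int m * ?u)" by (simp add: powr_add)
      finally show ?thesis using s(2) by simp
    qed
    finally show ?thesis by (simp add: ennreal_leI mult_right_mono)
  qed
  have fin: ?thesis if "?I \<le> ennreal c * ?L"
    "c \<le> ?K" for c
  proof -
    note that(1)
    also have "ennreal c * ?L \<le>
      ennreal (?K) * ?L"
      using that(2) by (intro mult_right_mono ennreal_leI) auto
    also have "\<dots> = ennreal (2 ^ 8 * 2 powr (\<bar>\<alpha>\<bar>) * 2 powr (real k / Q) * 2 powr (- of_int l * \<alpha>))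
       * (ennreal (2 powr (- \<epsilon> * \<bar>of_int (m - l)\<bar>)) * herz_piece \<alpha> Q W m)"
      unfolding herz_piece_def mult.assoc[symmetric]
      by (simp add: ennreal_mult[symmetric] powr_add[symmetric] powr_diff[symmetric] mult.assoc)
         (simp add: algebra_simps)
    finally show ?thesis .
  qed
  have half: "(2::real) powr (x - 1) - 2 powr (x - 2) = 2 powr (x - 2)" "(2::real) powr (x - 1) = 2 * 2 powr (x - 2)" for x
    by (simp_all add: powr_diff)
  \<comment> \<open>The bound \<open>cauchy_kernel_far\<close> at distance 2 powr (x - 2). The
    exponent - k - 2 x is written through k + x, because k + l \<ge> 0 is the inequality available
    later.\<close>
  have s8: "1 / ((2::real) ^ (k+1) * (2 powr (x - 2))\<^sup>2) = 8 * 2 powr (real k - 2 * (real k + x))" for x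
  proof -
    have "(2::real) ^ (k+1) * (2 powr (x - 2))\<^sup>2 = 2 powr (real k + 1 + 2 * (x - 2))"
      unfolding lam by (simp add: powr_add power2_eq_square powr_realpow[symmetric] flip: powr_add)
    moreover have "8 * (2::real) powr (real k - 2 * (real k + x)) = 2 powr (3 + (real k - 2 * (real k + x)))"
      unfolding powr_add by simp
    moreover have "3 + (real k - 2 * (real k + x)) = - (real k + 1 + 2 * (x - 2))" by simp
    ultimately show ?thesis by (simp only: powr_minus_divide)
  qed
  have const: "4 * x * (8 * y) \<le> 2 ^ 8 * a * e" if "x * y \<le> a * e" "0 \<le> a * e" for x y a e :: real
  proof -
    have "4 * x * (8 * y) = 32 * (x * y)" "2 ^ 8 * a * e = 256 * (a * e)" by simp_all
    then show ?thesis using that by linarith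
  qed
  have const': "4 * x * y \<le> 2 ^ 8 * a * e" if "x * y \<le> 2 * (a * e)" "0 \<le> a * e" for x y a e :: real
  proof -
    have "4 * x * y = 4 * (x * y)" "2 ^ 8 * a * e = 256 * (a * e)" by simp_all
    then show ?thesis using that by linarith
  qed
  \<comment> \<open>Neighbouring annuli use the full mass of the kernel. Inner annuli use that y
    keeps the distance 2 powr (l - 2) from t, or just the height of the kernel when l = - k and its
    width covers them anyway. Outer annuli use the distance 2 powr (m - 2).\<close>
  consider "\<bar>m - l\<bar> \<le> 1" | "m \<le> l - 2" "l = j" | "m \<le> l - 2" "l = - int k" | "l + 2 \<le> m"
    using l by linarith
  then show ?thesis
  proof cases
    case 1
    have "(\<integral>\<^sup>+ y. ennreal (?\<kappa> y) * (if ?W y = 0 then 0 else 1) \<partial>lborel) \<le> (\<integral>\<^sup>+ y. ennreal (?\<kappa> y) \<partial>lborel)"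
      by (intro nn_integral_mono) auto
    also have "\<dots> = ennreal pi" by (rule nn_integral_cauchy_kernel) auto
    also have "\<dots> \<le> ennreal 4" using pi_less_4 by (intro ennreal_leI) auto
    finally have "?I \<le> ennreal (2 * 4 powr ?u * (2 ^ (k+1)) powr (1/Q)) * ?L"
      by (intro gen) (auto intro!: cauchy_kernel_le)
    then show ?thesis
    proof (rule fin)
      have "4 powr ?u \<le> 4 powr (1::real)" using u by (intro powr_mono) auto
      moreover have "((2::real) ^ (k+1)) powr (1/Q) = 2 powr (1/Q) * 2 powr (real k / Q)"
        unfolding lam by (simp add: powr_powr flip: powr_add) (simp add: add_divide_distrib add.commute)
      moreover have "2 powr (1/Q) \<le> 2 powr (1::real)" using Q by (intro powr_mono) auto
      ultimately have "2 * 4 powr ?u * (2 ^ (k+1)) powr (1/Q) \<le> 2 * 4 * (2 * 2 powr (real k / Q))"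
        by (intro mult_mono) auto
      also have "\<dots> = 16 * 2 powr (real k / Q)" by simp
      also have "\<dots> \<le> 16 * 2 powr (4 + \<bar>\<alpha>\<bar> + (?E))"
      proof -
        have "\<epsilon> * \<bar>of_int (m - l)\<bar> \<le> 1" using 1 a mult_mono[of \<epsilon> 1 "\<bar>of_int (m-l)\<bar>" 1] by linarith
        moreover have "\<bar>of_int (m - l) * \<alpha>\<bar> \<le> \<bar>\<alpha>\<bar>" using 1 mult_right_mono[of "\<bar>of_int (m-l)\<bar>" 1 "\<bar>\<alpha>\<bar>"] by (simp add: abs_mult)
        ultimately show ?thesis by (simp add: algebra_simps)
      qed
      also have "\<dots> = ?K"
        by (simp add: powr_add)
      finally show "2 * 4 powr ?u * (2 ^ (k+1)) powr (1/Q) \<le> \<dots>" .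
    qed
  next
    case 2
    show ?thesis
    proof (rule fin[OF far])
      fix y assume "y \<in> dyadic_annulus m"
      then have "\<bar>y\<bar> < 2 powr (of_int m)" by (simp add: dyadic_annulus_iff)
      also have "\<dots> \<le> 2 powr (of_int l - 2)" using 2 by simp
      finally have "2 powr (of_int l - 2) \<le> \<bar>t - y\<bar>"
        using t 2(2) half(2)[of "of_int l"] by (auto simp: dyadic_annulus_iff)
      then have "?\<kappa> y \<le> 1 / (2 ^ (k+1) * (2 powr (of_int l - 2))\<^sup>2)"
        by (intro cauchy_kernel_far) auto
      then show "?\<kappa> y \<le> 8 * 2 powr (real k - 2 * (real k + of_int l))" unfolding s8 .
    next
      \<comment> \<open>Decay towards the origin: m - l is negative and \<alpha> + \<epsilon> \<le>
        1 - 1 / Q by the choice of \<epsilon>, while the second summand is nonpositive because k + l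
        \<ge> 0.\<close>
      have "(of_int m - of_int l) * ?u + (real k + of_int l) * (?u - 2) \<le> (of_int m - of_int l) * (\<alpha> + \<epsilon>)"
      proof -
        have "(real k + of_int l) * (?u - 2) \<le> 0" using u(2) by (intro mult_nonneg_nonpos kl) linarith
        moreover have "(of_int m - of_int l) * ?u \<le> (of_int m - of_int l) * (\<alpha> + \<epsilon>)"
          using 2 a by (intro mult_left_mono_neg) auto
        ultimately show ?thesis by linarith
      qed
      then have "of_int m * ?u + (real k - 2 * (real k + of_int l)) \<le> \<bar>\<alpha>\<bar> + (?E)"
        using 2 by (simp add: algebra_simps diff_divide_distrib)
      then have "2 powr (of_int m * ?u + (real k - 2 * (real k + of_int l))) \<le> (2::real) powr (\<bar>\<alpha>\<bar> + (?E))"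
        by (intro powr_mono) auto
      then show "4 * 2 powr (of_int m * ?u) * (8 * 2 powr (real k - 2 * (real k + of_int l))) \<le> ?K"
        by (intro const) (simp_all only: powr_add, simp)
    qed auto
  next
    case 3
    show ?thesis
    proof (rule fin[OF far])
      fix y 
      show "?\<kappa> y \<le> 2 ^ (k+1)" by (rule cauchy_kernel_le) simp
    next
      have "(of_int m - of_int l) * ?u \<le> (of_int m - of_int l) * (\<alpha> + \<epsilon>)"
        using 3 a u mult_left_mono_neg[of "\<alpha>+\<epsilon>" ?u "of_int m - of_int l"] by simp
      moreover have "real k = - of_int l" using 3 by simp
      ultimately have "of_int m * ?u + (real k + 1) \<le> 1 + \<bar>\<alpha>\<bar> + (?E)"
        using 3(1) by (simp add: algebra_simps diff_divide_distrib)
      then have "2 powr (of_int m * ?u + (real k + 1)) \<le> (2::real) powr (1 + \<bar>\<alpha>\<bar> + (?E))"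
        by (intro powr_mono) auto
      then show "4 * 2 powr (of_int m * ?u) * 2 ^ (k+1) \<le> ?K"
        unfolding lam by (intro const') (simp_all only: powr_add powr_one, simp_all)
    qed auto
  next
    case 4
    show ?thesis
    proof (rule fin[OF far])
      fix y assume "y \<in> dyadic_annulus m"
      moreover have "\<bar>t\<bar> < 2 powr (of_int m - 2)"
        by (rule less_le_trans[OF tl]) (use 4 in simp)
      ultimately have "2 powr (of_int m - 2) \<le> \<bar>t - y\<bar>"
        using half(2)[of "of_int m"] by (auto simp: dyadic_annulus_iff)
      then have "?\<kappa> y \<le> 1 / (2 ^ (k+1) * (2 powr (of_int m - 2))\<^sup>2)"
        by (intro cauchy_kernel_far) auto
      then show "?\<kappa> y \<le> 8 * 2 powr (real k - 2 * (real k + of_int m))" unfolding s8 .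
    next
      \<comment> \<open>Decay towards infinity: the quadratic decay of the kernel leaves the
        exponent - 1 - 1 / Q, which is below \<alpha> - \<epsilon> because \<alpha> > - 1 / Q and
        \<epsilon> \<le> 1.\<close>
      have "(real k + of_int m) * (- 1 - 1/Q) \<le> (of_int m - of_int l) * (- 1 - 1/Q)"
      proof (intro mult_right_mono_neg)
        have "0 \<le> 1/Q" using Q by simp
        then show "- 1 - 1/Q \<le> 0" by linarith
      qed (use kl in auto)
      also have "\<dots> \<le> (of_int m - of_int l) * (\<alpha> - \<epsilon>)"
        using 4 a by (intro mult_left_mono) auto
      finally have "of_int m * ?u + (real k - 2 * (real k + of_int m)) \<le> \<bar>\<alpha>\<bar> + (?E)"
        using 4 by (simp add: algebra_simps diff_divide_distrib)
      then have "2 powr (of_int m * ?u + (real k - 2 * (real k + of_int m))) \<le> (2::real) powr (\<bar>\<alpha>\<bar> + (?E))"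
        by (intro powr_mono) auto
      then show "4 * 2 powr (of_int m * ?u) * (8 * 2 powr (real k - 2 * (real k + of_int m))) \<le> ?K"
        by (intro const) (simp_all only: powr_add, simp)
    qed auto
  qed
qed

lemma ennreal_powr_add: "0 < a \<Longrightarrow> 0 < b \<Longrightarrow> ennreal_powr x a * ennreal_powr x b = ennreal_powr x (a + b)"
  by (cases x) (auto simp: ennreal_powr_def ennreal_mult[symmetric] powr_add)

text \<open>The substitution y = t - v / 2^(k + 1) turns the average into an integral against the
  dilated kernel, whose contributions from the single annuli are then added.\<close>

lemma cauchy_average_le:
  fixes W :: "real \<Rightarrow> ennreal" and k :: nat
  assumes Q: "1 \<le> Q" and a: "- 1 / Q < \<alpha>" "0 < \<epsilon>" "\<epsilon> \<le> 1" "\<epsilon> \<le> 1 - 1 / Q - \<alpha>"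
    and W [measurable]: "W \<in> borel_measurable borel" and t: "t \<in> dyadic_annulus j"
    and l: "l = max j (- int k)"
  shows "(\<integral>\<^sup>+ v. ennreal (1 / (1 + v\<^sup>2)) * W (t - v / 2 ^ (k + 1)) \<partial>lborel)
    \<le> ennreal (2 ^ 8 * 2 powr (\<bar>\<alpha>\<bar>) * 2 powr (real k / Q) * 2 powr (- of_int l * \<alpha>))
       * (\<integral>\<^sup>+ m. ennreal (2 powr (- \<epsilon> * \<bar>of_int (m - l)\<bar>)) * herz_piece \<alpha> Q W m \<partial>count_space UNIV)"
proof -
  let ?l = "2 ^ (k + 1) :: real" and ?c = "ennreal (2 ^ 8 * 2 powr (\<bar>\<alpha>\<bar>) * 2 powr (real k / Q) * 2 powr (- of_int l * \<alpha>))"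
  have "(\<integral>\<^sup>+ v. ennreal (1 / (1 + v\<^sup>2)) * W (t - v / ?l) \<partial>lborel)
    = ennreal ?l * (\<integral>\<^sup>+ y. ennreal (1 / (1 + (?l * (t - y))\<^sup>2)) * W (t - (?l * (t - y)) / ?l) \<partial>lborel)"
    by (rule nn_integral_dilation) auto
  also have "\<dots> = (\<integral>\<^sup>+ y. ennreal (cauchy_kernel ?l (t - y)) * W y \<partial>lborel)"
    by (subst nn_integral_cmult[symmetric])
      (auto simp: cauchy_kernel_def ennreal_mult[symmetric] mult.assoc[symmetric] intro!: nn_integral_cong)
  also have "\<dots> = (\<integral>\<^sup>+ m. (\<integral>\<^sup>+ y. ennreal (cauchy_kernel ?l (t - y)) * W y * indicator (dyadic_annulus m) y \<partial>lborel) \<partial>count_space UNIV)"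
    by (rule nn_integral_dyadic_decomposition) measurable
  also have "\<dots> \<le> (\<integral>\<^sup>+ m. ?c * (ennreal (2 powr (- \<epsilon> * \<bar>of_int (m - l)\<bar>)) * herz_piece \<alpha> Q W m) \<partial>count_space UNIV)"
    unfolding mult.assoc[of _ "W _"] by (intro nn_integral_mono cauchy_average_annulus_le[OF assms])
  also have "\<dots> = ?c * (\<integral>\<^sup>+ m. ennreal (2 powr (- \<epsilon> * \<bar>of_int (m - l)\<bar>)) * herz_piece \<alpha> Q W m \<partial>count_space UNIV)"
    by (rule nn_integral_cmult) auto
  finally show ?thesis .
qed

lemma Lp_norm_indicator_dyadic_annulus_le:
  assumes "1 \<le> P"
  shows "Lp_norm (ennreal P) lborel (indicator (dyadic_annulus j)) \<le> ennreal (2 * 2 powr (of_int j / P))"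
proof -
  have "ennreal_powr (indicator (dyadic_annulus j) t) P = indicator (dyadic_annulus j) t" for t
    by (auto split: split_indicator)
  then have "Lp_norm (ennreal P) lborel (indicator (dyadic_annulus j)) = ennreal_powr (emeasure lborel (dyadic_annulus j)) (1/P)"
    using assms by (simp add: Lp_norm_ennreal)
  also have "\<dots> \<le> ennreal_powr (ennreal (2 powr (of_int j + 1))) (1/P)"
    using assms by (intro ennreal_powr_mono emeasure_dyadic_annulus_le) auto
  also have "\<dots> = ennreal (2 powr (1/P) * 2 powr (of_int j / P))"
  proof -
    have "(2 powr (of_int j + 1)) powr (1/P) = 2 powr (1/P + of_int j / P)"
      by (simp only: powr_powr) (simp add: add_divide_distrib add.commute)
    then show ?thesis by (subst ennreal_powr_ennreal) (simp_all only: powr_ge_zero powr_add[of 2 "1/P"])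
  qed
  also have "\<dots> \<le> ennreal (2 * 2 powr (of_int j / P))"
  proof -
    have "2 powr (1/P) \<le> 2 powr (1::real)" using assms by (intro powr_mono) auto
    then show ?thesis by (intro ennreal_leI mult_right_mono) auto
  qed
  finally show ?thesis .
qed

text \<open>The exponent of the weights splits into 1 / Q - 1 / P, which feeds the interpolation
  between \<open>W\<close> and its averages, and \<alpha>2 - \<alpha>1, which exchanges the Herz
  weights. Since \<open>W\<close> carries no index k, one number per annulus bounds, up to the
  factor 2 powr (k / Q), the averages at all scales 2 powr (- k) not exceeding its radius.\<close>

lemma herz_norm_scale_sum_le:
  assumes Q: "1 \<le> Q" "Q < P" and R: "1 \<le> R" and \<alpha>: "\<alpha>1 \<le> \<alpha>2" "- 1 / P < \<alpha>1" "\<alpha>2 < 1 - 1 / Q" and A: "0 < A"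
  obtains C where "0 < C"
    and "\<And>W (V :: nat \<Rightarrow> real \<Rightarrow> ennreal). \<lbrakk>W \<in> borel_measurable borel; \<And>k. V k \<in> borel_measurable borel; \<And>k t. V k t \<le> W t;
      \<And>k t. V k t \<le> ennreal A * (\<integral>\<^sup>+ v. ennreal (1 / (1 + v\<^sup>2)) * W (t - v / 2 ^ (k + 1)) \<partial>lborel)\<rbrakk> \<Longrightarrow>
      herz_norm \<alpha>1 (ennreal P) (ennreal R) (\<lambda>t. \<Sum>k. ennreal (2 powr (- real k * (1/Q - 1/P + \<alpha>2 - \<alpha>1))) * V k t)
        \<le> ennreal C * herz_norm \<alpha>2 (ennreal Q) (ennreal R) W"
proof -
  let ?\<delta> = "1/Q - 1/P + \<alpha>2 - \<alpha>1" and ?LP = "Lp_norm (ennreal P) lborel"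
    and ?LR = "Lp_norm (ennreal R) (count_space UNIV) :: (int \<Rightarrow> ennreal) \<Rightarrow> ennreal"
  have P: "1 \<le> P" "0 < P" "0 < Q" using Q by auto
  define \<epsilon> where "\<epsilon> = min 1 (1 - 1/Q - \<alpha>2)"
  have \<epsilon>: "0 < \<epsilon>" "\<epsilon> \<le> 1" "\<epsilon> \<le> 1 - 1/Q - \<alpha>2" using \<alpha> by (auto simp: \<epsilon>_def)
  \<comment> \<open>Up to a constant, 2 powr (j * \<gamma>) bounds the weight of the j-th annulus
    times the L^P norm of its indicator, that is, the cost of a constant function there.\<close>
  define \<gamma> where "\<gamma> = 1/P + \<alpha>1"
  have \<gamma>: "0 < \<gamma>" using \<alpha> by (simp add: \<gamma>_def)
  have aQ: "- 1/Q < \<alpha>2"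
  proof -
    have "1/P < 1/Q" using Q P by (simp add: frac_less2)
    then show ?thesis using \<alpha> by simp
  qed
  define \<eta> where "\<eta> = 1/Q - 1/P"
  \<comment> \<open>The maximum with 1 lets \<open>D\<close> below bound the norm of
    \<open>W\<close> on the annulus as well as the averages, so that the powers 1 - Q / P and Q / P
    recombine to \<open>D\<close>.\<close>
  define c where "c = max 1 (A * (2 ^ 8 * 2 powr \<bar>\<alpha>2\<bar>))"
  have c: "1 \<le> c" "A * (2 ^ 8 * 2 powr \<bar>\<alpha>2\<bar>) \<le> c" by (auto simp: c_def)
  obtain C0 where C0: "0 < C0" and
    min_le: "\<And>w D. (\<Sum>k. ennreal (2 powr (- real k * \<eta>)) * min w (ennreal (2 powr (real k / Q)) * D))
      \<le> ennreal C0 * (ennreal_powr w (Q/P) * ennreal_powr D (1 - Q/P))"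
    using suminf_min_le[OF P(3) Q(2)] unfolding \<eta>_def by blast
  obtain G where G: "geom_mass \<epsilon> * geom_mass \<gamma> = ennreal G" "0 \<le> G"
    using geom_mass_finite[OF \<epsilon>(1)] geom_mass_finite[OF \<gamma>]
    by (cases "geom_mass \<epsilon> * geom_mass \<gamma>") (auto simp: ennreal_mult_eq_top_iff)
  define C1 where "C1 = C0 * c + 2 * c"
  have C1: "0 < C1" using C0 c by (auto simp: C1_def intro!: add_pos_pos)
  define C where "C = C1 * G + 1"
  have "herz_norm \<alpha>1 (ennreal P) (ennreal R) (\<lambda>t. \<Sum>k. ennreal (2 powr (- real k * ?\<delta>)) * V k t)
        \<le> ennreal C * herz_norm \<alpha>2 (ennreal Q) (ennreal R) W"
    if W [measurable]: "W \<in> borel_measurable borel" and [measurable]: "\<And>k. V k \<in> borel_measurable borel" and VW: "\<And>k t. V k t \<le> W t"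
    and VA: "\<And>k t. V k t \<le> ennreal A * (\<integral>\<^sup>+ v. ennreal (1 / (1 + v\<^sup>2)) * W (t - v / 2 ^ (k + 1)) \<partial>lborel)"
    for W and V :: "nat \<Rightarrow> real \<Rightarrow> ennreal"
  proof -
    let ?a = "herz_piece \<alpha>2 Q W"
    let ?S = "\<lambda>t. \<Sum>k. ennreal (2 powr (- real k * ?\<delta>)) * V k t"
    \<comment> \<open>\<open>B\<close> collects the annuli that interact through the averages,
      \<open>Y\<close> in addition the scales larger than the annulus. Both are convolutions with
      two-sided geometric sequences, so Young's inequality is used twice.\<close>
    define B where "B l = (\<integral>\<^sup>+ m. ennreal (2 powr (- \<epsilon> * \<bar>of_int (m - l)\<bar>)) * ?a m \<partial>count_space UNIV)" for l :: int
    define Y where "Y j = (\<integral>\<^sup>+ m. ennreal (2 powr (- \<gamma> * \<bar>of_int (m - j)\<bar>)) * B m \<partial>count_space UNIV)" for j :: int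
    have VB: "V k t \<le> ennreal (c * 2 powr (real k / Q) * 2 powr (- of_int l * \<alpha>2)) * B l"
      if t: "t \<in> dyadic_annulus j" and l: "l = max j (- int k)" for k t j l
    proof -
      have "V k t \<le> ennreal A * (ennreal (2 ^ 8 * 2 powr (\<bar>\<alpha>2\<bar>) * 2 powr (real k / Q) * 2 powr (- of_int l * \<alpha>2)) * B l)"
        unfolding B_def by (rule order_trans[OF VA mult_left_mono[OF cauchy_average_le[OF Q(1) aQ \<epsilon> W t l]]]) auto
      also have "\<dots> = ennreal (A * (2 ^ 8 * 2 powr (\<bar>\<alpha>2\<bar>)) * 2 powr (real k / Q) * 2 powr (- of_int l * \<alpha>2)) * B l"
        using A by (simp add: mult.assoc[symmetric] ennreal_mult[symmetric])
      also have "\<dots> \<le> ennreal (c * 2 powr (real k / Q) * 2 powr (- of_int l * \<alpha>2)) * B l"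
        using c by (intro mult_right_mono ennreal_leI) auto
      finally show ?thesis .
    qed
    have aB: "?a l \<le> B l" for l
      unfolding B_def using nn_integral_ge_point[of l UNIV "\<lambda>m. ennreal (2 powr (- \<epsilon> * \<bar>of_int (m - l)\<bar>)) * ?a m"] by simp
    have BY: "B l \<le> Y l" for l
      unfolding Y_def using nn_integral_ge_point[of l UNIV "\<lambda>m. ennreal (2 powr (- \<gamma> * \<bar>of_int (m - l)\<bar>)) * B m"] by simp
    have piece: "herz_piece \<alpha>1 P ?S j \<le> ennreal C1 * Y j" for j
    proof -
      define D where "D = ennreal (c * 2 powr (- of_int j * \<alpha>2)) * B j"
      define g where "g k = (if j < - int k then ennreal (2 powr (real k * \<gamma>)) * B (- int k) else 0)" for k :: nat
      define d where "d = ennreal (2 powr (of_int j * (\<alpha>2 - \<alpha>1)) * C0) * ennreal_powr D (1 - Q/P)"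
      let ?I = "indicator (dyadic_annulus j) :: real \<Rightarrow> ennreal" and ?G = "\<Sum>k. g k"
        and ?h = "\<lambda>k. ennreal (2 powr (real k / Q)) * D"
      have S_le: "?S t \<le> d * ennreal_powr (W t) (Q/P) + ennreal c * ?G" if t: "t \<in> dyadic_annulus j" for t
      proof -
        have "ennreal (2 powr (- real k * ?\<delta>)) * V k t \<le>
           ennreal (2 powr (of_int j * (\<alpha>2 - \<alpha>1))) * (ennreal (2 powr (- real k * \<eta>)) * min (W t) (?h k))
            + ennreal c * g k" for k
        proof (cases "j < - int k")
          case True
          then have mx: "- int k = max j (- int k)" by simp
          have "ennreal (2 powr (- real k * ?\<delta>)) * V k t \<le>
            ennreal (2 powr (- real k * ?\<delta>)) * (ennreal (c * 2 powr (real k / Q) * 2 powr (- of_int (- int k) * \<alpha>2)) * B (- int k))"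
            by (intro mult_left_mono VB[OF t mx]) auto
          also have "\<dots> = ennreal (2 powr (- real k * ?\<delta>) * (c * 2 powr (real k / Q) * 2 powr (- of_int (- int k) * \<alpha>2))) * B (- int k)"
            using c by (simp add: mult.assoc[symmetric] ennreal_mult[symmetric])
          also have "2 powr (- real k * ?\<delta>) * (c * 2 powr (real k / Q) * 2 powr (- of_int (- int k) * \<alpha>2))
             = c * 2 powr (- real k * ?\<delta> + real k / Q + real k * \<alpha>2)"
          proof -
            have "- of_int (- int k) * \<alpha>2 = real k * \<alpha>2" by simp
            then show ?thesis by (simp only: powr_add ac_simps)
          qed
          also have "- real k * ?\<delta> + real k / Q + real k * \<alpha>2 = real k * \<gamma>"
            by (simp add: \<gamma>_def algebra_simps)
          also have "ennreal (c * 2 powr (real k * \<gamma>)) * B (- int k) = ennreal c * g k"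
            using True c by (simp add: g_def ennreal_mult mult.assoc)
          finally show ?thesis by (simp add: add_increasing)
        next
          case False
          then have mx: "j = max j (- int k)" by simp
          have "V k t \<le> ?h k"
            using VB[OF t mx] c by (simp add: D_def ennreal_mult mult_ac)
          then have V: "V k t \<le> min (W t) (?h k)" using VW by simp
          have "- real k * ?\<delta> \<le> of_int j * (\<alpha>2 - \<alpha>1) + - real k * \<eta>"
          proof -
            \<comment> \<open>As 2 powr (- k) \<le> 2 powr j, the part \<alpha>2 - \<alpha>1 of the
              decay can be traded for a power of the radius. This is where \<alpha>1 \<le> \<alpha>2
              enters.\<close>
            have "- real k \<le> of_int j" using False by linarith
            then have "- real k * (\<alpha>2 - \<alpha>1) \<le> of_int j * (\<alpha>2 - \<alpha>1)" using \<alpha> by (intro mult_right_mono) auto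
            then show ?thesis by (simp add: \<eta>_def algebra_simps)
          qed
          then have "2 powr (- real k * ?\<delta>) \<le> 2 powr (of_int j * (\<alpha>2 - \<alpha>1)) * 2 powr (- real k * \<eta>)"
            by (simp only: powr_add[symmetric]) simp
          then have "ennreal (2 powr (- real k * ?\<delta>)) * V k t \<le>
            ennreal (2 powr (of_int j * (\<alpha>2 - \<alpha>1)) * 2 powr (- real k * \<eta>)) * min (W t) (?h k)"
            by (intro mult_mono V ennreal_leI) auto
          also have "\<dots> = ennreal (2 powr (of_int j * (\<alpha>2 - \<alpha>1))) * (ennreal (2 powr (- real k * \<eta>)) * min (W t) (?h k))"
            by (simp add: ennreal_mult mult.assoc)
          finally show ?thesis using False by (simp add: g_def)
        qed
        then have "?S t \<le> (\<Sum>k. ennreal (2 powr (of_int j * (\<alpha>2 - \<alpha>1))) * (ennreal (2 powr (- real k * \<eta>)) * min (W t) (?h k))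
            + ennreal c * g k)"
          by (intro suminf_le) auto
        also have "\<dots> = ennreal (2 powr (of_int j * (\<alpha>2 - \<alpha>1))) * (\<Sum>k. ennreal (2 powr (- real k * \<eta>)) * min (W t) (?h k))
            + ennreal c * ?G"
          by (simp add: suminf_add[symmetric] del: suminf_add)
        also have "\<dots> \<le> ennreal (2 powr (of_int j * (\<alpha>2 - \<alpha>1))) * (ennreal C0 * (ennreal_powr (W t) (Q/P) * ennreal_powr D (1 - Q/P))) + ennreal c * ?G"
          by (intro add_right_mono mult_left_mono min_le) auto
        also have "\<dots> = d * ennreal_powr (W t) (Q/P) + ennreal c * ?G"
          using C0 by (simp add: d_def ennreal_mult mult_ac)
        finally show ?thesis .
      qed
      have "?LP (\<lambda>t. ?S t * ?I t) \<le>
         ?LP (\<lambda>t. d * ennreal_powr (W t * ?I t) (Q/P) + (ennreal c * ?G) * ?I t)"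
        using P S_le by (intro Lp_norm_mono) (auto split: split_indicator)
      also have "\<dots> \<le> ?LP (\<lambda>t. d * ennreal_powr (W t * ?I t) (Q/P)) + 
          ?LP (\<lambda>t. (ennreal c * ?G) * ?I t)"
        by (rule Lp_norm_add_le[OF P(1)]) auto
      also have "\<dots> = d * ?LP (\<lambda>t. ennreal_powr (W t * ?I t) (Q/P)) + (ennreal c * ?G) * ?LP ?I"
        using P by (simp add: Lp_norm_cmult)
      also have "?LP (\<lambda>t. ennreal_powr (W t * ?I t) (Q/P)) = ennreal_powr (Lp_norm (ennreal Q) lborel (\<lambda>t. W t * ?I t)) (Q/P)"
        using P by (subst Lp_norm_powr) auto
      also have "ennreal_powr (Lp_norm (ennreal Q) lborel (\<lambda>t. W t * ?I t)) (Q/P) \<le> ennreal_powr D (Q/P)"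
      proof (intro ennreal_powr_mono)
        have "Lp_norm (ennreal Q) lborel (\<lambda>t. W t * ?I t) = ennreal (2 powr (- of_int j * \<alpha>2)) * ?a j"
          by (simp add: herz_piece_def mult.assoc[symmetric] ennreal_mult[symmetric] powr_add[symmetric])
        also have "\<dots> \<le> ennreal (c * 2 powr (- of_int j * \<alpha>2)) * B j"
          using c by (intro mult_mono aB ennreal_leI) auto
        finally show "Lp_norm (ennreal Q) lborel (\<lambda>t. W t * ?I t) \<le> D" by (simp add: D_def)
      qed (use P in auto)
      also have "?LP ?I \<le> ennreal (2 * 2 powr (of_int j / P))"
        by (rule Lp_norm_indicator_dyadic_annulus_le[OF P(1)])
      finally have "?LP (\<lambda>t. ?S t * ?I t) \<le> 
          d * ennreal_powr D (Q/P) + (ennreal c * ?G) * ennreal (2 * 2 powr (of_int j / P))"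
        by (auto simp: mult_left_mono add_mono)
      then have "herz_piece \<alpha>1 P ?S j \<le> ennreal (2 powr (of_int j * \<alpha>1)) * (d * ennreal_powr D (Q/P) + (ennreal c * ?G) * ennreal (2 * 2 powr (of_int j / P)))"
        unfolding herz_piece_def by (intro mult_left_mono) auto
      also have "\<dots> = ennreal (2 powr (of_int j * \<alpha>1)) * (d * ennreal_powr D (Q/P)) +
         ennreal (2 powr (of_int j * \<alpha>1)) * ((ennreal c * ?G) * ennreal (2 * 2 powr (of_int j / P)))"
        by (simp add: distrib_left)
      also have "ennreal (2 powr (of_int j * \<alpha>1)) * (d * ennreal_powr D (Q/P)) = ennreal (C0 * c) * B j"
      proof -
        have "ennreal_powr D (1 - Q/P) * ennreal_powr D (Q/P) = D"
          using P Q by (subst ennreal_powr_add) auto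
        then have "ennreal (2 powr (of_int j * \<alpha>1)) * (d * ennreal_powr D (Q/P)) = 
          ennreal (2 powr (of_int j * \<alpha>1)) * ennreal (2 powr (of_int j * (\<alpha>2 - \<alpha>1)) * C0) * D"
          by (simp add: d_def mult.assoc)
        also have "\<dots> = ennreal (2 powr (of_int j * \<alpha>1) * (2 powr (of_int j * (\<alpha>2 - \<alpha>1)) * C0) * (c * 2 powr (- of_int j * \<alpha>2))) * B j"
          using C0 c by (simp add: D_def ennreal_mult[symmetric] mult.assoc[symmetric])
        also have "2 powr (of_int j * \<alpha>1) * (2 powr (of_int j * (\<alpha>2 - \<alpha>1)) * C0) * (c * 2 powr (- of_int j * \<alpha>2))
          = C0 * c * 2 powr (of_int j * \<alpha>1 + of_int j * (\<alpha>2 - \<alpha>1) + - of_int j * \<alpha>2)"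
          by (simp only: powr_add mult_ac)
        also have "of_int j * \<alpha>1 + of_int j * (\<alpha>2 - \<alpha>1) + - of_int j * \<alpha>2 = 0" by (simp add: algebra_simps)
        finally show ?thesis by simp
      qed
      also have "ennreal (2 powr (of_int j * \<alpha>1)) * ((ennreal c * ?G) * ennreal (2 * 2 powr (of_int j / P)))
         = ennreal (2 * c) * (\<Sum>k. ennreal (2 powr (of_int j * \<gamma>)) * g k)"
      proof -
        have "2 powr (of_int j * \<gamma>) = 2 powr (of_int j / P) * 2 powr (of_int j * \<alpha>1)"
          by (simp add: \<gamma>_def powr_add[symmetric] distrib_left)
        then have "ennreal (2 powr (of_int j * \<gamma>)) = ennreal (2 powr (of_int j / P)) * ennreal (2 powr (of_int j * \<alpha>1))"
          by (simp add: ennreal_mult)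
        then show ?thesis using c by (simp add: ennreal_mult mult_ac)
      qed
      also have "(\<Sum>k. ennreal (2 powr (of_int j * \<gamma>)) * g k) \<le> Y j"
      proof -
        \<comment> \<open>The scale k acts like the annulus of index - k, and for j < - k the
          product of powers is exactly the geometric factor in the definition of
          \<open>Y\<close>.\<close>
        have "(\<Sum>k. ennreal (2 powr (of_int j * \<gamma>)) * g k) \<le> (\<Sum>k. ennreal (2 powr (- \<gamma> * \<bar>of_int (- int k - j)\<bar>)) * B (- int k))"
        proof (intro suminf_le)
          fix k
          show "ennreal (2 powr (of_int j * \<gamma>)) * g k \<le> ennreal (2 powr (- \<gamma> * \<bar>of_int (- int k - j)\<bar>)) * B (- int k)"
          proof (cases "j < - int k")
            case True
            then have "\<bar>real_of_int (- int k - j)\<bar> = - real k - of_int j" by simp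
            then have "of_int j * \<gamma> + real k * \<gamma> = - \<gamma> * \<bar>real_of_int (- int k - j)\<bar>"
              by (simp only:) (simp add: algebra_simps)
            then have "2 powr (of_int j * \<gamma>) * 2 powr (real k * \<gamma>) = 2 powr (- \<gamma> * \<bar>real_of_int (- int k - j)\<bar>)"
              by (simp only: powr_add[symmetric])
            then have "ennreal (2 powr (of_int j * \<gamma>)) * ennreal (2 powr (real k * \<gamma>)) = ennreal (2 powr (- \<gamma> * \<bar>real_of_int (- int k - j)\<bar>))"
              by (simp only: ennreal_mult[symmetric] powr_ge_zero)
            then show ?thesis using True by (simp only: g_def if_True mult.assoc[symmetric] order_refl)
          qed (simp add: g_def)
        qed auto
        also have "\<dots> \<le> Y j"
          unfolding Y_def
          by (rule suminf_le_nn_integral_count_space[of "\<lambda>k. - int k" "\<lambda>m. ennreal (2 powr (- \<gamma> * \<bar>of_int (m - j)\<bar>)) * B m"]) (auto simp: inj_def)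
        finally show ?thesis .
      qed
      finally have "herz_piece \<alpha>1 P ?S j \<le> ennreal (C0 * c) * B j + ennreal (2 * c) * Y j"
        by (auto simp: mult_left_mono add_mono)
      also have "\<dots> \<le> ennreal (C0 * c) * Y j + ennreal (2 * c) * Y j"
        by (intro add_right_mono mult_left_mono BY) auto
      also have "\<dots> = ennreal C1 * Y j"
        using C0 c by (simp add: C1_def distrib_right)
      finally show ?thesis .
    qed
    have "?LR (herz_piece \<alpha>1 P ?S) \<le> ?LR (\<lambda>j. ennreal C1 * Y j)"
      using R by (intro Lp_norm_mono piece) auto
    also have "\<dots> = ennreal C1 * ?LR Y"
      using R by (intro Lp_norm_cmult) auto
    also have "?LR Y \<le> geom_mass \<gamma> * ?LR B"
      unfolding Y_def[abs_def] by (rule Lp_norm_geom_convolution[OF R])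
    also have "?LR B \<le> geom_mass \<epsilon> * ?LR ?a"
      unfolding B_def[abs_def] by (rule Lp_norm_geom_convolution[OF R])
    finally have "?LR (herz_piece \<alpha>1 P ?S) \<le> ennreal C1 * (geom_mass \<gamma> * (geom_mass \<epsilon> * ?LR ?a))"
      by (auto simp: mult_left_mono)
    also have "\<dots> = ennreal (C1 * G) * ?LR ?a"
      using C1 G by (simp add: ennreal_mult G(1)[symmetric] mult_ac)
    also have "\<dots> \<le> ennreal C * ?LR ?a"
      using C1 G by (intro mult_right_mono ennreal_leI) (auto simp: C_def)
    finally show ?thesis using P R by (simp add: herz_norm_eq)
  qed
  moreover have "0 < C" using C1 G by (simp add: C_def add_nonneg_pos)
  ultimately show ?thesis using that by blast
qed

section \<open>Iterated Herz norms\<close>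

abbreviation ennreal_vec :: "real ^ 'n \<Rightarrow> ennreal ^ 'n" where
  "ennreal_vec p \<equiv> (\<chi> i. ennreal (p $ i))"

lemma iterated_herz_norm_append:
  "iterated_herz_norm \<alpha> p q (xs @ ys) f = iterated_herz_norm \<alpha> p q ys (iterated_herz_norm \<alpha> p q xs f)"
  by (induction xs arbitrary: f) auto

lemma upd_coord_shift: "upd_coord x i t + s *\<^sub>R axis i 1 = upd_coord x i (t + s)"
  by (simp add: vec_eq_iff upd_coord_def axis_def)

lemma upd_coord_shift_other: "i \<noteq> j \<Longrightarrow> upd_coord x j t + s *\<^sub>R axis i 1 = upd_coord (x + s *\<^sub>R axis i 1) j t"
  by (simp add: vec_eq_iff upd_coord_def axis_def)

lemma measurable_upd_coord:
  fixes i :: "'n::finite"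
  shows "(\<lambda>(x, t). upd_coord x i t) \<in> borel_measurable (borel \<Otimes>\<^sub>M borel)"
proof -
  have "continuous_on UNIV (\<lambda>z :: (real ^ 'n) \<times> real. upd_coord (fst z) i (snd z))"
    unfolding upd_coord_def
  proof (intro continuous_on_vec_lambda)
    fix j
    show "continuous_on UNIV (\<lambda>z :: (real ^ 'n) \<times> real. if j = i then snd z else fst z $ j)"
      by (cases "j = i") (auto intro!: continuous_intros)
  qed
  then show ?thesis
    by (subst borel_prod) (simp add: case_prod_beta borel_measurable_continuous_onI)
qed

lemma measurable_upd_coord2 [measurable]: "upd_coord x i \<in> borel_measurable borel"
  using measurable_compose[OF _ measurable_upd_coord, of "\<lambda>t. (x, t)" borel i] by simp

lemma borel_measurable_upd_coord_curried:
  assumes [measurable]: "f \<in> borel_measurable borel"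
  shows "case_prod (\<lambda>x t. f (upd_coord x i t)) \<in> borel_measurable (borel \<Otimes>\<^sub>M borel)"
  using measurable_compose[OF measurable_upd_coord assms, of i] by (simp add: case_prod_beta)

lemma borel_measurable_iterated_herz_norm [measurable]:
  fixes p q :: "real ^ 'n"
  assumes "f \<in> borel_measurable borel" "\<And>i. 0 \<le> p $ i" "\<And>i. 0 \<le> q $ i"
  shows "iterated_herz_norm \<alpha> (ennreal_vec p) (ennreal_vec q) js f \<in> borel_measurable borel"
  using assms(1)
proof (induction js arbitrary: f)
  case (Cons i js)
  show ?case
    by (simp, intro Cons.IH borel_measurable_herz_norm borel_measurable_upd_coord_curried Cons.prems assms)
qed simp

lemma iterated_herz_norm_mono:
  fixes p q :: "real ^ 'n"
  assumes "\<And>x. f x \<le> g x" "\<And>i. 0 \<le> p $ i" "\<And>i. 0 \<le> q $ i"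
  shows "iterated_herz_norm \<alpha> (ennreal_vec p) (ennreal_vec q) js f x \<le> iterated_herz_norm \<alpha> (ennreal_vec p) (ennreal_vec q) js g x"
  using assms(1)
proof (induction js arbitrary: f g)
  case (Cons i js)
  show ?case by (simp, intro Cons.IH herz_norm_mono Cons.prems assms)
qed simp

lemma iterated_herz_norm_cmult:
  fixes p q :: "real ^ 'n"
  assumes "f \<in> borel_measurable borel" "\<And>i. 0 < p $ i" "\<And>i. 0 < q $ i"
  shows "iterated_herz_norm \<alpha> (ennreal_vec p) (ennreal_vec q) js (\<lambda>x. c * f x) = (\<lambda>x. c * iterated_herz_norm \<alpha> (ennreal_vec p) (ennreal_vec q) js f x)"
  using assms(1)
proof (induction js arbitrary: f)
  case (Cons i js)
  note [measurable] = Cons.prems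
  have "(\<lambda>x. herz_norm (\<alpha> $ i) (ennreal (p $ i)) (ennreal (q $ i)) (\<lambda>t. c * f (upd_coord x i t)))
    = (\<lambda>x. c * herz_norm (\<alpha> $ i) (ennreal (p $ i)) (ennreal (q $ i)) (\<lambda>t. f (upd_coord x i t)))"
    using assms by (intro ext herz_norm_cmult) auto
  then show ?case using assms
    by (simp add: Cons.IH borel_measurable_herz_norm borel_measurable_upd_coord_curried less_imp_le)
qed simp

lemma iterated_herz_norm_suminf_le:
  fixes p q :: "real ^ 'n" and f :: "nat \<Rightarrow> real ^ 'n \<Rightarrow> ennreal"
  assumes "\<And>n. f n \<in> borel_measurable borel" "\<And>i. 1 \<le> p $ i" "\<And>i. 1 \<le> q $ i"
  shows "iterated_herz_norm \<alpha> (ennreal_vec p) (ennreal_vec q) js (\<lambda>x. \<Sum>n. f n x) x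
    \<le> (\<Sum>n. iterated_herz_norm \<alpha> (ennreal_vec p) (ennreal_vec q) js (f n) x)"
  using assms(1)
proof (induction js arbitrary: f)
  case (Cons i js)
  note [measurable] = Cons.prems
  have pq: "0 \<le> p $ i" "0 \<le> q $ i" for i using assms(2,3)[of i] by auto
  have "iterated_herz_norm \<alpha> (ennreal_vec p) (ennreal_vec q) (i # js) (\<lambda>x. \<Sum>n. f n x) x \<le>
    iterated_herz_norm \<alpha> (ennreal_vec p) (ennreal_vec q) js
     (\<lambda>x. \<Sum>n. herz_norm (\<alpha> $ i) (ennreal (p $ i)) (ennreal (q $ i)) (\<lambda>t. f n (upd_coord x i t))) x"
    using assms(2,3) by (auto simp: pq intro!: iterated_herz_norm_mono herz_norm_suminf_le)
  also have "\<dots> \<le> (\<Sum>n. iterated_herz_norm \<alpha> (ennreal_vec p) (ennreal_vec q) (i # js) (f n) x)"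
    by (auto intro!: order_trans[OF Cons.IH] borel_measurable_herz_norm borel_measurable_upd_coord_curried pq)
  finally show ?case .
qed simp

lemma iterated_herz_norm_powr:
  fixes p q \<alpha> :: "real ^ 'n"
  assumes "\<And>i. 0 < p $ i" "\<And>i. 0 < q $ i" "0 < a"
  shows "ennreal_powr (iterated_herz_norm \<alpha> (ennreal_vec p) (ennreal_vec q) js f x) a =
    iterated_herz_norm (a *\<^sub>R \<alpha>) (ennreal_vec ((1 / a) *\<^sub>R p)) (ennreal_vec ((1 / a) *\<^sub>R q)) js (\<lambda>x. ennreal_powr (f x) a) x"
proof (induction js arbitrary: f)
  case (Cons i js)
  then show ?case using assms by (simp add: herz_norm_powr)
qed simp

text \<open>A translation along a coordinate that has not been integrated out commutes with the
  norms in the others; this carries samples along axis i through the norms already taken.\<close>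

lemma iterated_herz_norm_shift:
  assumes "i \<notin> set js"
  shows "iterated_herz_norm \<alpha> p q js (\<lambda>y. f (y + s *\<^sub>R axis i 1)) x = iterated_herz_norm \<alpha> p q js f (x + s *\<^sub>R axis i 1)"
  using assms
proof (induction js arbitrary: f)
  case (Cons j js)
  then show ?case
    using Cons.IH[of "\<lambda>x. herz_norm (\<alpha> $ j) (p $ j) (q $ j) (\<lambda>t. f (upd_coord x j t))"]
    by (simp add: upd_coord_shift_other)
qed simp

text \<open>The integer translates of [0, 1) tile the line, so averaging lattice sums over the
  offset \<tau> gives the full integral.\<close>

lemma nn_integral_unit_translates:
  fixes g :: "real \<Rightarrow> ennreal"
  assumes [measurable]: "g \<in> borel_measurable borel"
  shows "(\<integral>\<^sup>+ \<tau>. (\<Sum>n. g (of_int (int_decode n) + \<tau>)) * indicator {0..<1} \<tau> \<partial>lborel) = (\<integral>\<^sup>+ v. g v \<partial>lborel)"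
proof -
  have one: "(\<Sum>n. indicator {0..<1} (v - of_int (int_decode n)) :: ennreal) = 1" for v :: real
  proof -
    have "(\<Sum>n. indicator {0..<1} (v - of_int (int_decode n)) :: ennreal) = (\<integral>\<^sup>+ m. indicator {0..<1} (v - of_int m) \<partial>count_space UNIV)"
      by (simp add: nn_integral_count_space_eq_suminf[OF bij_int_decode])
    also have "\<dots> = (\<integral>\<^sup>+ m. indicator {\<lfloor>v\<rfloor>} m \<partial>count_space UNIV)"
      by (intro nn_integral_cong) (auto split: split_indicator, linarith+)
    finally show ?thesis by simp
  qed
  have "(\<integral>\<^sup>+ \<tau>. (\<Sum>n. g (of_int (int_decode n) + \<tau>)) * indicator {0..<1} \<tau> \<partial>lborel)
     = (\<Sum>n. \<integral>\<^sup>+ \<tau>. g (of_int (int_decode n) + \<tau>) * indicator {0..<1} \<tau> \<partial>lborel)"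
    by (subst nn_integral_suminf[symmetric]) auto
  also have "\<dots> = (\<Sum>n. \<integral>\<^sup>+ v. g v * indicator {0..<1} (v - of_int (int_decode n)) \<partial>lborel)"
  proof (intro suminf_cong)
    fix n
    show "(\<integral>\<^sup>+ \<tau>. g (of_int (int_decode n) + \<tau>) * indicator {0..<1} \<tau> \<partial>lborel) = (\<integral>\<^sup>+ v. g v * indicator {0..<1} (v - of_int (int_decode n)) \<partial>lborel)"
      using nn_integral_real_affine[of "\<lambda>v. g v * indicator {0..<1} (v - of_int (int_decode n))" 1 "of_int (int_decode n)"] by simp
  qed
  also have "\<dots> = (\<integral>\<^sup>+ v. (\<Sum>n. g v * indicator {0..<1} (v - of_int (int_decode n))) \<partial>lborel)"
    by (rule nn_integral_suminf[symmetric]) measurable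
  also have "\<dots> = (\<integral>\<^sup>+ v. g v \<partial>lborel)" by (simp add: one)
  finally show ?thesis .
qed

text \<open>A quantitative substitute for being band-limited at frequency \<open>2 ^ k\<close>: the function is controlled in each
  coordinate by its samples along every translate of a lattice of step \<open>2 powr (- k - 1)\<close>.\<close>

definition sampling_dominated :: "real \<Rightarrow> (nat \<Rightarrow> real ^ 'n \<Rightarrow> ennreal) \<Rightarrow> bool" where
  "sampling_dominated A F \<longleftrightarrow> (\<forall>k. F k \<in> borel_measurable borel) \<and>
    (\<forall>k i x. \<forall>\<tau>\<in>{0..<1}. F k x \<le> (\<Sum>n. ennreal (A / (1 + (of_int (int_decode n) + \<tau>)\<^sup>2)) *
       F k (x - ((of_int (int_decode n) + \<tau>) / 2 ^ (k + 1)) *\<^sub>R axis i 1)))"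

text \<open>Minkowski's inequality pushes the norms in the coordinates \<open>js\<close> through the
  sampling inequality along axis i; averaging over the offset \<tau> then supplies the mean value
  hypothesis of \<open>herz_norm_scale_sum_le\<close>. On the left, the same inequality takes the
  sum over k out of the norms in \<open>js\<close>.\<close>

lemma herz_step:
  fixes p R :: "real ^ 'n"
  assumes "1 \<le> Q'" "Q' < P'" "1 \<le> R'" "\<alpha>1 \<le> \<alpha>2" "- 1 / P' < \<alpha>1" "\<alpha>2 < 1 - 1 / Q'" "0 < A"
    and pR: "\<And>i. 1 \<le> p $ i" "\<And>i. 1 \<le> R $ i"
  obtains C where "0 < C" and "\<And>(F :: nat \<Rightarrow> real ^ 'n \<Rightarrow> ennreal) \<sigma> js i x. \<lbrakk>sampling_dominated A F; i \<notin> set js\<rbrakk> \<Longrightarrow>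
    herz_norm \<alpha>1 (ennreal P') (ennreal R') (\<lambda>t. iterated_herz_norm \<alpha> (ennreal_vec p) (ennreal_vec R) js
        (\<lambda>y. \<Sum>k. ennreal (2 powr (real k * (\<sigma> - (1/Q' - 1/P' + \<alpha>2 - \<alpha>1)))) * F k y) (upd_coord x i t))
    \<le> ennreal C * herz_norm \<alpha>2 (ennreal Q') (ennreal R') (\<lambda>t. iterated_herz_norm \<alpha> (ennreal_vec p) (ennreal_vec R) js
        (\<lambda>y. SUP k. ennreal (2 powr (real k * \<sigma>)) * F k y) (upd_coord x i t))"
proof -
  obtain C where C: "0 < C" and bound: "\<And>W (V :: nat \<Rightarrow> real \<Rightarrow> ennreal). \<lbrakk>W \<in> borel_measurable borel; \<And>k. V k \<in> borel_measurable borel; \<And>k t. V k t \<le> W t;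
      \<And>k t. V k t \<le> ennreal A * (\<integral>\<^sup>+ v. ennreal (1 / (1 + v\<^sup>2)) * W (t - v / 2 ^ (k + 1)) \<partial>lborel)\<rbrakk> \<Longrightarrow>
      herz_norm \<alpha>1 (ennreal P') (ennreal R') (\<lambda>t. \<Sum>k. ennreal (2 powr (- real k * (1/Q' - 1/P' + \<alpha>2 - \<alpha>1))) * V k t)
        \<le> ennreal C * herz_norm \<alpha>2 (ennreal Q') (ennreal R') W"
    using herz_norm_scale_sum_le[OF assms(1-7)] by blast
  have p0: "0 < p $ i" "0 < R $ i" "0 \<le> p $ i" "0 \<le> R $ i" for i using pR[of i] by auto
  show ?thesis
  proof (rule that[OF C])
    fix F :: "nat \<Rightarrow> real ^ 'n \<Rightarrow> ennreal" and \<sigma> i x and js :: "'n list" assume sd: "sampling_dominated A F" and i: "i \<notin> set js"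
    have [measurable]: "F k \<in> borel_measurable borel" for k using sd by (simp add: sampling_dominated_def)
    let ?N = "iterated_herz_norm \<alpha> (ennreal_vec p) (ennreal_vec R) js"
    let ?\<delta> = "1/Q' - 1/P' + \<alpha>2 - \<alpha>1"
    define W where "W t = ?N (\<lambda>y. SUP k. ennreal (2 powr (real k * \<sigma>)) * F k y) (upd_coord x i t)" for t
    define V where "V k t = ennreal (2 powr (real k * \<sigma>)) * ?N (F k) (upd_coord x i t)" for k t
    have Nm: "?N f \<in> borel_measurable borel" if "f \<in> borel_measurable borel" for f
      using that p0 by (intro borel_measurable_iterated_herz_norm) auto
    have W [measurable]: "W \<in> borel_measurable borel"
      unfolding W_def by (intro measurable_compose[OF measurable_upd_coord2 Nm]) measurable
    have V [measurable]: "V k \<in> borel_measurable borel" for k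
    proof -
      have [measurable]: "(\<lambda>t. ?N (F k) (upd_coord x i t)) \<in> borel_measurable borel"
        by (intro measurable_compose[OF measurable_upd_coord2 Nm]) measurable
      show ?thesis unfolding V_def by measurable
    qed
    have V_eq: "V k t = ?N (\<lambda>y. ennreal (2 powr (real k * \<sigma>)) * F k y) (upd_coord x i t)" for k t
      unfolding V_def by (subst iterated_herz_norm_cmult) (auto simp: p0)
    have VW: "V k t \<le> W t" for k t
      unfolding V_eq W_def by (intro iterated_herz_norm_mono p0) (rule SUP_upper, simp)
    have VA: "V k t \<le> ennreal A * (\<integral>\<^sup>+ v. ennreal (1 / (1 + v\<^sup>2)) * W (t - v / 2 ^ (k + 1)) \<partial>lborel)" for k t
    proof -
      define g where "g v = ennreal (A / (1 + v\<^sup>2)) * W (t - v / 2 ^ (k + 1))" for v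
      have [measurable]: "g \<in> borel_measurable borel" unfolding g_def by measurable
      have avg: "V k t \<le> (\<Sum>n. g (of_int (int_decode n) + \<tau>))" if \<tau>: "\<tau> \<in> {0..<1}" for \<tau>
      proof -
        let ?v = "\<lambda>n. of_int (int_decode n) + \<tau>"
        let ?f = "\<lambda>n y. ennreal (A / (1 + (?v n)\<^sup>2)) * F k (y + (- (?v n / 2 ^ (k + 1))) *\<^sub>R axis i 1)"
        have "?N (F k) (upd_coord x i t) \<le> ?N (\<lambda>y. \<Sum>n. ?f n y) (upd_coord x i t)"
          using sd \<tau> by (intro iterated_herz_norm_mono p0) (auto simp: sampling_dominated_def)
        also have "\<dots> \<le> (\<Sum>n. ?N (?f n) (upd_coord x i t))"
          by (intro iterated_herz_norm_suminf_le pR) measurable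
        also have "\<dots> = (\<Sum>n. ennreal (A / (1 + (?v n)\<^sup>2)) * ?N (F k) (upd_coord x i (t - ?v n / 2 ^ (k+1))))"
        proof (intro suminf_cong)
          fix n
          have "?N (?f n) = (\<lambda>x. ennreal (A / (1 + (?v n)\<^sup>2)) * ?N (\<lambda>y. F k (y + (- (?v n / 2 ^ (k + 1))) *\<^sub>R axis i 1)) x)"
            by (rule iterated_herz_norm_cmult) (auto simp: p0)
          then show "?N (?f n) (upd_coord x i t) = ennreal (A / (1 + (?v n)\<^sup>2)) * ?N (F k) (upd_coord x i (t - ?v n / 2 ^ (k+1)))"
            by (simp only: iterated_herz_norm_shift[OF i] upd_coord_shift) simp
        qed
        finally have "V k t \<le> ennreal (2 powr (real k * \<sigma>)) * \<dots>"
          unfolding V_def by (rule mult_left_mono) auto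
        also have "\<dots> = (\<Sum>n. ennreal (A / (1 + (?v n)\<^sup>2)) * V k (t - ?v n / 2 ^ (k+1)))"
          unfolding V_def by (simp add: mult_ac flip: ennreal_suminf_cmult)
        \<comment> \<open>Passing from \<open>V k\<close> to the larger \<open>W\<close> gives every
          scale averages of one and the same function, as \<open>bound\<close> requires.\<close>
        also have "\<dots> \<le> (\<Sum>n. g (?v n))"
          unfolding g_def by (intro suminf_le mult_left_mono VW) auto
        finally show ?thesis .
      qed
      have "(\<integral>\<^sup>+ \<tau>. V k t * indicator {0..<1::real} \<tau> \<partial>lborel) \<le> (\<integral>\<^sup>+ \<tau>. (\<Sum>n. g (of_int (int_decode n) + \<tau>)) * indicator {0..<1} \<tau> \<partial>lborel)"
        by (intro nn_integral_mono) (auto intro: avg split: split_indicator)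
      also have "\<dots> = (\<integral>\<^sup>+ v. g v \<partial>lborel)" by (rule nn_integral_unit_translates) measurable
      also have "\<dots> = (\<integral>\<^sup>+ v. ennreal A * (ennreal (1 / (1 + v\<^sup>2)) * W (t - v / 2 ^ (k + 1))) \<partial>lborel)"
        unfolding g_def mult.assoc[symmetric] using assms(7) by (simp add: ennreal_mult[symmetric])
      also have "\<dots> = ennreal A * (\<integral>\<^sup>+ v. ennreal (1 / (1 + v\<^sup>2)) * W (t - v / 2 ^ (k + 1)) \<partial>lborel)"
        by (rule nn_integral_cmult) measurable
      finally show ?thesis by (simp add: nn_integral_cmult)
    qed
    have "?N (\<lambda>y. \<Sum>k. ennreal (2 powr (real k * (\<sigma> - ?\<delta>))) * F k y) (upd_coord x i t) \<le> (\<Sum>k. ennreal (2 powr (- real k * ?\<delta>)) * V k t)" for t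
    proof -
      have "?N (\<lambda>y. \<Sum>k. ennreal (2 powr (real k * (\<sigma> - ?\<delta>))) * F k y) (upd_coord x i t) \<le>
        (\<Sum>k. ?N (\<lambda>y. ennreal (2 powr (real k * (\<sigma> - ?\<delta>))) * F k y) (upd_coord x i t))"
        by (intro iterated_herz_norm_suminf_le pR) measurable
      also have "\<dots> = (\<Sum>k. ennreal (2 powr (- real k * ?\<delta>)) * V k t)"
      proof (intro suminf_cong)
        fix k
        have "2 powr (real k * (\<sigma> - ?\<delta>)) = 2 powr (- real k * ?\<delta>) * 2 powr (real k * \<sigma>)"
          by (simp only: powr_add[symmetric]) (simp add: algebra_simps)
        then show "?N (\<lambda>y. ennreal (2 powr (real k * (\<sigma> - ?\<delta>))) * F k y) (upd_coord x i t) = ennreal (2 powr (- real k * ?\<delta>)) * V k t"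
          unfolding V_def by (subst iterated_herz_norm_cmult) (auto simp: p0 ennreal_mult mult.assoc)
      qed
      finally show ?thesis .
    qed
    then have "herz_norm \<alpha>1 (ennreal P') (ennreal R') (\<lambda>t. ?N (\<lambda>y. \<Sum>k. ennreal (2 powr (real k * (\<sigma> - ?\<delta>))) * F k y) (upd_coord x i t))
      \<le> herz_norm \<alpha>1 (ennreal P') (ennreal R') (\<lambda>t. \<Sum>k. ennreal (2 powr (- real k * ?\<delta>)) * V k t)"
      using assms by (intro herz_norm_mono) auto
    also have "\<dots> \<le> ennreal C * herz_norm \<alpha>2 (ennreal Q') (ennreal R') W"
      by (rule bound[OF W V VW VA])
    finally show "herz_norm \<alpha>1 (ennreal P') (ennreal R') (\<lambda>t. ?N (\<lambda>y. \<Sum>k. ennreal (2 powr (real k * (\<sigma> - ?\<delta>))) * F k y) (upd_coord x i t))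
      \<le> ennreal C * herz_norm \<alpha>2 (ennreal Q') (ennreal R') (\<lambda>t. ?N (\<lambda>y. SUP k. ennreal (2 powr (real k * \<sigma>)) * F k y) (upd_coord x i t))"
      unfolding W_def .
  qed
qed

text \<open>Induction from the outermost coordinate. The step for i changes its own norm and leaves
  a supremum inside the norms with \<alpha>1 and P; dominated by the sum, it takes the form that the
  induction hypothesis treats, at the smoothness left over by i. The gains 1 / Q - 1 / P + \<alpha>2
  - \<alpha>1 add up, which is why \<sigma> is quantified. The list must be nonempty, because it
  takes at least one step to turn a sum into a supremum.\<close>

lemma iterated_herz_norm_embedding:
  fixes P Q R \<alpha>1 \<alpha>2 :: "real ^ 'n"
  assumes Q: "\<And>i. 1 \<le> Q $ i" "\<And>i. Q $ i < P $ i" and R: "\<And>i. 1 \<le> R $ i"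
    and \<alpha>: "\<And>i. \<alpha>1 $ i \<le> \<alpha>2 $ i" "\<And>i. - 1 / P $ i < \<alpha>1 $ i" "\<And>i. \<alpha>2 $ i < 1 - 1 / Q $ i" and A: "0 < A"
    and js: "distinct js" "js \<noteq> []"
  shows "\<exists>C>0. \<forall>(F :: nat \<Rightarrow> real ^ 'n \<Rightarrow> ennreal) \<sigma> x. sampling_dominated A F \<longrightarrow>
    iterated_herz_norm \<alpha>1 (ennreal_vec P) (ennreal_vec R) js
      (\<lambda>y. \<Sum>k. ennreal (2 powr (real k * (\<sigma> - (\<Sum>i\<leftarrow>js. 1 / Q $ i - 1 / P $ i + \<alpha>2 $ i - \<alpha>1 $ i)))) * F k y) x
    \<le> ennreal C * iterated_herz_norm \<alpha>2 (ennreal_vec Q) (ennreal_vec R) js (\<lambda>y. SUP k. ennreal (2 powr (real k * \<sigma>)) * F k y) x"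
  using js
proof (induction js rule: rev_induct)
  case (snoc i js)
  let ?\<delta> = "\<lambda>i. 1 / Q $ i - 1 / P $ i + \<alpha>2 $ i - \<alpha>1 $ i"
  let ?N1 = "iterated_herz_norm \<alpha>1 (ennreal_vec P) (ennreal_vec R)" and ?N2 = "iterated_herz_norm \<alpha>2 (ennreal_vec Q) (ennreal_vec R)"
  let ?H1 = "herz_norm (\<alpha>1 $ i) (ennreal (P $ i)) (ennreal (R $ i))" and ?H2 = "herz_norm (\<alpha>2 $ i) (ennreal (Q $ i)) (ennreal (R $ i))"
  have P1: "1 \<le> P $ i" for i using Q[of i] by simp
  have nonneg: "0 \<le> P $ i" "0 \<le> Q $ i" "0 \<le> R $ i" "0 < Q $ i" "0 < R $ i" for i using Q(1)[of i] P1[of i] R[of i] by auto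
  obtain C where C: "0 < C" and step: "\<And>(F :: nat \<Rightarrow> real ^ 'n \<Rightarrow> ennreal) \<sigma> js' i' x. \<lbrakk>sampling_dominated A F; i' \<notin> set js'\<rbrakk> \<Longrightarrow>
    ?H1 (\<lambda>t. ?N1 js' (\<lambda>y. \<Sum>k. ennreal (2 powr (real k * (\<sigma> - ?\<delta> i))) * F k y) (upd_coord x i' t))
    \<le> ennreal C * ?H2 (\<lambda>t. ?N1 js' (\<lambda>y. SUP k. ennreal (2 powr (real k * \<sigma>)) * F k y) (upd_coord x i' t))"
    using herz_step[of "Q $ i" "P $ i" "R $ i" "\<alpha>1 $ i" "\<alpha>2 $ i" A P R, OF Q R \<alpha> A P1 R] by blast
  show ?case
  proof (cases "js = []")
    case True
    have "\<forall>(F :: nat \<Rightarrow> real ^ 'n \<Rightarrow> ennreal) \<sigma> x. sampling_dominated A F \<longrightarrow>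
      ?N1 [i] (\<lambda>y. \<Sum>k. ennreal (2 powr (real k * (\<sigma> - ?\<delta> i))) * F k y) x
       \<le> ennreal C * ?N2 [i] (\<lambda>y. SUP k. ennreal (2 powr (real k * \<sigma>)) * F k y) x"
      using step[of _ i "[]"] by simp
    then show ?thesis using C True by auto
  next
    case False
    then obtain C' where C': "0 < C'" and IH: "\<And>(F :: nat \<Rightarrow> real ^ 'n \<Rightarrow> ennreal) \<sigma> x. sampling_dominated A F \<Longrightarrow>
      ?N1 js (\<lambda>y. \<Sum>k. ennreal (2 powr (real k * (\<sigma> - (\<Sum>i\<leftarrow>js. ?\<delta> i)))) * F k y) x
       \<le> ennreal C' * ?N2 js (\<lambda>y. SUP k. ennreal (2 powr (real k * \<sigma>)) * F k y) x"
      using snoc.IH snoc.prems by auto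
    have "?N1 (js @ [i]) (\<lambda>y. \<Sum>k. ennreal (2 powr (real k * (\<sigma> - (\<Sum>i\<leftarrow>js @ [i]. ?\<delta> i)))) * F k y) x
       \<le> ennreal (C * C') * ?N2 (js @ [i]) (\<lambda>y. SUP k. ennreal (2 powr (real k * \<sigma>)) * F k y) x"
      if sd: "sampling_dominated A F" for F :: "nat \<Rightarrow> real ^ 'n \<Rightarrow> ennreal" and \<sigma> x
    proof -
      have [measurable]: "F k \<in> borel_measurable borel" for k using sd by (simp add: sampling_dominated_def)
      let ?s = "\<sigma> - (\<Sum>i\<leftarrow>js. ?\<delta> i)"
      have "?N1 (js @ [i]) (\<lambda>y. \<Sum>k. ennreal (2 powr (real k * (\<sigma> - (\<Sum>i\<leftarrow>js @ [i]. ?\<delta> i)))) * F k y) x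
        = ?H1 (\<lambda>t. ?N1 js (\<lambda>y. \<Sum>k. ennreal (2 powr (real k * (?s - ?\<delta> i))) * F k y) (upd_coord x i t))"
        by (simp add: iterated_herz_norm_append diff_diff_add)
      also have "\<dots> \<le> ennreal C * ?H2 (\<lambda>t. ?N1 js (\<lambda>y. SUP k. ennreal (2 powr (real k * ?s)) * F k y) (upd_coord x i t))"
        using snoc.prems by (intro step sd) auto
      also have "\<dots> \<le> ennreal C * ?H2 (\<lambda>t. ?N1 js (\<lambda>y. \<Sum>k. ennreal (2 powr (real k * ?s)) * F k y) (upd_coord x i t))"
      proof (intro mult_left_mono herz_norm_mono iterated_herz_norm_mono nonneg)
        fix y
        show "(SUP k. ennreal (2 powr (real k * ?s)) * F k y) \<le> (\<Sum>k. ennreal (2 powr (real k * ?s)) * F k y)"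
          by (intro SUP_least ennreal_suminf_ge)
      qed auto
      also have "\<dots> \<le> ennreal C * ?H2 (\<lambda>t. ennreal C' * ?N2 js (\<lambda>y. SUP k. ennreal (2 powr (real k * \<sigma>)) * F k y) (upd_coord x i t))"
        by (intro mult_left_mono herz_norm_mono nonneg IH sd) auto
      also have "\<dots> = ennreal C * (ennreal C' * ?H2 (\<lambda>t. ?N2 js (\<lambda>y. SUP k. ennreal (2 powr (real k * \<sigma>)) * F k y) (upd_coord x i t)))"
      proof -
        have "(\<lambda>t. ?N2 js (\<lambda>y. SUP k. ennreal (2 powr (real k * \<sigma>)) * F k y) (upd_coord x i t)) \<in> borel_measurable borel"
          by (intro measurable_compose[OF measurable_upd_coord2 borel_measurable_iterated_herz_norm] nonneg) measurable
        from herz_norm_cmult[OF nonneg(4,5) this] show ?thesis by (simp only:)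
      qed
      also have "\<dots> = ennreal (C * C') * ?N2 (js @ [i]) (\<lambda>y. SUP k. ennreal (2 powr (real k * \<sigma>)) * F k y) x"
        using C C' by (simp add: iterated_herz_norm_append ennreal_mult mult.assoc)
      finally show ?thesis .
    qed
    then show ?thesis using C C' by (intro exI[of _ "C * C'"]) auto
  qed
qed simp

section \<open>The sampling identity on the integers\<close>

text \<open>A constant version of the library's abbreviation \<open>sinc\<close>, which the simplifier would unfold.\<close>

definition sincf :: "real \<Rightarrow> real" where
  "sincf x = (if x = 0 then 1 else sin x / x)"

lemma sincf_0 [simp]: "sincf 0 = 1"
  by (simp add: sincf_def)

lemma continuous_on_sincf [continuous_intros]: "continuous_on A f \<Longrightarrow> continuous_on A (\<lambda>x. sincf (f x))"
  using continuous_on_sinc[of A f] by (simp add: sincf_def)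

lemma abs_sinc_le_1: "\<bar>sincf x\<bar> \<le> 1"
proof (cases "x = 0")
  case False
  have "\<bar>sin x\<bar> \<le> \<bar>x\<bar>" by (rule abs_sin_x_le_abs_x)
  then show ?thesis using False by (simp add: sincf_def abs_divide)
qed simp

lemma abs_mult_sinc_le_1: "\<bar>x\<bar> * \<bar>sincf x\<bar> \<le> 1"
  by (cases "x = 0") (auto simp: sincf_def abs_divide)

lemma has_integral_exp_sinc:
  fixes b t :: real
  assumes "0 < b"
  shows "((\<lambda>\<eta>. exp (\<i> * of_real (\<eta> * t))) has_integral of_real (2 * b * sincf (b * t))) {- b..b}"
proof (cases "t = 0")
  case True
  then show ?thesis using assms has_integral_const_real[of "1::complex" "-b" b] by (simp add: scaleR_conv_of_real)
next
  case False
  have "((\<lambda>\<eta>. exp (\<i> * of_real (\<eta> * t))) has_integral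
     (exp (\<i> * of_real (b * t)) / (\<i> * of_real t) - exp (\<i> * of_real (- b * t)) / (\<i> * of_real t))) {- b..b}"
    using assms False
    by (intro fundamental_theorem_of_calculus)
       (auto intro!: derivative_eq_intros has_vector_derivative_real_field simp: field_simps)
  also have "exp (\<i> * of_real (b * t)) / (\<i> * of_real t) - exp (\<i> * of_real (- b * t)) / (\<i> * of_real t)
    = of_real (2 * b * sincf (b * t))"
  proof -
    have "exp (\<i> * of_real (b * t)) - exp (\<i> * of_real (- b * t)) = 2 * \<i> * of_real (sin (b * t))"
      unfolding cis_conv_exp[symmetric] by (simp add: complex_eq_iff)
    then show ?thesis using assms False by (simp add: sincf_def diff_divide_distrib[symmetric])
  qed
  finally show ?thesis .
qed

text \<open>Fejer means, written as a double sum so that the kernel is visibly a squared modulus.\<close>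

definition fejer_mean :: "real \<Rightarrow> real list \<Rightarrow> nat \<Rightarrow> real \<Rightarrow> complex" where
  "fejer_mean \<tau> bs L \<theta> = (\<Sum>j\<le>L. \<Sum>k\<le>L. of_real (sincf (pi * (real j - real k + \<tau>)) * (\<Prod>b\<leftarrow>bs. sincf (b * (real j - real k + \<tau>))))
      * exp (- \<i> * of_real ((real j - real k + \<tau>) * \<theta>))) / of_nat (L + 1)"

text \<open>The function t \<mapsto> sincf (b t) is the Fourier transform of the uniform
  distribution on [- b, b], so each further factor in the coefficients averages the mean over
  \<theta>.\<close>

lemma fejer_mean_Cons:
  assumes "0 < b"
  shows "((\<lambda>\<eta>. fejer_mean \<tau> bs L (\<theta> - \<eta>)) has_integral (2 * b) *\<^sub>R fejer_mean \<tau> (b # bs) L \<theta>) {- b..b}"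
proof -
  let ?t = "\<lambda>j k. real j - real k + \<tau>"
  let ?c = "\<lambda>j k. sincf (pi * ?t j k) * (\<Prod>b\<leftarrow>bs. sincf (b * ?t j k))"
  have "((\<lambda>\<eta>. (\<Sum>j\<le>L. \<Sum>k\<le>L. (of_real (?c j k) * exp (- \<i> * of_real (?t j k * \<theta>))) * exp (\<i> * of_real (\<eta> * ?t j k))) / of_nat (L + 1)) has_integral
    (\<Sum>j\<le>L. \<Sum>k\<le>L. (of_real (?c j k) * exp (- \<i> * of_real (?t j k * \<theta>))) * of_real (2 * b * sincf (b * ?t j k))) / of_nat (L + 1)) {- b..b}"
    using assms by (intro has_integral_divide has_integral_sum has_integral_mult_right has_integral_exp_sinc) auto
  moreover have "(\<Sum>j\<le>L. \<Sum>k\<le>L. (of_real (?c j k) * exp (- \<i> * of_real (?t j k * \<theta>))) * exp (\<i> * of_real (\<eta> * ?t j k))) / of_nat (L + 1)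
     = fejer_mean \<tau> bs L (\<theta> - \<eta>)" for \<eta>
    unfolding fejer_mean_def mult.assoc exp_add[symmetric]
    by (intro arg_cong2[where f="(/)"] sum.cong refl arg_cong2[where f="(*)"] arg_cong[where f=exp]) (simp add: algebra_simps)
  moreover have "(\<Sum>j\<le>L. \<Sum>k\<le>L. (of_real (?c j k) * exp (- \<i> * of_real (?t j k * \<theta>))) * of_real (2 * b * sincf (b * ?t j k))) / of_nat (L + 1)
     = (2 * b) *\<^sub>R fejer_mean \<tau> (b # bs) L \<theta>"
    by (simp add: fejer_mean_def scaleR_conv_of_real sum_distrib_left mult_ac)
  ultimately show ?thesis by simp
qed

section \<open>The Fejer kernel and the limit of the means\<close>

definition fejer_kernel :: "nat \<Rightarrow> real \<Rightarrow> real" where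
  "fejer_kernel L u = (cmod (\<Sum>j\<le>L. exp (\<i> * of_real (real j * u))))\<^sup>2 / real (L + 1)"

lemma fejer_kernel_double_sum:
  "of_real (fejer_kernel L u) = (\<Sum>j\<le>L. \<Sum>k\<le>L. exp (\<i> * of_real ((real j - real k) * u))) / of_nat (L + 1)"
proof -
  have "of_real ((cmod (\<Sum>j\<le>L. exp (\<i> * of_real (real j * u))))\<^sup>2) = 
     (\<Sum>j\<le>L. exp (\<i> * of_real (real j * u))) * cnj (\<Sum>j\<le>L. exp (\<i> * of_real (real j * u)))"
    by (rule complex_norm_square)
  also have "\<dots> = (\<Sum>j\<le>L. \<Sum>k\<le>L. exp (\<i> * of_real ((real j - real k) * u)))"
    by (simp add: sum_product exp_cnj algebra_simps flip: exp_add)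
  finally show ?thesis by (simp add: fejer_kernel_def)
qed

lemma fejer_kernel_nonneg: "0 \<le> fejer_kernel L u"
  by (simp add: fejer_kernel_def)

lemma norm_exp_minus_1: "cmod (exp (\<i> * of_real u) - 1) = 2 * \<bar>sin (u / 2)\<bar>"
  using dist_exp_i_1[of u] by simp

lemma fejer_sum_bound:
  "cmod (\<Sum>j\<le>L. exp (\<i> * of_real (real j * u))) * (2 * \<bar>sin (u / 2)\<bar>) \<le> 2"
proof -
  have "(\<Sum>j\<le>L. exp (\<i> * of_real (real j * u))) = (\<Sum>j<Suc L. exp (\<i> * of_real u) ^ j)"
    by (simp add: exp_of_nat_mult[symmetric] lessThan_Suc_atMost mult_ac)
  then have "(exp (\<i> * of_real u) - 1) * (\<Sum>j\<le>L. exp (\<i> * of_real (real j * u))) = exp (\<i> * of_real u) ^ Suc L - 1"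
    by (simp only: power_diff_1_eq)
  then have "cmod (\<Sum>j\<le>L. exp (\<i> * of_real (real j * u))) * (2 * \<bar>sin (u / 2)\<bar>) = cmod (exp (\<i> * of_real u) ^ Suc L - 1)"
    by (metis norm_exp_minus_1 norm_mult mult.commute)
  also have "\<dots> \<le> cmod (exp (\<i> * of_real u) ^ Suc L) + 1" 
    by (metis norm_one norm_triangle_ineq4)
  also have "\<dots> = 2" by (simp add: norm_power norm_mult)
  finally show ?thesis .
qed

text \<open>Two bounds for dominated convergence: the first is uniform in L after multiplication by
  |u|, the second gives pointwise convergence to 0 away from the zeros of sin (u / 2).\<close>

lemma fejer_kernel_le:
  assumes "sin (u / 2) \<noteq> 0"
  shows "\<bar>u\<bar> * fejer_kernel L u \<le> 2 / \<bar>sincf (u / 2)\<bar>" "fejer_kernel L u \<le> (1 / sin (u / 2))\<^sup>2 / real (L + 1)"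
proof -
  let ?Z = "cmod (\<Sum>j\<le>L. exp (\<i> * of_real (real j * u)))"
  have s: "0 < \<bar>sin (u / 2)\<bar>" using assms by simp
  have Z: "?Z \<le> 1 / \<bar>sin (u / 2)\<bar>" using fejer_sum_bound[of u L] s by (simp add: field_simps)
  have "?Z \<le> (\<Sum>j\<le>L. cmod (exp (\<i> * of_real (real j * u))))" by (rule norm_sum)
  then have Z2: "?Z \<le> real (L + 1)" by simp
  have "fejer_kernel L u \<le> ?Z * real (L + 1) / real (L + 1)"
    unfolding fejer_kernel_def power2_eq_square by (intro divide_right_mono mult_left_mono Z2) auto
  then have "\<bar>u\<bar> * fejer_kernel L u \<le> \<bar>u\<bar> * (1 / \<bar>sin (u / 2)\<bar>)"
    using Z by (intro mult_left_mono) auto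
  also have "\<dots> = 2 / \<bar>sincf (u / 2)\<bar>" using s by (auto simp: sincf_def field_simps abs_mult)
  finally show "\<bar>u\<bar> * fejer_kernel L u \<le> 2 / \<bar>sincf (u / 2)\<bar>" .
  have "?Z\<^sup>2 \<le> (1 / \<bar>sin (u / 2)\<bar>)\<^sup>2" by (intro power_mono Z) auto
  then show "fejer_kernel L u \<le> (1 / sin (u / 2))\<^sup>2 / real (L + 1)"
    unfolding fejer_kernel_def by (intro divide_right_mono) (auto simp: power_divide)
qed

text \<open>The numbers sincf (pi t) are the Fourier coefficients of \<xi> \<mapsto> exp (i \<tau>
  \<xi>) on [- pi, pi]. The means are its Fejer means at \<theta> multiplied by exp (- i \<tau>
  \<theta>), so the expected limit is 1.\<close>

lemma fejer_mean_Nil: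
  "((\<lambda>\<xi>. exp (\<i> * of_real (\<tau> * (\<xi> - \<theta>))) * of_real (fejer_kernel L (\<xi> - \<theta>))) has_integral (2 * pi) *\<^sub>R fejer_mean \<tau> [] L \<theta>) {- pi..pi}"
proof -
  let ?t = "\<lambda>j k. real j - real k + \<tau>"
  have "((\<lambda>\<xi>. (\<Sum>j\<le>L. \<Sum>k\<le>L. exp (- \<i> * of_real (?t j k * \<theta>)) * exp (\<i> * of_real (\<xi> * ?t j k))) / of_nat (L + 1)) has_integral
    (\<Sum>j\<le>L. \<Sum>k\<le>L. exp (- \<i> * of_real (?t j k * \<theta>)) * of_real (2 * pi * sincf (pi * ?t j k))) / of_nat (L + 1)) {- pi..pi}"
    by (intro has_integral_divide has_integral_sum has_integral_mult_right has_integral_exp_sinc) auto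
  moreover have "(\<Sum>j\<le>L. \<Sum>k\<le>L. exp (- \<i> * of_real (?t j k * \<theta>)) * exp (\<i> * of_real (\<xi> * ?t j k))) / of_nat (L + 1)
     = exp (\<i> * of_real (\<tau> * (\<xi> - \<theta>))) * of_real (fejer_kernel L (\<xi> - \<theta>))" for \<xi>
    unfolding fejer_kernel_double_sum times_divide_eq_right sum_distrib_left
    by (simp add: algebra_simps flip: exp_add)
  moreover have "(\<Sum>j\<le>L. \<Sum>k\<le>L. exp (- \<i> * of_real (?t j k * \<theta>)) * of_real (2 * pi * sincf (pi * ?t j k))) / of_nat (L + 1)
     = (2 * pi) *\<^sub>R fejer_mean \<tau> [] L \<theta>"
    by (simp add: fejer_mean_def scaleR_conv_of_real sum_distrib_left mult_ac)
  ultimately show ?thesis by simp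
qed

lemma fejer_kernel_integral: "((\<lambda>\<xi>. fejer_kernel L (\<xi> - \<theta>)) has_integral 2 * pi) {- pi..pi}"
proof -
  have "fejer_mean 0 [] L \<theta> = (\<Sum>j\<le>L. \<Sum>k\<le>L. if j = k then 1 else 0) / of_nat (L + 1)"
    unfolding fejer_mean_def
  proof (intro arg_cong2[where f="(/)"] sum.cong refl)
    fix j k :: nat
    have "sin (pi * (real j - real k)) = 0"
      using sin_npi_int[of "int j - int k"] by simp
    then show "of_real (sincf (pi * (real j - real k + 0)) * (\<Prod>b\<leftarrow>[]. sincf (b * (real j - real k + 0)))) * exp (- \<i> * of_real ((real j - real k + 0) * \<theta>)) = (if j = k then 1 else 0)"
      by (auto simp: sincf_def)
  qed
  also have "\<dots> = 1" by simp (metis of_nat_Suc of_nat_neq_0 div_self add.commute)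
  finally have "fejer_mean 0 [] L \<theta> = 1" .
  then have "((\<lambda>\<xi>. of_real (fejer_kernel L (\<xi> - \<theta>)) :: complex) has_integral of_real (2 * pi)) {- pi..pi}"
    using fejer_mean_Nil[of 0 \<theta> L] by (simp add: scaleR_conv_of_real)
  from has_integral_Re[OF this] show ?thesis by simp
qed

lemma norm_exp_i_minus_1_le: "cmod (exp (\<i> * of_real u) - 1) \<le> \<bar>u\<bar>"
  unfolding norm_exp_minus_1 using abs_sin_x_le_abs_x[of "u / 2"] by simp

text \<open>As the kernel has mass 2 pi, 1 can be subtracted under the integral. With u = \<xi> -
  \<theta>, the factor exp (i \<tau> u) - 1 is at most |u| in modulus and compensates the peak of
  the kernel at u = 0, so dominated convergence applies with a constant bound.\<close>

lemma fejer_mean_Nil_limit: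
  assumes \<theta>: "\<bar>\<theta>\<bar> < pi" and \<tau>: "\<bar>\<tau>\<bar> \<le> 1"
  shows "(\<lambda>L. fejer_mean \<tau> [] L \<theta>) \<longlonglongrightarrow> 1"
proof -
  let ?f = "\<lambda>L \<xi>. (exp (\<i> * of_real (\<tau> * (\<xi> - \<theta>))) - 1) * of_real (fejer_kernel L (\<xi> - \<theta>))"
  have int: "(?f L has_integral (2 * pi) *\<^sub>R (fejer_mean \<tau> [] L \<theta> - 1)) {- pi..pi}" for L
    using has_integral_diff[OF fejer_mean_Nil[of \<tau> \<theta> L] has_integral_of_real[OF fejer_kernel_integral[of L \<theta>]]]
    by (simp add: algebra_simps scaleR_conv_of_real)
  \<comment> \<open>As |\<theta>| < pi, the values u / 2 stay in a compact part of (- pi, pi), where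
    sinc has no zero; hence the positive lower bound \<open>m\<close>.\<close>
  define K where "K = (pi + \<bar>\<theta>\<bar>) / 2"
  have K: "0 \<le> K" "K < pi" using \<theta> by (auto simp: K_def)
  have u: "\<bar>(\<xi> - \<theta>) / 2\<bar> \<le> K" if "\<xi> \<in> {- pi..pi}" for \<xi>
  proof -
    have "\<bar>\<xi>\<bar> \<le> pi" using that by auto
    then show ?thesis using abs_triangle_ineq4[of \<xi> \<theta>] by (simp add: K_def)
  qed
  have sin_nz: "sin v \<noteq> 0" if "\<bar>v\<bar> \<le> K" "v \<noteq> 0" for v
    using that K sin_gt_zero[of v] sin_gt_zero[of "-v"] by (cases "0 < v") auto
  obtain m where m: "0 < m" "\<And>v. \<bar>v\<bar> \<le> K \<Longrightarrow> m \<le> \<bar>sincf v\<bar>"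
  proof -
    have "\<exists>x\<in>{-K..K}. \<forall>y\<in>{-K..K}. \<bar>sincf x\<bar> \<le> \<bar>sincf y\<bar>"
      using K by (intro continuous_attains_inf continuous_intros) auto
    then obtain x where x': "x \<in> {-K..K}" "\<forall>y\<in>{-K..K}. \<bar>sincf x\<bar> \<le> \<bar>sincf y\<bar>" by blast
    have x: "\<bar>sincf x\<bar> \<le> \<bar>sincf y\<bar>" if "\<bar>y\<bar> \<le> K" for y
      using that by (intro bspec[OF x'(2)]) (auto simp: abs_le_iff)
    have "sincf x \<noteq> 0" using sin_nz[of x] x'(1) by (auto simp: sincf_def abs_le_iff)
    then show ?thesis using x by (intro that[of "\<bar>sincf x\<bar>"]) auto
  qed
  have "(\<lambda>L. integral {- pi..pi} (?f L)) \<longlonglongrightarrow> integral {- pi..pi} (\<lambda>\<xi>. 0)"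
  proof (rule dominated_convergence(2))
    show "?f L integrable_on {- pi..pi}" for L using int by blast
    show "(\<lambda>\<xi>. 2 / m) integrable_on {- pi..pi}" by (rule integrable_const_ivl)
    show "norm (?f L \<xi>) \<le> 2 / m" if "\<xi> \<in> {- pi..pi}" for L \<xi>
    proof (cases "\<xi> = \<theta>")
      case False
      have "norm (?f L \<xi>) \<le> \<bar>\<tau> * (\<xi> - \<theta>)\<bar> * fejer_kernel L (\<xi> - \<theta>)"
        unfolding norm_mult using fejer_kernel_nonneg[of L "\<xi> - \<theta>"]
        by (intro mult_mono norm_exp_i_minus_1_le) auto
      also have "\<dots> \<le> 1 * (\<bar>\<xi> - \<theta>\<bar> * fejer_kernel L (\<xi> - \<theta>))"
        unfolding abs_mult mult.assoc using \<tau> fejer_kernel_nonneg[of L "\<xi> - \<theta>"] by (intro mult_right_mono) auto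
      also have "\<dots> \<le> 2 / \<bar>sincf ((\<xi> - \<theta>) / 2)\<bar>"
        using False sin_nz[OF u[OF that]] by (auto intro!: fejer_kernel_le)
      also have "\<dots> \<le> 2 / m" using m(1) m(2)[OF u[OF that]] by (intro divide_left_mono) auto
      finally show ?thesis .
    qed (use m in simp)
    show "(\<lambda>L. ?f L \<xi>) \<longlonglongrightarrow> 0" if "\<xi> \<in> {- pi..pi}" for \<xi>
    proof (cases "\<xi> = \<theta>")
      case False
      then have nz: "sin ((\<xi> - \<theta>) / 2) \<noteq> 0" using sin_nz[OF u[OF that]] by auto
      have "(\<lambda>L. fejer_kernel L (\<xi> - \<theta>)) \<longlonglongrightarrow> 0"
      proof (rule tendsto_sandwich[OF _ _ tendsto_const])
        show "(\<lambda>L. (1 / sin ((\<xi> - \<theta>) / 2))\<^sup>2 / real (L + 1)) \<longlonglongrightarrow> 0"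
          using LIMSEQ_Suc[OF lim_const_over_n[of "(1 / sin ((\<xi> - \<theta>) / 2))\<^sup>2"]] by simp
      qed (use fejer_kernel_nonneg fejer_kernel_le(2)[OF nz] in auto)
      then show ?thesis by (intro tendsto_mult_right_zero) (use tendsto_of_real in fastforce)
    qed simp
  qed
  then have "(\<lambda>L. (2 * pi) *\<^sub>R (fejer_mean \<tau> [] L \<theta> - 1)) \<longlonglongrightarrow> 0"
    using integral_unique[OF int] by simp
  from tendsto_scaleR[OF tendsto_const this, of "1 / (2 * pi)"]
  have "(\<lambda>L. fejer_mean \<tau> [] L \<theta> - 1) \<longlonglongrightarrow> 0" by simp
  then show ?thesis by (simp add: LIM_zero_iff)
qed

text \<open>The kernel is nonnegative with mass 2 pi and is integrated against a function of modulus
  1; averaging over \<theta> keeps the bound. It provides the dominating function for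
  \<open>fejer_mean_limit\<close>.\<close>

lemma norm_fejer_mean_le_1:
  assumes "\<And>b. b \<in> set bs \<Longrightarrow> 0 < b"
  shows "cmod (fejer_mean \<tau> bs L \<theta>) \<le> 1"
  using assms
proof (induction bs arbitrary: \<theta>)
  case Nil
  have "norm (integral {- pi..pi} (\<lambda>\<xi>. exp (\<i> * of_real (\<tau> * (\<xi> - \<theta>))) * of_real (fejer_kernel L (\<xi> - \<theta>)) :: complex)) \<le>
    integral {- pi..pi} (\<lambda>\<xi>. fejer_kernel L (\<xi> - \<theta>))"
    using fejer_mean_Nil[of \<tau> \<theta> L] fejer_kernel_integral[of L \<theta>] fejer_kernel_nonneg[of L]
    by (intro integral_norm_bound_integral) (auto simp: norm_mult)
  then show ?case
    unfolding integral_unique[OF fejer_mean_Nil] integral_unique[OF fejer_kernel_integral] by simp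
next
  case (Cons b bs)
  then have b: "0 < b" by simp
  have "norm (integral {- b..b} (\<lambda>\<eta>. fejer_mean \<tau> bs L (\<theta> - \<eta>))) \<le> integral {- b..b} (\<lambda>\<eta>. 1 :: real)"
    using fejer_mean_Cons[OF b, of \<tau> bs L \<theta>] Cons by (intro integral_norm_bound_integral) auto
  then show ?case using b unfolding integral_unique[OF fejer_mean_Cons[OF b]] by simp
qed

text \<open>Each factor averages over \<theta> within distance b. The hypothesis on the sum of the
  half-widths ensures that the successive averages never leave (- pi, pi), where the limit is
  1.\<close>

lemma fejer_mean_limit:
  assumes "\<And>b. b \<in> set bs \<Longrightarrow> 0 < b" "\<bar>\<theta>\<bar> + sum_list bs < pi" and \<tau>: "\<bar>\<tau>\<bar> \<le> 1"
  shows "(\<lambda>L. fejer_mean \<tau> bs L \<theta>) \<longlonglongrightarrow> 1"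
  using assms(1,2)
proof (induction bs arbitrary: \<theta>)
  case Nil
  then show ?case using fejer_mean_Nil_limit[OF _ \<tau>] by simp
next
  case (Cons b bs)
  then have b: "0 < b" by simp
  have "(\<lambda>L. integral {- b..b} (\<lambda>\<eta>. fejer_mean \<tau> bs L (\<theta> - \<eta>))) \<longlonglongrightarrow> integral {- b..b} (\<lambda>\<eta>. 1)"
  proof (rule dominated_convergence(2))
    show "(\<lambda>\<eta>. fejer_mean \<tau> bs L (\<theta> - \<eta>)) integrable_on {- b..b}" for L
      using fejer_mean_Cons[OF b] by blast
    show "(\<lambda>\<eta>. 1 :: real) integrable_on {- b..b}" by (rule integrable_const_ivl)
    show "norm (fejer_mean \<tau> bs L (\<theta> - \<eta>)) \<le> 1" for L \<eta>
      using Cons.prems by (intro norm_fejer_mean_le_1) auto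
    show "(\<lambda>L. fejer_mean \<tau> bs L (\<theta> - \<eta>)) \<longlonglongrightarrow> 1" if "\<eta> \<in> {- b..b}" for \<eta>
    proof (rule Cons.IH)
      have "\<bar>\<theta> - \<eta>\<bar> \<le> \<bar>\<theta>\<bar> + b" using that by (auto simp: abs_if)
      then show "\<bar>\<theta> - \<eta>\<bar> + sum_list bs < pi" using Cons.prems(2) by simp
    qed (use Cons.prems in auto)
  qed
  then have "(\<lambda>L. (2 * b) *\<^sub>R fejer_mean \<tau> (b # bs) L \<theta>) \<longlonglongrightarrow> (2 * b) *\<^sub>R 1"
    using b unfolding integral_unique[OF fejer_mean_Cons[OF b]] by simp
  from tendsto_scaleR[OF tendsto_const this, of "1 / (2 * b)"] show ?case using b by simp
qed

section \<open>From Fejer means to the sum of the series\<close>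

lemma cesaro_mean_tendsto:
  fixes s :: "nat \<Rightarrow> complex"
  assumes "s \<longlonglongrightarrow> a"
  shows "(\<lambda>L. (\<Sum>l\<le>L. s l) / of_nat (L + 1)) \<longlonglongrightarrow> a"
proof -
  have "Bseq (\<lambda>n. s n - a)" by (intro convergent_imp_Bseq convergentI[OF LIM_zero[OF assms]])
  then obtain B where "0 < B" "\<forall>n. cmod (s n - a) \<le> B" by (rule BseqE)
  then have B: "\<And>n. cmod (s n - a) \<le> B" "0 < B" by auto
  show ?thesis
  proof (rule LIMSEQ_I)
    fix e :: real assume e: "0 < e"
    obtain n0 where n0: "\<And>n. n \<ge> n0 \<Longrightarrow> cmod (s n - a) < e / 2"
      using LIMSEQ_D[OF assms, of "e / 2"] e by auto
    obtain n1 :: nat where n1: "2 * real n0 * B / e < real n1" using reals_Archimedean2 by blast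
    show "\<exists>no. \<forall>L\<ge>no. cmod ((\<Sum>l\<le>L. s l) / of_nat (L + 1) - a) < e"
    proof (intro exI allI impI)
      fix L assume L: "n1 \<le> L"
      have "(\<Sum>l\<le>L. s l) / of_nat (L + 1) - a = (\<Sum>l\<le>L. s l - a) / of_nat (L + 1)"
        by (simp add: sum_subtractf diff_divide_distrib del: of_nat_Suc)
      then have "cmod ((\<Sum>l\<le>L. s l) / of_nat (L + 1) - a) \<le> (\<Sum>l\<le>L. cmod (s l - a)) / real (L + 1)"
        by (simp only: norm_divide norm_of_nat) (intro divide_right_mono norm_sum, simp)
      also have "(\<Sum>l\<le>L. cmod (s l - a)) \<le> (\<Sum>l\<le>L. (if l < n0 then B else 0) + e / 2)"
        using B n0 e by (intro sum_mono) (auto simp: not_less less_imp_le add_increasing2)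
      also have "\<dots> = (\<Sum>l\<in>{..L} \<inter> {..<n0}. B) + real (L + 1) * (e / 2)"
        by (simp add: sum.distrib sum.If_cases lessThan_def)
      also have "(\<Sum>l\<in>{..L} \<inter> {..<n0}. B) \<le> (\<Sum>l\<in>{..<n0}. B)"
        using B by (intro sum_mono2) auto
      also have "\<dots> = real n0 * B" by simp
      also have "real n0 * B < real (L + 1) * (e / 2)"
      proof -
        have "2 * real n0 * B / e < real (L + 1)" using n1 L by simp
        then show ?thesis using e by (simp add: field_simps)
      qed
      finally have "cmod ((\<Sum>l\<le>L. s l) / of_nat (L + 1) - a) < (real (L + 1) * (e / 2) + real (L + 1) * (e / 2)) / real (L + 1)"
        by (simp add: divide_strict_right_mono divide_right_mono)
      then show "cmod ((\<Sum>l\<le>L. s l) / of_nat (L + 1) - a) < e" by (simp add: add_divide_distrib del: of_nat_Suc)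
    qed
  qed
qed

text \<open>Enlarging the square by one adds a last row and a last column, and the differences j - k
  on them run exactly once through a symmetric interval of integers.\<close>

lemma double_sum_eq_sum_symmetric:
  fixes c :: "int \<Rightarrow> complex"
  shows "(\<Sum>j\<le>L. \<Sum>k\<le>L. c (int j - int k)) = (\<Sum>l\<le>L. \<Sum>m\<in>{- int l..int l}. c m)"
proof (induction L)
  case (Suc L)
  have "(\<Sum>k\<le>Suc L. c (int (Suc L) - int k)) = (\<Sum>m\<in>{0..int (Suc L)}. c m)"
    by (rule sum.reindex_bij_witness[of _ "\<lambda>m. nat (int (Suc L) - m)" "\<lambda>k. int (Suc L) - int k"]) auto
  moreover have "(\<Sum>j\<le>L. c (int j - int (Suc L))) = (\<Sum>m\<in>{- int (Suc L)..<0}. c m)"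
    by (rule sum.reindex_bij_witness[of _ "\<lambda>m. nat (m + int (Suc L))" "\<lambda>j. int j - int (Suc L)"]) auto
  moreover have "{- int (Suc L)..int (Suc L)} = {- int (Suc L)..<0} \<union> {0..int (Suc L)}" by auto
  then have "(\<Sum>m\<in>{- int (Suc L)..int (Suc L)}. c m) = (\<Sum>m\<in>{- int (Suc L)..<0}. c m) + (\<Sum>m\<in>{0..int (Suc L)}. c m)"
    by (simp only:) (rule sum.union_disjoint, auto)
  ultimately show ?case
    by (simp only: sum.atMost_Suc sum.distrib Suc.IH) simp
qed simp

text \<open>The Fejer means are the Cesaro means of the symmetric partial sums. Absolute summability
  makes the sum independent of the enumeration, so the symmetric partial sums tend to it, and the
  known limit of the means forces it to be 1.\<close>

lemma sampling_identity:
  assumes bs: "\<And>b. b \<in> set bs \<Longrightarrow> 0 < b" "\<bar>\<theta>\<bar> + sum_list bs < pi" and \<tau>: "\<bar>\<tau>\<bar> \<le> 1"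
    and t: "\<And>n. t n = of_int (int_decode n) + \<tau>"
    and summable: "summable (\<lambda>n. \<bar>sincf (pi * t n) * (\<Prod>b\<leftarrow>bs. sincf (b * t n))\<bar>)"
  shows "(\<lambda>n. of_real (sincf (pi * t n) * (\<Prod>b\<leftarrow>bs. sincf (b * t n))) * exp (- \<i> * of_real (t n * \<theta>))) sums 1"
proof -
  define c where "c m = of_real (sincf (pi * (of_int m + \<tau>)) * (\<Prod>b\<leftarrow>bs. sincf (b * (of_int m + \<tau>)))) * exp (- \<i> * of_real ((of_int m + \<tau>) * \<theta>))" for m :: int
  have ct: "of_real (sincf (pi * t n) * (\<Prod>b\<leftarrow>bs. sincf (b * t n))) * exp (- \<i> * of_real (t n * \<theta>)) = c (int_decode n)" for n
    by (simp only: c_def t)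
  have norm_c: "norm (c (int_decode n)) = \<bar>sincf (pi * t n) * (\<Prod>b\<leftarrow>bs. sincf (b * t n))\<bar>" for n
    by (simp add: norm_mult ct[symmetric] abs_mult)
  have "(\<lambda>n. norm (c (int_decode n))) summable_on UNIV"
    using summable by (simp add: norm_c summable_on_UNIV_nonneg_real_iff)
  then have abs: "(\<lambda>n. c (int_decode n)) summable_on UNIV" by (rule abs_summable_summable)
  define T where "T = infsum (\<lambda>n. c (int_decode n)) UNIV"
  have hs: "((\<lambda>n. c (int_decode n)) has_sum T) UNIV" unfolding T_def using abs by (rule has_sum_infsum)
  then have hs_int: "(c has_sum T) UNIV" using has_sum_reindex_bij_betw[OF bij_int_decode, of c] by simp
  have "(\<lambda>l. \<Sum>m\<in>{- int l..int l}. c m) \<longlonglongrightarrow> T"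
  proof -
    have "filterlim (\<lambda>l. {- int l..int l}) (finite_subsets_at_top UNIV) sequentially"
      unfolding filterlim_finite_subsets_at_top
    proof safe
      fix X :: "int set" assume X: "finite X"
      obtain B where B: "\<And>x. x \<in> X \<Longrightarrow> \<bar>x\<bar> \<le> B" using finite_set_of_finite_funs X
        by (metis bdd_above_finite bdd_above.unfold finite_imageI imageI)
      show "\<forall>\<^sub>F l in sequentially. finite {- int l..int l} \<and> X \<subseteq> {- int l..int l} \<and> {- int l..int l} \<subseteq> UNIV"
        using eventually_ge_at_top[of "nat B"] by eventually_elim (use B in \<open>fastforce simp: abs_le_iff\<close>)
    qed
    from filterlim_compose[OF hs_int[unfolded has_sum_def] this] show ?thesis .
  qed
  then have "(\<lambda>L. (\<Sum>l\<le>L. \<Sum>m\<in>{- int l..int l}. c m) / of_nat (L + 1)) \<longlonglongrightarrow> T"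
    by (rule cesaro_mean_tendsto)
  moreover have "(\<Sum>l\<le>L. \<Sum>m\<in>{- int l..int l}. c m) / of_nat (L + 1) = fejer_mean \<tau> bs L \<theta>" for L
    unfolding double_sum_eq_sum_symmetric[symmetric] fejer_mean_def c_def by simp
  ultimately have "T = 1" using LIMSEQ_unique[OF _ fejer_mean_limit[OF bs \<tau>]] by simp
  then show ?thesis using has_sum_imp_sums[OF hs] unfolding ct by simp
qed

text \<open>Of the M + 1 factors, M absorb one power of 1 + |t| each and the last is bounded by 1.
  The scale 1 / (2 (M + 1)) gives the M + 1 averaging intervals the total half-width 1 / 2.\<close>

lemma sinc_power_decay:
  "(1 + \<bar>t\<bar>) ^ M * \<bar>sincf (1 / (2 * real (Suc M)) * t)\<bar> ^ Suc M \<le> (1 + 2 * real (Suc M)) ^ M"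
proof -
  let ?x = "1 / (2 * real (Suc M)) * t"
  have "\<bar>t\<bar> * \<bar>sincf ?x\<bar> = 2 * real (Suc M) * (\<bar>?x\<bar> * \<bar>sincf ?x\<bar>)" by (simp add: abs_mult)
  also have "\<dots> \<le> 2 * real (Suc M) * 1" by (intro mult_left_mono abs_mult_sinc_le_1) auto
  finally have "(1 + \<bar>t\<bar>) * \<bar>sincf ?x\<bar> \<le> 1 + 2 * real (Suc M)"
    using abs_sinc_le_1[of ?x] by (simp add: distrib_right)
  then have "((1 + \<bar>t\<bar>) * \<bar>sincf ?x\<bar>) ^ M \<le> (1 + 2 * real (Suc M)) ^ M"
    by (intro power_mono) auto
  then have "((1 + \<bar>t\<bar>) * \<bar>sincf ?x\<bar>) ^ M * \<bar>sincf ?x\<bar> \<le> (1 + 2 * real (Suc M)) ^ M * 1"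
    using abs_sinc_le_1[of ?x] by (intro mult_mono) auto
  then show ?thesis by (simp add: power_mult_distrib mult_ac)
qed

text \<open>The enumeration \<open>int_decode\<close> alternates between the two signs, so
  |int_decode n| grows like n / 2, and an offset below 1 changes 1 + |t| at most by a
  factor.\<close>

lemma summable_inverse_square_lattice:
  fixes t :: "nat \<Rightarrow> real"
  assumes "0 \<le> \<tau>" "\<tau> < 1" "\<And>n. t n = of_int (int_decode n) + \<tau>"
  shows "summable (\<lambda>n. 1 / (1 + \<bar>t n\<bar>)\<^sup>2)"
proof (rule summable_comparison_test')
  show "summable (\<lambda>n. 16 * (1 / (real (Suc n))\<^sup>2))"
    using inverse_power_summable[of 2, where 'a=real] by (intro summable_mult) (subst summable_Suc_iff, simp add: inverse_eq_divide)
  fix n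
  have "real (Suc n) \<le> 2 * (1 + \<bar>of_int (int_decode n)\<bar>)"
    by (simp add: int_decode_def sum_decode_def) (auto elim!: evenE oddE split: sum.split)
  also have "\<dots> \<le> 4 * (1 + \<bar>t n\<bar>)"
    unfolding assms(3) using assms(1,2) by (simp add: abs_if)
  finally have "(real (Suc n))\<^sup>2 \<le> (4 * (1 + \<bar>t n\<bar>))\<^sup>2" by (intro power_mono) auto
  then have "1 / (4 * (1 + \<bar>t n\<bar>))\<^sup>2 \<le> 1 / (real (Suc n))\<^sup>2" by (intro divide_left_mono) (auto intro!: mult_pos_pos)
  moreover have "(4 * (1 + \<bar>t n\<bar>))\<^sup>2 = 16 * (1 + \<bar>t n\<bar>)\<^sup>2"
    by (simp only: power_mult_distrib) simp
  moreover have "norm (1 / (1 + \<bar>t n\<bar>)\<^sup>2) = 16 * (1 / (16 * (1 + \<bar>t n\<bar>)\<^sup>2))" by simp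
  ultimately show "norm (1 / (1 + \<bar>t n\<bar>)\<^sup>2) \<le> 16 * (1 / (real (Suc n))\<^sup>2)"
    by (simp only:)
qed

text \<open>The decay constant \<open>C\<close> of order \<open>M\<close> does not depend on the second order \<open>N\<close>; this independence is what allows
  distributions of arbitrary order to be treated with uniform constants.\<close>

lemma sampling_sequence:
  fixes M :: nat
  obtains C where "0 < C"
    and "\<And>(N :: nat) \<tau> t. \<lbrakk>0 \<le> \<tau>; \<tau> < 1; \<And>n. t n = of_int (int_decode n) + \<tau>\<rbrakk> \<Longrightarrow>
      \<exists>c :: nat \<Rightarrow> real. (\<forall>n. \<bar>c n\<bar> * (1 + \<bar>t n\<bar>) ^ M \<le> C) \<and> summable (\<lambda>n. \<bar>c n\<bar> * (1 + \<bar>t n\<bar>) ^ N) \<and>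
        (\<forall>\<theta>. \<bar>\<theta>\<bar> \<le> 1 \<longrightarrow> (\<lambda>n. of_real (c n) * exp (- \<i> * of_real (t n * \<theta>))) sums 1)"
proof
  define C where "C = (1 + 2 * real (Suc M)) ^ M"
  show "0 < C" by (simp add: C_def)
  fix N :: nat and \<tau> :: real and t :: "nat \<Rightarrow> real"
  assume \<tau>: "0 \<le> \<tau>" "\<tau> < 1" and t: "\<And>n. t n = of_int (int_decode n) + \<tau>"
  \<comment> \<open>Two orders beyond \<open>N\<close> leave a summable inverse square.\<close>
  define K where "K = N + 2"
  define bs where "bs = replicate (Suc M) (1 / (2 * real (Suc M))) @ replicate (Suc K) (1 / (2 * real (Suc K)))"
  have bs: "0 < b" if "b \<in> set bs" for b using that by (auto simp: bs_def)
  have sum_bs: "sum_list bs = 1" by (simp add: bs_def sum_list_replicate del: of_nat_Suc replicate_Suc)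
  define c where "c n = sincf (pi * t n) * (\<Prod>b\<leftarrow>bs. sincf (b * t n))" for n
  let ?A = "\<lambda>n. \<bar>sincf (1 / (2 * real (Suc M)) * t n)\<bar> ^ Suc M" and ?B = "\<lambda>n. \<bar>sincf (1 / (2 * real (Suc K)) * t n)\<bar> ^ Suc K"
  have "\<bar>c n\<bar> = \<bar>sincf (pi * t n)\<bar> * (?A n * ?B n)" for n
    unfolding c_def bs_def map_append map_replicate prod_list.append prod_list_replicate abs_mult power_abs ..
  then have c_le: "\<bar>c n\<bar> \<le> ?A n * ?B n" for n
    using mult_right_mono[OF abs_sinc_le_1[of "pi * t n"], of "?A n * ?B n"] by simp
  have AB: "?A n \<le> 1" "?B n \<le> 1" "0 \<le> ?A n" "0 \<le> ?B n" for n
    by (intro power_le_one abs_sinc_le_1 zero_le_power abs_ge_zero)+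
  have "\<bar>c n\<bar> * (1 + \<bar>t n\<bar>) ^ M \<le> C" for n
  proof -
    have "\<bar>c n\<bar> \<le> ?A n" using c_le[of n] mult_left_le[OF AB(2,3), of n n] by linarith
    then have "\<bar>c n\<bar> * (1 + \<bar>t n\<bar>) ^ M \<le> ?A n * (1 + \<bar>t n\<bar>) ^ M" by (intro mult_right_mono) auto
    also have "\<dots> \<le> C" unfolding C_def using sinc_power_decay[of "t n" M] by (simp only: mult.commute)
    finally show ?thesis .
  qed
  moreover have summable: "summable (\<lambda>n. \<bar>c n\<bar> * (1 + \<bar>t n\<bar>) ^ N)"
  proof (rule summable_comparison_test')
    show "summable (\<lambda>n. (1 + 2 * real (Suc K)) ^ K * (1 / (1 + \<bar>t n\<bar>)\<^sup>2))"
      by (intro summable_mult summable_inverse_square_lattice[OF \<tau> t])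
    fix n
    have "\<bar>c n\<bar> \<le> ?B n" using c_le[of n] mult_left_le_one_le[OF AB(4,3,1), of n n] by linarith
    then have "\<bar>c n\<bar> * (1 + \<bar>t n\<bar>) ^ K \<le> ?B n * (1 + \<bar>t n\<bar>) ^ K" by (intro mult_right_mono) auto
    also have "\<dots> \<le> (1 + 2 * real (Suc K)) ^ K" using sinc_power_decay[of "t n" K] by (simp only: mult.commute)
    finally have "(\<bar>c n\<bar> * (1 + \<bar>t n\<bar>) ^ N) * (1 + \<bar>t n\<bar>)\<^sup>2 \<le> (1 + 2 * real (Suc K)) ^ K"
      by (simp only: K_def power_add mult.assoc)
    then show "norm (\<bar>c n\<bar> * (1 + \<bar>t n\<bar>) ^ N) \<le> (1 + 2 * real (Suc K)) ^ K * (1 / (1 + \<bar>t n\<bar>)\<^sup>2)"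
      by (simp add: pos_le_divide_eq add_pos_nonneg)
  qed
  moreover have "summable (\<lambda>n. \<bar>c n\<bar>)"
  proof (rule summable_comparison_test'[OF summable])
    fix n
    have "1 \<le> (1 + \<bar>t n\<bar>) ^ N" by (intro one_le_power) auto
    from mult_left_mono[OF this, of "\<bar>c n\<bar>"] show "norm \<bar>c n\<bar> \<le> \<bar>c n\<bar> * (1 + \<bar>t n\<bar>) ^ N" by simp
  qed
  then have "(\<lambda>n. of_real (c n) * exp (- \<i> * of_real (t n * \<theta>))) sums 1" if "\<bar>\<theta>\<bar> \<le> 1" for \<theta>
    unfolding c_def using \<tau> that pi_gt3 by (intro sampling_identity[where \<tau> = \<tau>] bs t) (auto simp: sum_bs)
  ultimately show "\<exists>c :: nat \<Rightarrow> real. (\<forall>n. \<bar>c n\<bar> * (1 + \<bar>t n\<bar>) ^ M \<le> C) \<and> summable (\<lambda>n. \<bar>c n\<bar> * (1 + \<bar>t n\<bar>) ^ N) \<and>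
        (\<forall>\<theta>. \<bar>\<theta>\<bar> \<le> 1 \<longrightarrow> (\<lambda>n. of_real (c n) * exp (- \<i> * of_real (t n * \<theta>))) sums 1)"
    by blast
qed

section \<open>Injectivity of the Fourier transform\<close>

lemma
  fixes f :: "'a::euclidean_space \<Rightarrow> real \<Rightarrow> 'b::{real_normed_field, banach, second_countable_topology}"
  assumes "\<And>b. b \<in> Basis \<Longrightarrow> integrable lborel (f b)"
  shows integrable_lborel_prod: "integrable lborel (\<lambda>x::'a. \<Prod>b\<in>Basis. f b (x \<bullet> b))"
    and integral_lborel_prod: "(\<integral>x. (\<Prod>b\<in>Basis. f b (x \<bullet> b)) \<partial>(lborel :: 'a measure)) = (\<Prod>b\<in>Basis. integral\<^sup>L lborel (f b))"
proof -
  interpret product_sigma_finite "\<lambda>_::'a. lborel :: real measure" ..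
  have [measurable]: "f b \<in> borel_measurable borel" if "b \<in> Basis" for b
    using borel_measurable_integrable[OF assms[OF that]] by simp
  have T [measurable]: "(\<lambda>f. \<Sum>b\<in>Basis. f b *\<^sub>R b) \<in> (\<Pi>\<^sub>M b\<in>Basis. lborel) \<rightarrow>\<^sub>M (borel :: 'a measure)"
    by measurable
  have F [measurable]: "(\<lambda>x::'a. \<Prod>b\<in>Basis. f b (x \<bullet> b)) \<in> borel_measurable borel"
    by measurable
  have eq: "(\<Prod>b\<in>Basis. f b ((\<Sum>b\<in>Basis. x b *\<^sub>R b) \<bullet> b)) = (\<Prod>b\<in>Basis. f b (x b))" for x :: "'a \<Rightarrow> real"
    by (intro prod.cong) (simp_all add: inner_sum_left_Basis)
  have "integrable (distr (\<Pi>\<^sub>M b\<in>Basis. lborel) borel (\<lambda>f. \<Sum>b\<in>Basis. f b *\<^sub>R b)) (\<lambda>x::'a. \<Prod>b\<in>Basis. f b (x \<bullet> b))"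
    unfolding integrable_distr_eq[OF T F] eq by (rule product_integrable_prod) (auto intro: assms)
  then show "integrable lborel (\<lambda>x::'a. \<Prod>b\<in>Basis. f b (x \<bullet> b))" by (simp only: lborel_eq[symmetric])
  have "(\<integral>x. (\<Prod>b\<in>Basis. f b (x \<bullet> b)) \<partial>distr (\<Pi>\<^sub>M b\<in>Basis. lborel) borel (\<lambda>f. \<Sum>b\<in>Basis. f b *\<^sub>R b)) = (\<Prod>b\<in>Basis. integral\<^sup>L lborel (f b))"
    unfolding integral_distr[OF T F] eq by (rule product_integral_prod) (auto intro: assms)
  then show "(\<integral>x. (\<Prod>b\<in>Basis. f b (x \<bullet> b)) \<partial>(lborel :: 'a measure)) = (\<Prod>b\<in>Basis. integral\<^sup>L lborel (f b))"
    by (simp only: lborel_eq[symmetric])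
qed

lemma lborel_integral_affine:
  fixes f :: "'a::euclidean_space \<Rightarrow> 'b::{banach, second_countable_topology}"
  assumes c: "c \<noteq> 0" and f [measurable]: "f \<in> borel_measurable borel"
  shows "(\<integral>x. f x \<partial>lborel) = (\<bar>c\<bar> ^ DIM('a)) *\<^sub>R (\<integral>x. f (t + c *\<^sub>R x) \<partial>lborel)"
  by (subst lborel_affine[OF c, of t]) (simp add: integral_density integral_distr)

lemma lborel_integrable_affine:
  fixes f :: "'a::euclidean_space \<Rightarrow> 'b::{banach, second_countable_topology}"
  assumes c: "c \<noteq> 0" and f: "integrable lborel f"
  shows "integrable lborel (\<lambda>x. f (t + c *\<^sub>R x))"
proof -
  have [measurable]: "f \<in> borel_measurable borel" using borel_measurable_integrable[OF f] by simp
  have "integrable (density (distr lborel borel (\<lambda>x. t + c *\<^sub>R x)) (\<lambda>_. \<bar>c\<bar> ^ DIM('a))) f"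
    using f by (subst lborel_affine[OF c, of t, symmetric]) simp
  then have "integrable lborel (\<lambda>x. (\<bar>c\<bar> ^ DIM('a)) *\<^sub>R f (t + c *\<^sub>R x))"
    by (simp add: integrable_density integrable_distr_eq)
  from integrable_scaleR_right[of "1 / \<bar>c\<bar> ^ DIM('a)", OF this] show ?thesis using c by simp
qed

text \<open>Both Gaussians are products over the basis, which reduces their Fourier transform to the
  characteristic function of the one-dimensional normal distribution.\<close>

definition gauss_weight :: "'a::euclidean_space \<Rightarrow> complex" where
  "gauss_weight x = (\<Prod>b\<in>Basis. of_real (std_normal_density (x \<bullet> b)))"

definition gauss_transform :: "'a::euclidean_space \<Rightarrow> complex" where
  "gauss_transform x = (\<Prod>b\<in>Basis. of_real (exp (- (x \<bullet> b)\<^sup>2 / 2)))"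

lemma gauss_measurable [measurable]:
  "gauss_weight \<in> borel_measurable borel" "gauss_transform \<in> borel_measurable borel"
  unfolding gauss_weight_def[abs_def] gauss_transform_def[abs_def] by measurable

lemma gauss_transform_eq: "gauss_transform (x::'a::euclidean_space) = of_real (sqrt (2 * pi) ^ DIM('a)) * gauss_weight x"
proof -
  have "gauss_transform x = (\<Prod>b\<in>Basis. of_real (sqrt (2 * pi)) * of_real (std_normal_density (x \<bullet> b)))"
  proof -
    have "exp (- u\<^sup>2 / 2) = sqrt (2 * pi) * std_normal_density u" for u
      by (simp add: std_normal_density_def)
    then show ?thesis unfolding gauss_transform_def by (simp only: of_real_mult)
  qed
  then show ?thesis by (simp add: gauss_weight_def prod.distrib)
qed

lemma integrable_gauss_weight: "integrable lborel gauss_weight"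
  unfolding gauss_weight_def[abs_def]
  by (intro integrable_lborel_prod integrable_of_real integrable_normal_density zero_less_one)

lemma gauss_transform_integral:
  "(\<integral>\<xi>. exp (- \<i> * of_real (x \<bullet> \<xi>)) * gauss_weight \<xi> \<partial>lborel) = gauss_transform (x::'a::euclidean_space)"
proof -
  have one: "integrable lborel (\<lambda>u. exp (- \<i> * of_real (c * u)) * of_real (std_normal_density u) :: complex)"
    "(\<integral>u. exp (- \<i> * of_real (c * u)) * of_real (std_normal_density u) \<partial>lborel) = of_real (exp (- c\<^sup>2 / 2))" for c
  proof -
    have "integrable lborel (\<lambda>u. of_real (std_normal_density u) :: complex)"
      by (intro integrable_of_real integrable_normal_density zero_less_one)
    then show "integrable lborel (\<lambda>u. exp (- \<i> * of_real (c * u)) * of_real (std_normal_density u) :: complex)"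
      by (rule Bochner_Integration.integrable_bound) (auto simp: norm_mult)
    have "char std_normal_distribution (- c) = (\<integral>u. std_normal_density u *\<^sub>R exp (\<i> * of_real (- c * u)) \<partial>lborel)"
      unfolding char_def by (subst integral_density) (auto simp: normal_density_nonneg)
    then show "(\<integral>u. exp (- \<i> * of_real (c * u)) * of_real (std_normal_density u) \<partial>lborel) = of_real (exp (- c\<^sup>2 / 2))"
      by (simp add: char_std_normal_distribution scaleR_conv_of_real mult.commute)
  qed
  have "exp (- \<i> * of_real (x \<bullet> \<xi>)) * gauss_weight \<xi> =
    (\<Prod>b\<in>Basis. exp (- \<i> * of_real ((x \<bullet> b) * (\<xi> \<bullet> b))) * of_real (std_normal_density (\<xi> \<bullet> b)))" for \<xi>
    by (subst euclidean_inner) (simp add: gauss_weight_def prod.distrib exp_sum[symmetric] sum_distrib_left sum_negf)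
  then show ?thesis
    using integral_lborel_prod[of "\<lambda>b u. exp (- \<i> * of_real ((x \<bullet> b) * u)) * of_real (std_normal_density u)", OF one(1)]
    by (simp only: one(2) gauss_transform_def)
qed

text \<open>The multiplication formula: Fubini moves the Fourier transform from the Gaussian to
  \<open>g\<close>, where it vanishes.\<close>

lemma gauss_pairing_eq_0:
  fixes g :: "'a::euclidean_space \<Rightarrow> complex"
  assumes g: "integrable lborel g" and zero: "\<And>\<xi>. (\<integral>x. exp (- \<i> * of_real (x \<bullet> \<xi>)) * g x \<partial>lborel) = 0"
  shows "(\<integral>x. gauss_transform x * g x \<partial>lborel) = 0"
proof -
  have [measurable]: "g \<in> borel_measurable borel" using borel_measurable_integrable[OF g] by simp
  let ?f = "\<lambda>x \<xi>. exp (- \<i> * of_real (x \<bullet> \<xi>)) * gauss_weight \<xi> * g x"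
  have "integrable (lborel \<Otimes>\<^sub>M lborel) (case_prod ?f)"
  proof (rule lborel_pair.Fubini_integrable)
    show "case_prod ?f \<in> borel_measurable (lborel \<Otimes>\<^sub>M lborel)" by measurable
    have "(\<lambda>x. \<integral>\<xi>. norm (case (x, \<xi>) of (x, \<xi>) \<Rightarrow> ?f x \<xi>) \<partial>lborel) = (\<lambda>x. (\<integral>\<xi>. norm (gauss_weight \<xi> :: complex) \<partial>(lborel :: 'a measure)) * norm (g x))"
      by (simp add: norm_mult)
    then show "integrable lborel (\<lambda>x. \<integral>\<xi>. norm (case (x, \<xi>) of (x, \<xi>) \<Rightarrow> ?f x \<xi>) \<partial>lborel)"
      using g by simp
    have "integrable lborel (\<lambda>\<xi>. ?f x \<xi>)" for x
      by (intro integrable_mult_left Bochner_Integration.integrable_bound[OF integrable_gauss_weight]) (auto simp: norm_mult)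
    then show "AE x in lborel. integrable lborel (\<lambda>\<xi>. case (x, \<xi>) of (x, \<xi>) \<Rightarrow> ?f x \<xi>)" by simp
  qed
  then have swap: "(\<integral>\<xi>. (\<integral>x. ?f x \<xi> \<partial>lborel) \<partial>lborel) = (\<integral>x. (\<integral>\<xi>. ?f x \<xi> \<partial>lborel) \<partial>lborel)"
    by (rule lborel_pair.Fubini_integral)
  have inner: "(\<integral>\<xi>. ?f x \<xi> \<partial>lborel) = gauss_transform x * g x" for x
    by (simp only: gauss_transform_integral integral_mult_left_zero)
  have outer: "(\<integral>x. ?f x \<xi> \<partial>lborel) = 0" for \<xi>
  proof -
    have "(\<integral>x. ?f x \<xi> \<partial>lborel) = (\<integral>x. gauss_weight \<xi> * (exp (- \<i> * of_real (x \<bullet> \<xi>)) * g x) \<partial>lborel)"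
      by (simp add: mult_ac)
    also have "\<dots> = 0" unfolding integral_mult_right_zero zero by simp
    finally show ?thesis .
  qed
  show ?thesis using swap unfolding inner outer by simp
qed

text \<open>Translating and dilating \<open>g\<close> changes its transform by a phase, a factor and
  a rescaled frequency, so it stays 0. Hence every Gaussian mean of \<open>g\<close> around z
  vanishes; as the width tends to 0, continuity and boundedness give g z times the nonzero mass of
  the Gaussian in the limit.\<close>

lemma fourier_injective:
  fixes g :: "'a::euclidean_space \<Rightarrow> complex"
  assumes g: "integrable lborel g" and cont: "continuous_on UNIV g" and bdd: "\<And>x. norm (g x) \<le> B"
    and zero: "\<And>\<xi>. (\<integral>x. exp (- \<i> * of_real (x \<bullet> \<xi>)) * g x \<partial>lborel) = 0"
  shows "g z = 0"
proof -
  have [measurable]: "g \<in> borel_measurable borel" using borel_measurable_integrable[OF g] by simp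
  have int_T: "integrable lborel (gauss_transform :: 'a \<Rightarrow> complex)"
    unfolding gauss_transform_eq[abs_def] by (intro integrable_mult_right integrable_gauss_weight)
  have I: "(\<integral>w. gauss_transform w * g (z + e *\<^sub>R w) \<partial>lborel) = 0" if e: "0 < e" for e
  proof (rule gauss_pairing_eq_0)
    show "integrable lborel (\<lambda>w. g (z + e *\<^sub>R w))" using e by (intro lborel_integrable_affine g) auto
    fix \<xi>
    let ?h = "\<lambda>x. exp (- \<i> * of_real (((x - z) /\<^sub>R e) \<bullet> \<xi>)) * g x"
    have "?h = (\<lambda>x. exp (\<i> * of_real ((z /\<^sub>R e) \<bullet> \<xi>)) * (exp (- \<i> * of_real (x \<bullet> (\<xi> /\<^sub>R e))) * g x))"
      by (auto simp: fun_eq_iff inner_diff_left algebra_simps simp flip: exp_add)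
    then have "(\<integral>x. ?h x \<partial>lborel) = 0" by (simp only: integral_mult_right_zero zero) simp
    moreover have "(\<integral>x. ?h x \<partial>lborel) = (\<bar>e\<bar> ^ DIM('a)) *\<^sub>R (\<integral>w. ?h (z + e *\<^sub>R w) \<partial>lborel)"
      using e by (intro lborel_integral_affine) auto
    ultimately show "(\<integral>w. exp (- \<i> * of_real (w \<bullet> \<xi>)) * g (z + e *\<^sub>R w) \<partial>lborel) = 0"
      using e by simp
  qed
  have "(\<lambda>n. \<integral>w. gauss_transform w * g (z + (1 / real (Suc n)) *\<^sub>R w) \<partial>lborel) \<longlonglongrightarrow> (\<integral>w. gauss_transform w * g z \<partial>(lborel :: 'a measure))"
  proof (rule integral_dominated_convergence[where w = "\<lambda>w::'a. B * norm (gauss_transform w :: complex)"])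
    show "integrable lborel (\<lambda>w::'a. B * norm (gauss_transform w :: complex))"
      using int_T by auto
    show "AE w in lborel. (\<lambda>n. gauss_transform w * g (z + (1 / real (Suc n)) *\<^sub>R w)) \<longlonglongrightarrow> gauss_transform w * g z"
    proof (intro AE_I2 tendsto_mult tendsto_const)
      fix w
      have "(\<lambda>n. z + (1 / real (Suc n)) *\<^sub>R w) \<longlonglongrightarrow> z + 0 *\<^sub>R w"
        by (intro tendsto_intros LIMSEQ_Suc[OF lim_1_over_n])
      then have "(\<lambda>n. z + (1 / real (Suc n)) *\<^sub>R w) \<longlonglongrightarrow> z" by simp
      then show "(\<lambda>n. g (z + (1 / real (Suc n)) *\<^sub>R w)) \<longlonglongrightarrow> g z"
        using cont by (intro isCont_tendsto_compose[of z g]) (auto simp: continuous_on_eq_continuous_at)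
    qed
    show "AE w in lborel. norm (gauss_transform w * g (z + (1 / real (Suc n)) *\<^sub>R w)) \<le> B * norm (gauss_transform w)" for n
      unfolding norm_mult mult.commute[of B] by (intro AE_I2 mult_left_mono bdd) auto
  qed auto
  moreover have "(\<integral>w. gauss_transform w * g (z + (1 / real (Suc n)) *\<^sub>R w) \<partial>lborel) = 0" for n
    by (rule I) simp
  ultimately have "(\<integral>w. gauss_transform w * g z \<partial>(lborel :: 'a measure)) = 0"
    by (simp only: LIMSEQ_const_iff)
  moreover have "(\<integral>w. gauss_transform w \<partial>(lborel :: 'a measure)) = of_real (sqrt (2 * pi) ^ DIM('a))"
    unfolding gauss_transform_eq using gauss_transform_integral[of "0 :: 'a"]
    by (simp add: gauss_transform_def)
  ultimately show "g z = 0" by simp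
qed

section \<open>Schwartz functions\<close>

lemma partial_deriv_eq:
  assumes "(f has_derivative f') (at x)"
  shows "partial_deriv i f x = f' (axis i 1)"
  unfolding partial_deriv_def using frechet_derivative_at[OF assms] by simp

lemma has_derivative_frechet: "f differentiable (at x) \<Longrightarrow> (f has_derivative frechet_derivative f (at x)) (at x)"
  by (simp add: frechet_derivative_works)

lemma partial_deriv_affine:
  assumes "\<And>x. f differentiable (at x)"
  shows "partial_deriv i (\<lambda>y. f (x + c *\<^sub>R y)) = (\<lambda>y. c *\<^sub>R partial_deriv i f (x + c *\<^sub>R y))"
    and "(\<lambda>y. f (x + c *\<^sub>R y)) differentiable (at z)"
proof -
  have d: "((\<lambda>y. f (x + c *\<^sub>R y)) has_derivative (\<lambda>h. frechet_derivative f (at (x + c *\<^sub>R y)) (c *\<^sub>R h))) (at y)" for y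
    by (rule has_derivative_compose[OF _ has_derivative_frechet[OF assms]]) (auto intro!: derivative_eq_intros)
  have "frechet_derivative f (at y) (c *\<^sub>R h) = c *\<^sub>R frechet_derivative f (at y) h" for y h
    using linear_frechet_derivative[OF assms] by (rule linear_scale)
  then show "partial_deriv i (\<lambda>y. f (x + c *\<^sub>R y)) = (\<lambda>y. c *\<^sub>R partial_deriv i f (x + c *\<^sub>R y))"
    by (intro ext) (simp add: partial_deriv_eq[OF d], simp add: partial_deriv_def)
  show "(\<lambda>y. f (x + c *\<^sub>R y)) differentiable (at z)" using d by (auto simp: differentiable_def)
qed

lemma partial_deriv_linear:
  assumes "\<And>x. f differentiable (at x)" "\<And>x. g differentiable (at x)"
  shows "partial_deriv i (\<lambda>y. a * f y + b * g y) = (\<lambda>y. a * partial_deriv i f y + b * partial_deriv i g y)"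
    and "(\<lambda>y. a * f y + b * g y) differentiable (at z)"
proof -
  have d: "((\<lambda>y. a * f y + b * g y) has_derivative (\<lambda>h. a * frechet_derivative f (at y) h + b * frechet_derivative g (at y) h)) (at y)" for y
    by (intro has_derivative_add has_derivative_mult_right has_derivative_frechet assms)
  then show "(\<lambda>y. a * f y + b * g y) differentiable (at z)" by (auto simp: differentiable_def)
  show "partial_deriv i (\<lambda>y. a * f y + b * g y) = (\<lambda>y. a * partial_deriv i f y + b * partial_deriv i g y)"
    by (intro ext) (simp add: partial_deriv_eq[OF d], simp add: partial_deriv_def)
qed

lemma schwartz_differentiable: "f \<in> schwartz \<Longrightarrow> partial_derivs js f differentiable (at x)"
  by (simp add: schwartz_def)

lemma schwartz_bounded:
  assumes "f \<in> schwartz"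
  obtains B where "0 < B" "\<And>x. (1 + norm x) ^ N * cmod (partial_derivs js f x) \<le> B"
proof -
  have "bdd_above (range (\<lambda>x. (1 + norm x) ^ N * cmod (partial_derivs js f x)))"
    using assms by (simp add: schwartz_def)
  then obtain B where "\<And>x. (1 + norm x) ^ N * cmod (partial_derivs js f x) \<le> B"
    by (auto simp: bdd_above_def)
  moreover have "B \<le> \<bar>B\<bar> + 1" by simp
  ultimately show ?thesis by (intro that[of "\<bar>B\<bar> + 1"]) (auto intro: order_trans)
qed

lemma schwartzI:
  assumes "\<And>js x. partial_derivs js f differentiable (at x)"
    and "\<And>js N. \<exists>B. \<forall>x. (1 + norm x) ^ N * cmod (partial_derivs js f x) \<le> B"
  shows "f \<in> schwartz"
  using assms by (auto simp: schwartz_def bdd_above_def)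

lemma partial_derivs_append: "partial_derivs (is @ js) f = partial_derivs is (partial_derivs js f)"
  by (induction "is") auto

lemma partial_derivs_schwartz: "f \<in> schwartz \<Longrightarrow> partial_derivs js f \<in> schwartz"
  by (auto simp: schwartz_def partial_derivs_append[symmetric])

lemma partial_derivs_affine:
  assumes "f \<in> schwartz"
  shows "partial_derivs js (\<lambda>y. f (x + c *\<^sub>R y)) = (\<lambda>y. c ^ length js *\<^sub>R partial_derivs js f (x + c *\<^sub>R y))"
proof (induction js)
  case (Cons i js)
  let ?g = "partial_derivs js f"
  note d = partial_deriv_affine[of ?g, OF schwartz_differentiable[OF assms]]
  \<comment> \<open>Linearity with second coefficient 0 serves as the rule for scalar
    multiples.\<close>
  have "partial_deriv i (\<lambda>y. c ^ length js *\<^sub>R ?g (x + c *\<^sub>R y)) = (\<lambda>y. c ^ length js *\<^sub>R partial_deriv i (\<lambda>y. ?g (x + c *\<^sub>R y)) y)"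
    using partial_deriv_linear(1)[OF d(2) d(2), of i "of_real (c ^ length js)" x c 0 x c] by (simp add: scaleR_conv_of_real)
  then show ?case by (simp add: Cons.IH d(1) mult.commute)
qed simp

lemma one_plus_norm_add_le:
  fixes x y :: "'a::real_normed_vector"
  shows "1 + norm (x + y) \<le> (1 + norm x) * (1 + norm y)"
proof -
  have "(1 + norm x) * (1 + norm y) = 1 + norm x + norm y + norm x * norm y" by (simp add: algebra_simps)
  moreover have "0 \<le> norm x * norm y" by simp
  ultimately show ?thesis using norm_triangle_ineq[of x y] by linarith
qed

lemma schwartz_affine:
  assumes f: "f \<in> schwartz" and c: "c \<noteq> 0"
  shows "(\<lambda>y. f (x + c *\<^sub>R y)) \<in> schwartz"
proof (rule schwartzI)
  fix js N
  let ?g = "partial_derivs js f"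
  note d = partial_deriv_affine[of ?g, OF schwartz_differentiable[OF f]]
  show "partial_derivs js (\<lambda>y. f (x + c *\<^sub>R y)) differentiable (at z)" for z
    unfolding partial_derivs_affine[OF f]
    using partial_deriv_linear(2)[OF d(2) d(2), of "of_real (c ^ length js)" x c 0 x c] by (simp add: scaleR_conv_of_real)
  obtain B where B: "0 < B" "\<And>z. (1 + norm z) ^ N * cmod (?g z) \<le> B" using schwartz_bounded[OF f] by blast
  define K where "K = (1 + norm x) * (1 + 1 / \<bar>c\<bar>)"
  have "(1 + norm y) ^ N * cmod (partial_derivs js (\<lambda>y. f (x + c *\<^sub>R y)) y) \<le> K ^ N * \<bar>c\<bar> ^ length js * B" for y
  proof -
    let ?z = "x + c *\<^sub>R y"
    have "y = (?z - x) /\<^sub>R c" using c by simp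
    then have "norm y = norm (?z + (- x)) / \<bar>c\<bar>" by (metis norm_scaleR abs_inverse divide_inverse mult.commute diff_conv_add_uminus)
    also have "\<dots> \<le> (1 + norm (?z + (- x))) * (1 / \<bar>c\<bar>)" using c by (simp add: divide_simps)
    finally have "1 + norm y \<le> (1 + norm (?z + (- x))) * (1 + 1 / \<bar>c\<bar>)" using c by (simp add: algebra_simps add_increasing)
    also have "\<dots> \<le> ((1 + norm ?z) * (1 + norm (- x))) * (1 + 1 / \<bar>c\<bar>)"
      by (intro mult_right_mono one_plus_norm_add_le) auto
    finally have "1 + norm y \<le> K * (1 + norm ?z)" by (simp add: K_def mult_ac)
    then have "(1 + norm y) ^ N \<le> (K * (1 + norm ?z)) ^ N" by (intro power_mono) auto
    then have "(1 + norm y) ^ N * cmod (partial_derivs js (\<lambda>y. f (x + c *\<^sub>R y)) y) \<le> (K * (1 + norm ?z)) ^ N * (\<bar>c\<bar> ^ length js * cmod (?g ?z))"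
      unfolding partial_derivs_affine[OF f] by (simp add: power_abs mult_right_mono)
    also have "\<dots> = K ^ N * \<bar>c\<bar> ^ length js * ((1 + norm ?z) ^ N * cmod (?g ?z))" by (simp only: power_mult_distrib mult_ac)
    also have "\<dots> \<le> K ^ N * \<bar>c\<bar> ^ length js * B" by (intro mult_left_mono B) (auto simp: K_def)
    finally show ?thesis .
  qed
  then show "\<exists>B. \<forall>y. (1 + norm y) ^ N * cmod (partial_derivs js (\<lambda>y. f (x + c *\<^sub>R y)) y) \<le> B" by blast
qed

lemma partial_derivs_linear:
  assumes f: "f \<in> schwartz" and g: "g \<in> schwartz"
  shows "partial_derivs js (\<lambda>y. a * f y + b * g y) = (\<lambda>y. a * partial_derivs js f y + b * partial_derivs js g y)"
proof (induction js)
  case (Cons i js)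
  then show ?case by (simp add: partial_deriv_linear(1)[OF schwartz_differentiable[OF f] schwartz_differentiable[OF g]])
qed simp

lemma schwartz_linear:
  assumes f: "f \<in> schwartz" and g: "g \<in> schwartz"
  shows "(\<lambda>y. a * f y + b * g y) \<in> schwartz"
proof (rule schwartzI)
  fix js N
  show "partial_derivs js (\<lambda>y. a * f y + b * g y) differentiable (at z)" for z
    unfolding partial_derivs_linear[OF f g]
    by (rule partial_deriv_linear(2)[OF schwartz_differentiable[OF f] schwartz_differentiable[OF g]])
  obtain A where A: "0 < A" "\<And>z. (1 + norm z) ^ N * cmod (partial_derivs js f z) \<le> A" using schwartz_bounded[OF f] by blast
  obtain B where B: "0 < B" "\<And>z. (1 + norm z) ^ N * cmod (partial_derivs js g z) \<le> B" using schwartz_bounded[OF g] by blast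
  have "(1 + norm y) ^ N * cmod (partial_derivs js (\<lambda>y. a * f y + b * g y) y) \<le> cmod a * A + cmod b * B" for y
  proof -
    have "(1 + norm y) ^ N * cmod (partial_derivs js (\<lambda>y. a * f y + b * g y) y) \<le>
      (1 + norm y) ^ N * (cmod a * cmod (partial_derivs js f y) + cmod b * cmod (partial_derivs js g y))"
      unfolding partial_derivs_linear[OF f g] by (intro mult_left_mono) (auto intro: order_trans[OF norm_triangle_ineq] simp: norm_mult)
    also have "\<dots> = cmod a * ((1 + norm y) ^ N * cmod (partial_derivs js f y)) + cmod b * ((1 + norm y) ^ N * cmod (partial_derivs js g y))"
      by (simp add: algebra_simps)
    also have "\<dots> \<le> cmod a * A + cmod b * B" by (intro add_mono mult_left_mono A B) auto
    finally show ?thesis .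
  qed
  then show "\<exists>B. \<forall>y. (1 + norm y) ^ N * cmod (partial_derivs js (\<lambda>y. a * f y + b * g y) y) \<le> B" by blast
qed

text \<open>Stated for \<open>g\<close> minus a partial sum because the remainders of sampling
  series are what a distribution will be applied to.\<close>

lemma schwartz_sum:
  fixes f :: "nat \<Rightarrow> real ^ 'n::finite \<Rightarrow> complex"
  assumes g: "g \<in> schwartz" and f: "\<And>n. f n \<in> schwartz"
  shows "(\<lambda>y. g y - (\<Sum>n<L. c n * f n y)) \<in> schwartz"
    and "partial_derivs js (\<lambda>y. g y - (\<Sum>n<L. c n * f n y)) = (\<lambda>y. partial_derivs js g y - (\<Sum>n<L. c n * partial_derivs js (f n) y))"
proof (induction L)
  case (Suc L)
  { case 1 then show ?case
      using schwartz_linear[OF Suc.IH(1) f, of 1 "- c L" L] by (simp add: diff_diff_eq) }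
  { case 2 then show ?case
      using partial_derivs_linear[OF Suc.IH(1) f, of js 1 "- c L" L] Suc.IH(2) by (simp add: diff_diff_eq) }
qed (use g in auto)

lemma schwartz_seminorm_le:
  assumes "\<And>js x. length js \<le> N \<Longrightarrow> (1 + norm x) ^ N * cmod (partial_derivs js f x) \<le> B"
  shows "schwartz_seminorm N f \<le> B"
  unfolding schwartz_seminorm_def
  by (rule cSUP_least) (use assms in \<open>auto intro!: exI[of _ "[]"]\<close>)

lemma finite_index_lists: "finite {js :: 'n::finite list. length js \<le> N}"
  using finite_lists_length_le[of "UNIV :: 'n set" N] by simp

text \<open>The seminorm is a real supremum, so boundedness has to be shown first; it holds because
  there are only finitely many index lists of length at most N.\<close>

lemma schwartz_seminorm_ge:
  fixes f :: "real ^ 'n::finite \<Rightarrow> complex"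
  assumes f: "f \<in> schwartz" and js: "length js \<le> N"
  shows "(1 + norm x) ^ N * cmod (partial_derivs js f x) \<le> schwartz_seminorm N f"
proof -
  have "bdd_above ((\<lambda>(js, x). (1 + norm x) ^ N * cmod (partial_derivs js f x)) ` ({js. length js \<le> N} \<times> UNIV))"
  proof -
    have "({js :: 'n list. length js \<le> N} \<times> (UNIV :: (real ^ 'n) set)) = (\<Union>js\<in>{js. length js \<le> N}. {js} \<times> UNIV)" by auto
    moreover have "bdd_above ((\<lambda>(js, x). (1 + norm x) ^ N * cmod (partial_derivs js f x)) ` ({js} \<times> UNIV))" for js
    proof -
      obtain B where "\<And>x. (1 + norm x) ^ N * cmod (partial_derivs js f x) \<le> B" using schwartz_bounded[OF f] by blast
      then show ?thesis by (intro bdd_aboveI[of _ B]) auto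
    qed
    ultimately show ?thesis by (simp only: image_UN) (simp add: bdd_above_UN finite_index_lists)
  qed
  from cSUP_upper[OF _ this, of "(js, x)"] js show ?thesis
    unfolding schwartz_seminorm_def by simp
qed

lemma schwartz_continuous: "f \<in> schwartz \<Longrightarrow> continuous_on A f"
  using schwartz_differentiable[of f "[]"]
  by (auto intro!: continuous_at_imp_continuous_on differentiable_imp_continuous_within)

text \<open>Decay of order twice the dimension allows a comparison with the product of the functions
  1 / (1 + x^2) of the single coordinates.\<close>

lemma schwartz_integrable:
  fixes f :: "real ^ 'n::finite \<Rightarrow> complex"
  assumes f: "f \<in> schwartz"
  shows "integrable lborel f"
proof -
  let ?n = "DIM(real ^ 'n)"
  obtain B where B: "0 < B" "\<And>x. (1 + norm x) ^ (2 * ?n) * cmod (partial_derivs [] f x) \<le> B" using schwartz_bounded[OF f] by blast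
  have "integrable lborel (\<lambda>x::real ^ 'n. \<Prod>b\<in>Basis. 1 / (1 + (x \<bullet> b)\<^sup>2))"
    by (rule integrable_lborel_prod[OF integrable_1_over_1_plus_square])
  then have "integrable lborel (\<lambda>x::real ^ 'n. B * (\<Prod>b\<in>Basis. 1 / (1 + (x \<bullet> b)\<^sup>2)))" by (rule integrable_mult_right)
  then show ?thesis
  proof (rule Bochner_Integration.integrable_bound)
    show "f \<in> borel_measurable lborel" using schwartz_continuous[OF f] by (simp add: borel_measurable_continuous_onI)
    have "norm (f x) \<le> norm (B * (\<Prod>b\<in>Basis. 1 / (1 + (x \<bullet> b)\<^sup>2)))" for x
    proof -
      have "(\<Prod>b\<in>Basis. 1 + (x \<bullet> b)\<^sup>2) \<le> (\<Prod>b\<in>(Basis :: (real ^ 'n) set). (1 + norm x)\<^sup>2)"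
      proof (intro prod_mono conjI)
        fix b :: "real ^ 'n" assume b: "b \<in> Basis"
        have "(x \<bullet> b)\<^sup>2 \<le> (norm x)\<^sup>2" using Basis_le_norm[OF b, of x] by (metis abs_le_square_iff abs_norm_cancel)
        then show "1 + (x \<bullet> b)\<^sup>2 \<le> (1 + norm x)\<^sup>2" by (simp add: power2_sum add_increasing2)
      qed auto
      also have "\<dots> = (1 + norm x) ^ (2 * ?n)" by (simp add: power_mult)
      finally have le: "(\<Prod>b\<in>Basis. 1 + (x \<bullet> b)\<^sup>2) \<le> (1 + norm x) ^ (2 * ?n)" .
      have pos: "0 < (\<Prod>b\<in>Basis. 1 + (x \<bullet> b)\<^sup>2)" by (intro prod_pos) (auto simp: add_pos_nonneg)
      have "(\<Prod>b\<in>Basis. 1 + (x \<bullet> b)\<^sup>2) * cmod (f x) \<le> (1 + norm x) ^ (2 * ?n) * cmod (f x)"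
        by (intro mult_right_mono le) auto
      also have "\<dots> \<le> B" using B(2)[of x] by simp
      finally have "cmod (f x) \<le> B / (\<Prod>b\<in>Basis. 1 + (x \<bullet> b)\<^sup>2)" using pos by (simp add: field_simps)
      then show ?thesis using B(1) pos by (simp add: prod_dividef)
    qed
    then show "AE x in lborel. norm (f x) \<le> norm (B * (\<Prod>b\<in>Basis. 1 / (1 + (x \<bullet> b)\<^sup>2)))" by simp
  qed
qed

section \<open>Sampling of band-limited convolutions\<close>

text \<open>Both sides of the sampling formula have the same Fourier transform, since the sampling identity holds on
  the support of the transform of \<open>\<psi>\<close>.\<close>

lemma schwartz_sampling_formula:
  fixes \<psi> :: "real ^ 'n::finite \<Rightarrow> complex" and c t :: "nat \<Rightarrow> real"
  assumes \<psi>: "\<psi> \<in> schwartz" and supp: "supp (fourier \<psi>) \<subseteq> {\<xi>. norm \<xi> \<le> 2}"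
    and c: "summable (\<lambda>n. \<bar>c n\<bar>)"
    and one: "\<And>\<theta>. \<bar>\<theta>\<bar> \<le> 1 \<Longrightarrow> (\<lambda>n. of_real (c n) * exp (- \<i> * of_real (t n * \<theta>))) sums (1 :: complex)"
  shows "(\<lambda>n. of_real (c n) * \<psi> (z - (t n / 2) *\<^sub>R axis i 1)) sums \<psi> z"
proof -
  let ?e = "axis i 1 :: real ^ 'n"
  \<comment> \<open>The lattice step 1 / 2 turns a frequency \<xi> of norm at most 2 into \<theta> =
    \<xi> $ i / 2 in [- 1, 1], the range in which \<open>one\<close> is available.\<close>
  let ?f = "\<lambda>n x. of_real (c n) * \<psi> (x - (t n / 2) *\<^sub>R ?e)"
  obtain B where B: "0 < B" "\<And>x. cmod (\<psi> x) \<le> B"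
    using schwartz_bounded[OF \<psi>, of 0 "[]"] by auto
  have fB: "norm (?f n x) \<le> \<bar>c n\<bar> * B" for n x
    using B by (simp add: norm_mult mult_left_mono)
  have sB: "summable (\<lambda>n. \<bar>c n\<bar> * B)" by (rule summable_mult2[OF c])
  have summ: "summable (\<lambda>n. norm (?f n x))" for x
    by (rule summable_comparison_test'[OF sB]) (use fB in simp)
  define G where "G x = (\<Sum>n. ?f n x)" for x
  have cont_f: "continuous_on UNIV (?f n)" for n
    by (intro continuous_intros continuous_on_compose2[OF schwartz_continuous[OF \<psi>, of UNIV]]) auto
  \<comment> \<open>Uniform convergence makes \<open>G\<close> continuous, so that injectivity gives
    equality at every point and not just almost everywhere.\<close>
  have "uniform_limit UNIV (\<lambda>L x. \<Sum>n<L. ?f n x) G sequentially"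
    unfolding G_def by (rule Weierstrass_m_test[OF fB sB])
  then have cont_G: "continuous_on UNIV G"
    by (rule uniform_limit_theorem[rotated]) (auto intro!: always_eventually continuous_on_sum cont_f)
  have int_\<psi>: "integrable lborel \<psi>" by (rule schwartz_integrable[OF \<psi>])
  have shift: "integrable lborel (\<lambda>x. h (x - v))" "(\<integral>x. h (x - v) \<partial>lborel) = (\<integral>x. h x \<partial>lborel)"
    if h: "integrable lborel h" for h :: "real ^ 'n \<Rightarrow> 'b::{banach, second_countable_topology}" and v
    using lborel_integrable_affine[OF _ h, of 1 "- v"] lborel_integral_affine[of 1 h "- v"] borel_measurable_integrable[OF h]
    by (auto simp: add.commute)
  have int_f: "integrable lborel (?f n)" for n by (intro integrable_mult_right shift int_\<psi>)
  have norm_f: "(\<integral>x. norm (?f n x) \<partial>lborel) = \<bar>c n\<bar> * (\<integral>x. norm (\<psi> x) \<partial>lborel)" for n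
    using shift(2)[OF integrable_norm[OF int_\<psi>], of "(t n / 2) *\<^sub>R ?e"] by (simp add: norm_mult)
  have int_G: "integrable lborel G"
    unfolding G_def by (rule integrable_suminf[OF int_f]) (auto intro: summ simp: norm_f summable_mult2[OF c])
  have FG: "(\<integral>x. exp (- \<i> * of_real (x \<bullet> \<xi>)) * G x \<partial>lborel) = (\<integral>x. exp (- \<i> * of_real (x \<bullet> \<xi>)) * \<psi> x \<partial>lborel)" for \<xi>
  proof -
    let ?E = "\<lambda>x. exp (- \<i> * of_real (x \<bullet> \<xi>)) :: complex"
    let ?F = "\<integral>x. ?E x * \<psi> x \<partial>lborel"
    have nE: "norm (?E x) = 1" for x by (simp add: norm_mult)
    have int_E: "integrable lborel (\<lambda>x. ?E x * h x)" if "integrable lborel h" for h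
      using that by (rule Bochner_Integration.integrable_bound) (use borel_measurable_integrable[OF that] in \<open>auto simp: norm_mult\<close>)
    have "(\<lambda>n. \<integral>x. ?E x * ?f n x \<partial>lborel) sums (\<integral>x. (\<Sum>n. ?E x * ?f n x) \<partial>lborel)"
    proof (rule sums_integral)
      have n: "norm (?E x * ?f n x) = norm (?f n x)" for n x by (simp only: norm_mult[of "?E x"] nE mult_1)
      show "integrable lborel (\<lambda>x. ?E x * ?f n x)" for n by (rule int_E[OF int_f])
      show "AE x in lborel. summable (\<lambda>n. norm (?E x * ?f n x))" unfolding n by (intro AE_I2 summ)
      show "summable (\<lambda>n. \<integral>x. norm (?E x * ?f n x) \<partial>lborel)" unfolding n norm_f by (rule summable_mult2[OF c])
    qed
    also have "(\<integral>x. (\<Sum>n. ?E x * ?f n x) \<partial>lborel) = (\<integral>x. ?E x * G x \<partial>lborel)"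
      unfolding G_def using summable_norm_cancel[OF summ] by (simp add: suminf_mult)
    also have "(\<lambda>n. \<integral>x. ?E x * ?f n x \<partial>lborel) = (\<lambda>n. of_real (c n) * exp (- \<i> * of_real (t n * (\<xi> $ i / 2))) * ?F)"
    proof
      fix n
      let ?v = "(t n / 2) *\<^sub>R ?e"
      have "?v \<bullet> \<xi> = t n * (\<xi> $ i / 2)" by (simp add: cart_eq_inner_axis inner_commute)
      then have "(x - ?v) \<bullet> \<xi> = x \<bullet> \<xi> - t n * (\<xi> $ i / 2)" for x by (simp only: inner_diff_left)
      then have E: "?E x = exp (- \<i> * of_real (t n * (\<xi> $ i / 2))) * ?E (x - ?v)" for x
        by (simp only: exp_add[symmetric]) (simp add: algebra_simps)
      have "?E x * ?f n x = of_real (c n) * exp (- \<i> * of_real (t n * (\<xi> $ i / 2))) * (?E (x - ?v) * \<psi> (x - ?v))" for x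
        unfolding E[of x] by (simp only: mult_ac)
      then have "(\<integral>x. ?E x * ?f n x \<partial>lborel) = of_real (c n) * exp (- \<i> * of_real (t n * (\<xi> $ i / 2))) * (\<integral>x. ?E (x - ?v) * \<psi> (x - ?v) \<partial>lborel)"
        by (simp only: integral_mult_right_zero)
      also have "(\<integral>x. ?E (x - ?v) * \<psi> (x - ?v) \<partial>lborel) = ?F"
        using shift(2)[OF int_E[OF int_\<psi>], of ?v] .
      finally show "(\<integral>x. ?E x * ?f n x \<partial>lborel) = of_real (c n) * exp (- \<i> * of_real (t n * (\<xi> $ i / 2))) * ?F" .
    qed
    finally have 1: "(\<lambda>n. of_real (c n) * exp (- \<i> * of_real (t n * (\<xi> $ i / 2))) * ?F) sums (\<integral>x. ?E x * G x \<partial>lborel)" .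
    have "(\<lambda>n. of_real (c n) * exp (- \<i> * of_real (t n * (\<xi> $ i / 2))) * ?F) sums ?F"
    proof (cases "?F = 0")
      case False
      then have "fourier \<psi> \<xi> \<noteq> 0" by (simp add: fourier_def)
      then have "\<xi> \<in> supp (fourier \<psi>)" unfolding supp_def using closure_subset by fastforce
      then have "norm \<xi> \<le> 2" using supp by auto
      then have "\<bar>\<xi> $ i / 2\<bar> \<le> 1" using component_le_norm_cart[of \<xi> i] by simp
      from sums_mult2[OF one[OF this], of ?F] show ?thesis by simp
    qed simp
    from sums_unique2[OF 1 this] show ?thesis .
  qed
  have "\<psi> z - G z = 0"
  proof (rule fourier_injective[of "\<lambda>x. \<psi> x - G x"])
    show "integrable lborel (\<lambda>x. \<psi> x - G x)" by (intro Bochner_Integration.integrable_diff int_\<psi> int_G)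
    show "continuous_on UNIV (\<lambda>x. \<psi> x - G x)" by (intro continuous_intros cont_G schwartz_continuous \<psi>)
    show "norm (\<psi> x - G x) \<le> B + (\<Sum>n. \<bar>c n\<bar> * B)" for x
    proof -
      have "norm (G x) \<le> (\<Sum>n. \<bar>c n\<bar> * B)" unfolding G_def by (rule norm_suminf_le[OF fB sB])
      then show ?thesis using B(2)[of x] norm_triangle_ineq4[of "\<psi> x" "G x"] by linarith
    qed
    fix \<xi>
    have int_E: "integrable lborel (\<lambda>x. exp (- \<i> * of_real (x \<bullet> \<xi>)) * h x)" if "integrable lborel h" for h :: "real ^ 'n \<Rightarrow> complex"
      using that by (rule Bochner_Integration.integrable_bound) (use borel_measurable_integrable[OF that] in \<open>auto simp: norm_mult\<close>)
    show "(\<integral>x. exp (- \<i> * of_real (x \<bullet> \<xi>)) * (\<psi> x - G x) \<partial>lborel) = 0"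
      unfolding right_diff_distrib Bochner_Integration.integral_diff[OF int_E[OF int_\<psi>] int_E[OF int_G]] FG by simp
  qed
  then have "\<psi> z = G z" by simp
  then show ?thesis unfolding G_def using summable_sums[OF summable_norm_cancel[OF summ[of z]]] by simp
qed

text \<open>A partial derivative is the derivative along a line, so this is termwise differentiation
  in one real variable, justified by the uniform convergence of the differentiated series. All
  derivatives are needed because Schwartz seminorms see them.\<close>

lemma sampling_formula_partial_deriv:
  fixes g :: "real ^ 'n::finite \<Rightarrow> complex" and c :: "nat \<Rightarrow> real"
  assumes g: "g \<in> schwartz" and c: "summable (\<lambda>n. \<bar>c n\<bar>)"
    and sums: "\<And>z. (\<lambda>n. of_real (c n) * g (z - v n)) sums g z"
  shows "(\<lambda>n. of_real (c n) * partial_deriv j g (z - v n)) sums partial_deriv j g z"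
proof -
  let ?a = "axis j 1 :: real ^ 'n" and ?h = "partial_deriv j g"
  have h: "?h \<in> schwartz" using partial_derivs_schwartz[OF g, of "[j]"] by simp
  obtain B where B: "0 < B" "\<And>x. cmod (?h x) \<le> B"
    using schwartz_bounded[OF h, of 0 "[]"] by auto
  have hB: "norm (of_real (c n) * ?h (x n)) \<le> \<bar>c n\<bar> * B" for n x
    using B by (simp add: norm_mult mult_left_mono)
  have sB: "summable (\<lambda>n. \<bar>c n\<bar> * B)" by (rule summable_mult2[OF c])
  have summ: "summable (\<lambda>n. of_real (c n) * ?h (x n))" for x
    by (rule summable_norm_cancel[OF summable_comparison_test'[OF sB]]) (use hB in simp)
  have line: "((\<lambda>\<tau>. g (x + \<tau> *\<^sub>R ?a)) has_derivative (\<lambda>u. u *\<^sub>R ?h (x + \<tau> *\<^sub>R ?a))) (at \<tau>)" for x \<tau>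
  proof -
    have d: "g differentiable (at y)" for y using schwartz_differentiable[OF g, of "[]"] by simp
    have "((\<lambda>\<tau>. g (x + \<tau> *\<^sub>R ?a)) has_derivative (\<lambda>u. frechet_derivative g (at (x + \<tau> *\<^sub>R ?a)) (u *\<^sub>R ?a))) (at \<tau>)"
      by (rule has_derivative_compose[OF _ has_derivative_frechet[OF d]]) (auto intro!: derivative_eq_intros)
    then show ?thesis using linear_scale[OF linear_frechet_derivative[OF d]] by (simp add: partial_deriv_def)
  qed
  define D where "D \<tau> = (\<Sum>n. of_real (c n) * ?h (z + \<tau> *\<^sub>R ?a - v n))" for \<tau>
  have ul: "uniform_limit UNIV (\<lambda>L \<tau>. \<Sum>n<L. of_real (c n) * ?h (z + \<tau> *\<^sub>R ?a - v n)) D sequentially"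
    unfolding D_def by (rule Weierstrass_m_test[OF hB sB])
  have "\<exists>G. \<forall>\<tau>\<in>UNIV. (\<lambda>n. of_real (c n) * g (z + \<tau> *\<^sub>R ?a - v n)) sums G \<tau> \<and> (G has_derivative (\<lambda>u. u *\<^sub>R D \<tau>)) (at \<tau> within UNIV)"
  proof (rule has_derivative_series[where f' = "\<lambda>n \<tau> u. u *\<^sub>R (of_real (c n) * ?h (z + \<tau> *\<^sub>R ?a - v n))" and x = 0])
    fix n \<tau>
    have "((\<lambda>\<tau>. of_real (c n) * g ((z - v n) + \<tau> *\<^sub>R ?a)) has_derivative (\<lambda>u. of_real (c n) * (u *\<^sub>R ?h ((z - v n) + \<tau> *\<^sub>R ?a)))) (at \<tau>)"
      by (intro has_derivative_mult_right line)
    then show "((\<lambda>\<tau>. of_real (c n) * g (z + \<tau> *\<^sub>R ?a - v n)) has_derivative (\<lambda>u. u *\<^sub>R (of_real (c n) * ?h (z + \<tau> *\<^sub>R ?a - v n)))) (at \<tau> within UNIV)"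
      by (simp add: algebra_simps)
  next
    fix e :: real assume e: "0 < e"
    show "\<forall>\<^sub>F n in sequentially. \<forall>\<tau>\<in>UNIV. \<forall>u. norm ((\<Sum>i<n. u *\<^sub>R (of_real (c i) * ?h (z + \<tau> *\<^sub>R ?a - v i))) - u *\<^sub>R D \<tau>) \<le> e * norm u"
      using uniform_limitD[OF ul e]
    proof eventually_elim
      case (elim n)
      show ?case
      proof (intro ballI allI)
        fix \<tau> u :: real
        have "norm ((\<Sum>i<n. u *\<^sub>R (of_real (c i) * ?h (z + \<tau> *\<^sub>R ?a - v i))) - u *\<^sub>R D \<tau>)
          = \<bar>u\<bar> * norm ((\<Sum>i<n. of_real (c i) * ?h (z + \<tau> *\<^sub>R ?a - v i)) - D \<tau>)"
          by (simp only: scaleR_sum_right[symmetric] scaleR_diff_right[symmetric] norm_scaleR)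
        also have "\<dots> \<le> \<bar>u\<bar> * e" using elim by (intro mult_left_mono) (auto simp: dist_norm less_imp_le)
        finally show "norm ((\<Sum>i<n. u *\<^sub>R (of_real (c i) * ?h (z + \<tau> *\<^sub>R ?a - v i))) - u *\<^sub>R D \<tau>) \<le> e * norm u"
          by (simp add: mult.commute)
      qed
    qed
  next
    show "(\<lambda>n. of_real (c n) * g (z + 0 *\<^sub>R ?a - v n)) sums g z" using sums[of z] by simp
  qed auto
  then obtain G where G: "\<And>\<tau>. (\<lambda>n. of_real (c n) * g (z + \<tau> *\<^sub>R ?a - v n)) sums G \<tau>" "\<And>\<tau>. (G has_derivative (\<lambda>u. u *\<^sub>R D \<tau>)) (at \<tau>)"
    by auto
  have "G = (\<lambda>\<tau>. g (z + \<tau> *\<^sub>R ?a))" using sums_unique2[OF G(1) sums] by auto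
  then have "((\<lambda>\<tau>. g (z + \<tau> *\<^sub>R ?a)) has_derivative (\<lambda>u. u *\<^sub>R D 0)) (at 0)" using G(2)[of 0] by simp
  from has_derivative_unique[OF this line[of z 0]] have "1 *\<^sub>R D 0 = 1 *\<^sub>R ?h (z + 0 *\<^sub>R ?a)" by metis
  then have "?h z = (\<Sum>n. of_real (c n) * ?h (z - v n))" by (simp add: D_def)
  then show ?thesis using summable_sums[OF summ[of "\<lambda>n. z - v n"]] by simp
qed

lemma sampling_formula_partial_derivs:
  fixes g :: "real ^ 'n::finite \<Rightarrow> complex" and c :: "nat \<Rightarrow> real"
  assumes g: "g \<in> schwartz" and c: "summable (\<lambda>n. \<bar>c n\<bar>)"
    and sums: "\<And>z. (\<lambda>n. of_real (c n) * g (z - v n)) sums g z"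
  shows "(\<lambda>n. of_real (c n) * partial_derivs js g (z - v n)) sums partial_derivs js g z"
proof (induction js arbitrary: z)
  case (Cons j js)
  then show ?case
    using sampling_formula_partial_deriv[OF partial_derivs_schwartz[OF g, of js] c] by simp
qed (use sums in simp)

section \<open>Convolution with tempered distributions\<close>

lemma tempered_linear:
  "u \<in> tempered_distributions \<Longrightarrow> f \<in> schwartz \<Longrightarrow> g \<in> schwartz \<Longrightarrow> u (\<lambda>x. a * f x + b * g x) = a * u f + b * u g"
  by (simp add: tempered_distributions_def)

lemma tempered_sum:
  fixes f :: "nat \<Rightarrow> real ^ 'n::finite \<Rightarrow> complex"
  assumes u: "u \<in> tempered_distributions" and g: "g \<in> schwartz" and f: "\<And>n. f n \<in> schwartz"
  shows "u (\<lambda>y. g y - (\<Sum>n<L. c n * f n y)) = u g - (\<Sum>n<L. c n * u (f n))"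
proof (induction L)
  case (Suc L)
  then show ?case
    using tempered_linear[OF u schwartz_sum(1)[OF g, of f c L, OF f] f, of 1 "- c L" L] by (simp add: diff_diff_eq)
qed simp

lemma tempered_order:
  assumes "u \<in> tempered_distributions"
  obtains N C where "0 \<le> C" "\<And>f. f \<in> schwartz \<Longrightarrow> cmod (u f) \<le> C * schwartz_seminorm N f"
proof -
  obtain N C where "\<And>f. f \<in> schwartz \<Longrightarrow> cmod (u f) \<le> C * schwartz_seminorm N f"
    using assms unfolding tempered_distributions_def by blast
  moreover have "0 \<le> schwartz_seminorm N f" if "f \<in> schwartz" for f :: "real ^ 'a \<Rightarrow> complex"
    using schwartz_seminorm_ge[OF that, of "[]" N 0] by (simp add: order_trans[OF norm_ge_zero])
  ultimately have "cmod (u f) \<le> \<bar>C\<bar> * schwartz_seminorm N f" if "f \<in> schwartz" for f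
    using that by (meson abs_ge_self mult_right_mono order_trans)
  then show ?thesis by (intro that[of "\<bar>C\<bar>" N]) auto
qed

lemma schwartz_reflect: "\<psi> \<in> schwartz \<Longrightarrow> (\<lambda>y. \<psi> (x - y)) \<in> schwartz"
  using schwartz_affine[of \<psi> "-1" x] by simp

lemma partial_derivs_reflect:
  "\<psi> \<in> schwartz \<Longrightarrow> partial_derivs js (\<lambda>y. \<psi> (x - y)) = (\<lambda>y. (-1) ^ length js * partial_derivs js \<psi> (x - y))"
  using partial_derivs_affine[of \<psi> js x "-1"] by (simp add: scaleR_conv_of_real)

text \<open>The remainder of the kernel's sampling formula is a Schwartz function, and its seminorm
  of the order \<open>N\<close> of \<open>u\<close> is bounded by a tail of the weighted series: (1
  + |y|)^N is absorbed by the N-th powers of 1 + |x|, 1 + |s n| and 1 plus the size of the argument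
  of the kernel. Continuity of \<open>u\<close> then sends the remainder to 0.\<close>

lemma convolve_sampling_formula:
  fixes \<psi> :: "real ^ 'n::finite \<Rightarrow> complex" and c s :: "nat \<Rightarrow> real"
  assumes u: "u \<in> tempered_distributions" and C: "0 \<le> C" "\<And>f. f \<in> schwartz \<Longrightarrow> cmod (u f) \<le> C * schwartz_seminorm N f"
    and \<psi>: "\<psi> \<in> schwartz" and c: "summable (\<lambda>n. \<bar>c n\<bar> * (1 + \<bar>s n\<bar>) ^ N)"
    and sums: "\<And>js z. (\<lambda>n. of_real (c n) * partial_derivs js \<psi> (z - s n *\<^sub>R axis i 1)) sums partial_derivs js \<psi> z"
  shows "(\<lambda>n. of_real (c n) * convolve \<psi> u (x - s n *\<^sub>R axis i 1)) sums convolve \<psi> u x"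
proof -
  let ?a = "\<lambda>n. \<bar>c n\<bar> * (1 + \<bar>s n\<bar>) ^ N" and ?e = "axis i 1 :: real ^ 'n"
  let ?D = "schwartz_seminorm N \<psi>"
  let ?g = "\<lambda>L y. \<psi> (x - y) - (\<Sum>n<L. of_real (c n) * \<psi> (x - s n *\<^sub>R ?e - y))"
  have D: "0 \<le> ?D" using schwartz_seminorm_ge[OF \<psi>, of "[]" N 0] by (simp add: order_trans[OF norm_ge_zero])
  have tail: "(\<lambda>n. ?a (n + L)) sums (suminf ?a - sum ?a {..<L})" for L
    by (rule sums_split_initial_segment[OF summable_sums[OF c]])
  have semi: "schwartz_seminorm N (?g L) \<le> (1 + norm x) ^ N * ?D * (suminf ?a - sum ?a {..<L})" for L
  proof (rule schwartz_seminorm_le)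
    fix js y assume js: "length (js :: 'n list) \<le> N"
    let ?h = "partial_derivs js \<psi>"
    have swap: "x - s n *\<^sub>R ?e - y = x - y - s n *\<^sub>R ?e" for n by simp
    have "partial_derivs js (?g L) y = (-1) ^ length js * (?h (x - y) - (\<Sum>n<L. of_real (c n) * ?h (x - y - s n *\<^sub>R ?e)))"
      by (simp add: schwartz_sum(2)[OF schwartz_reflect[OF \<psi>] schwartz_reflect[OF \<psi>]] partial_derivs_reflect[OF \<psi>]
           right_diff_distrib sum_distrib_left mult_ac swap)
    then have "cmod (partial_derivs js (?g L) y) = cmod (?h (x - y) - (\<Sum>n<L. of_real (c n) * ?h (x - y - s n *\<^sub>R ?e)))"
      by (simp add: norm_mult norm_power)
    also have "\<dots> = cmod (\<Sum>n. of_real (c (n + L)) * ?h (x - y - s (n + L) *\<^sub>R ?e))"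
      using sums_unique[OF sums_split_initial_segment[OF sums[of js "x - y"], of L]] by simp
    finally have norm_eq: "cmod (partial_derivs js (?g L) y) = cmod (\<Sum>n. of_real (c (n + L)) * ?h (x - y - s (n + L) *\<^sub>R ?e))" .
    have "(1 + norm y) ^ N * cmod (partial_derivs js (?g L) y) =
      cmod (of_real ((1 + norm y) ^ N) * (\<Sum>n. of_real (c (n + L)) * ?h (x - y - s (n + L) *\<^sub>R ?e)))"
      unfolding norm_eq norm_mult norm_of_real by simp
    also have "of_real ((1 + norm y) ^ N) * (\<Sum>n. of_real (c (n + L)) * ?h (x - y - s (n + L) *\<^sub>R ?e)) =
      (\<Sum>n. of_real ((1 + norm y) ^ N) * (of_real (c (n + L)) * ?h (x - y - s (n + L) *\<^sub>R ?e)))"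
      by (rule suminf_mult[symmetric, OF sums_summable[OF sums_split_initial_segment[OF sums]]])
    also have "cmod \<dots> \<le> (\<Sum>n. (1 + norm x) ^ N * ?D * ?a (n + L))"
    proof (rule norm_suminf_le)
      fix n
      let ?s = "s (n + L) *\<^sub>R ?e"
      have "1 + norm y \<le> (1 + norm (x - ?s)) * (1 + norm (x - y - ?s))"
        using one_plus_norm_add_le[of "x - ?s" "- (x - y - ?s)"] by (simp add: norm_minus_commute algebra_simps)
      also have "\<dots> \<le> ((1 + norm x) * (1 + norm ?s)) * (1 + norm (x - y - ?s))"
        using one_plus_norm_add_le[of x "- ?s"] by (intro mult_right_mono) auto
      finally have "(1 + norm y) ^ N \<le> (((1 + norm x) * (1 + \<bar>s (n + L)\<bar>)) * (1 + norm (x - y - ?s))) ^ N"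
        by (intro power_mono) (auto simp: norm_axis_1)
      then have "(1 + norm y) ^ N * (\<bar>c (n + L)\<bar> * cmod (?h (x - y - ?s))) \<le>
        (((1 + norm x) * (1 + \<bar>s (n + L)\<bar>)) * (1 + norm (x - y - ?s))) ^ N * (\<bar>c (n + L)\<bar> * cmod (?h (x - y - ?s)))"
        by (intro mult_right_mono) auto
      also have "\<dots> = (1 + norm x) ^ N * ?a (n + L) * ((1 + norm (x - y - ?s)) ^ N * cmod (?h (x - y - ?s)))"
        by (simp only: power_mult_distrib mult_ac)
      also have "\<dots> \<le> (1 + norm x) ^ N * ?a (n + L) * ?D"
        by (intro mult_left_mono schwartz_seminorm_ge \<psi> js) auto
      finally show "norm (of_real ((1 + norm y) ^ N) * (of_real (c (n + L)) * ?h (x - y - ?s))) \<le> (1 + norm x) ^ N * ?D * ?a (n + L)"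
        unfolding norm_mult norm_of_real by (simp add: mult_ac)
    next
      show "summable (\<lambda>n. (1 + norm x) ^ N * ?D * ?a (n + L))"
        by (rule summable_mult[OF sums_summable[OF tail]])
    qed
    also have "\<dots> = (1 + norm x) ^ N * ?D * (suminf ?a - sum ?a {..<L})"
      using sums_unique[OF sums_mult[OF tail]] by simp
    finally show "(1 + norm y) ^ N * cmod (partial_derivs js (?g L) y) \<le> (1 + norm x) ^ N * ?D * (suminf ?a - sum ?a {..<L})" .
  qed
  have bound: "cmod (convolve \<psi> u x - (\<Sum>n<L. of_real (c n) * convolve \<psi> u (x - s n *\<^sub>R ?e))) \<le>
      C * ((1 + norm x) ^ N * ?D * (suminf ?a - sum ?a {..<L}))" for L
  proof -
    have "?g L \<in> schwartz" by (intro schwartz_sum schwartz_reflect \<psi>)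
    then have "cmod (u (?g L)) \<le> C * schwartz_seminorm N (?g L)" by (rule C(2))
    also have "\<dots> \<le> C * ((1 + norm x) ^ N * ?D * (suminf ?a - sum ?a {..<L}))" by (intro mult_left_mono semi C(1))
    finally show ?thesis
      unfolding convolve_def tempered_sum[OF u schwartz_reflect[OF \<psi>] schwartz_reflect[OF \<psi>]] .
  qed
  have "(\<lambda>L. C * ((1 + norm x) ^ N * ?D * (suminf ?a - sum ?a {..<L}))) \<longlonglongrightarrow> C * ((1 + norm x) ^ N * ?D * (suminf ?a - suminf ?a))"
    by (intro tendsto_intros summable_LIMSEQ c)
  then have "(\<lambda>L. C * ((1 + norm x) ^ N * ?D * (suminf ?a - sum ?a {..<L}))) \<longlonglongrightarrow> 0" by simp
  then have "(\<lambda>L. convolve \<psi> u x - (\<Sum>n<L. of_real (c n) * convolve \<psi> u (x - s n *\<^sub>R ?e))) \<longlonglongrightarrow> 0"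
    by (rule Lim_null_comparison[rotated]) (auto intro!: always_eventually bound)
  from tendsto_diff[OF tendsto_const[of "convolve \<psi> u x"] this] show ?thesis
    unfolding sums_def by simp
qed

section \<open>Continuity of the convolution\<close>

lemma schwartz_frechet_bound:
  fixes g :: "real ^ 'n::finite \<Rightarrow> complex"
  assumes g: "g \<in> schwartz"
  obtains B where "0 \<le> B" "\<And>w h. (1 + norm w) ^ N * cmod (frechet_derivative g (at w) h) \<le> B * norm h"
proof -
  have d: "g differentiable (at y)" for y using schwartz_differentiable[OF g, of "[]"] by simp
  have "\<exists>b. 0 < b \<and> (\<forall>w. (1 + norm w) ^ N * cmod (partial_derivs [i] g w) \<le> b)" for i
    by (rule schwartz_bounded[OF g]) blast
  then have "\<exists>B. \<forall>i. 0 < B i \<and> (\<forall>w. (1 + norm w) ^ N * cmod (partial_deriv i g w) \<le> B i)"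
    by (intro choice allI) simp
  then obtain B where B: "\<And>i. 0 < B i" "\<And>i w. (1 + norm w) ^ N * cmod (partial_deriv i g w) \<le> B i" by blast
  show ?thesis
  proof (rule that[of "\<Sum>i\<in>UNIV. B i"])
    show "0 \<le> (\<Sum>i\<in>UNIV. B i)" using B(1) by (intro sum_nonneg) (auto intro: less_imp_le)
    fix w h :: "real ^ 'n"
    have lin: "linear (frechet_derivative g (at w))" by (rule linear_frechet_derivative[OF d])
    have "frechet_derivative g (at w) h = frechet_derivative g (at w) (\<Sum>i\<in>UNIV. (h $ i) *\<^sub>R axis i 1)"
      using basis_expansion[of h] by (simp add: scalar_mult_eq_scaleR)
    also have "\<dots> = (\<Sum>i\<in>UNIV. (h $ i) *\<^sub>R partial_deriv i g w)"
      by (simp add: linear_sum[OF lin] linear_scale[OF lin] partial_deriv_def)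
    finally have "cmod (frechet_derivative g (at w) h) \<le> (\<Sum>i\<in>UNIV. \<bar>h $ i\<bar> * cmod (partial_deriv i g w))"
      by (simp only:) (rule order_trans[OF norm_sum], simp)
    also have "\<dots> \<le> (\<Sum>i\<in>UNIV. norm h * cmod (partial_deriv i g w))"
      by (intro sum_mono mult_right_mono component_le_norm_cart) auto
    finally have "(1 + norm w) ^ N * cmod (frechet_derivative g (at w) h) \<le> (1 + norm w) ^ N * (\<Sum>i\<in>UNIV. norm h * cmod (partial_deriv i g w))"
      by (intro mult_left_mono) auto
    also have "\<dots> = (\<Sum>i\<in>UNIV. ((1 + norm w) ^ N * cmod (partial_deriv i g w)) * norm h)"
      by (simp add: sum_distrib_left mult_ac)
    also have "\<dots> \<le> (\<Sum>i\<in>UNIV. B i * norm h)" by (intro sum_mono mult_right_mono B) auto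
    finally show "(1 + norm w) ^ N * cmod (frechet_derivative g (at w) h) \<le> (\<Sum>i\<in>UNIV. B i) * norm h"
      by (simp add: sum_distrib_right)
  qed
qed

text \<open>The mean value inequality on the unit ball around x - y, on which 1 + |y| is at most (2
  + |x|) (1 + |w|), so the weight can be moved to the point w where the derivative is taken.\<close>

lemma schwartz_increment_bound:
  fixes g :: "real ^ 'n::finite \<Rightarrow> complex"
  assumes g: "g \<in> schwartz"
  obtains B where "0 \<le> B"
    "\<And>x x' y. norm (x' - x) \<le> 1 \<Longrightarrow> (1 + norm y) ^ N * cmod (g (x' - y) - g (x - y)) \<le> (2 + norm x) ^ N * B * norm (x' - x)"
proof -
  have d: "g differentiable (at y)" for y using schwartz_differentiable[OF g, of "[]"] by simp
  obtain B where B: "0 \<le> B" "\<And>w h. (1 + norm w) ^ N * cmod (frechet_derivative g (at w) h) \<le> B * norm h"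
    using schwartz_frechet_bound[OF g] by blast
  show ?thesis
  proof (rule that[OF B(1)])
    fix x x' y :: "real ^ 'n" assume x': "norm (x' - x) \<le> 1"
    let ?K = "(2 + norm x) ^ N * B / (1 + norm y) ^ N"
    have "norm (g (x' - y) - g (x - y)) \<le> ?K * norm ((x' - y) - (x - y))"
    proof (rule differentiable_bound[of "cball (x - y) 1"])
      show "(g has_derivative frechet_derivative g (at w)) (at w within cball (x - y) 1)" for w
        using has_derivative_frechet[OF d] by (rule has_derivative_at_withinI)
      fix w assume "w \<in> cball (x - y) 1"
      then have w: "norm (w - (x - y)) \<le> 1" by (simp add: dist_norm norm_minus_commute)
      have "1 + norm y \<le> (2 + norm x) * (1 + norm w)"
      proof -
        have 1: "1 + norm y \<le> (1 + norm (y + w)) * (1 + norm w)"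
          using one_plus_norm_add_le[of "y + w" "- w"] by simp
        have 2: "norm (y + w) \<le> 1 + norm x"
        proof -
          have "y + w = (w - (x - y)) + x" by simp
          then have "norm (y + w) \<le> norm (w - (x - y)) + norm x" by (metis norm_triangle_ineq)
          then show ?thesis using w by linarith
        qed
        have "(1 + norm (y + w)) * (1 + norm w) \<le> (2 + norm x) * (1 + norm w)"
          using 2 by (intro mult_right_mono) auto
        with 1 show ?thesis by (rule order_trans)
      qed
      then have "(1 + norm y) ^ N \<le> ((2 + norm x) * (1 + norm w)) ^ N" by (intro power_mono) auto
      then have le: "(1 + norm y) ^ N \<le> (2 + norm x) ^ N * (1 + norm w) ^ N" by (simp only: power_mult_distrib)
      show "onorm (frechet_derivative g (at w)) \<le> ?K"
      proof (rule onorm_le)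
        fix h
        have "(1 + norm y) ^ N * cmod (frechet_derivative g (at w) h) \<le> (2 + norm x) ^ N * ((1 + norm w) ^ N * cmod (frechet_derivative g (at w) h))"
          unfolding mult.assoc[symmetric] by (intro mult_right_mono le) auto
        also have "\<dots> \<le> (2 + norm x) ^ N * (B * norm h)" by (intro mult_left_mono B(2)) auto
        finally show "norm (frechet_derivative g (at w) h) \<le> ?K * norm h"
          by (simp add: pos_le_divide_eq add_pos_nonneg mult_ac)
      qed
    qed (use x' in \<open>auto simp: dist_norm norm_minus_commute\<close>)
    then show "(1 + norm y) ^ N * cmod (g (x' - y) - g (x - y)) \<le> (2 + norm x) ^ N * B * norm (x' - x)"
      by (simp add: pos_le_divide_eq add_pos_nonneg mult_ac)
  qed
qed

text \<open>Continuity is what makes the pieces Borel measurable. Moving x changes the test function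
  by an amount whose seminorm of the order of \<open>u\<close> is at most a constant times |x' - x|;
  adding the constants of the finitely many relevant index lists makes it a single one.\<close>

lemma continuous_convolve:
  fixes \<psi> :: "real ^ 'n::finite \<Rightarrow> complex"
  assumes u: "u \<in> tempered_distributions" and \<psi>: "\<psi> \<in> schwartz"
  shows "continuous_on UNIV (convolve \<psi> u)"
proof -
  obtain N C where C: "0 \<le> C" "\<And>f. f \<in> schwartz \<Longrightarrow> cmod (u f) \<le> C * schwartz_seminorm N f"
    by (rule tempered_order[OF u], rule that)
  have "\<exists>b. 0 \<le> b \<and> (\<forall>x x' y. norm (x' - x) \<le> 1 \<longrightarrow>
      (1 + norm y) ^ N * cmod (partial_derivs js \<psi> (x' - y) - partial_derivs js \<psi> (x - y)) \<le> (2 + norm x) ^ N * b * norm (x' - x))" for js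
    by (rule schwartz_increment_bound[OF partial_derivs_schwartz[OF \<psi>]]) blast
  then have "\<exists>B. \<forall>js. 0 \<le> B js \<and> (\<forall>x x' y. norm (x' - x) \<le> 1 \<longrightarrow>
      (1 + norm y) ^ N * cmod (partial_derivs js \<psi> (x' - y) - partial_derivs js \<psi> (x - y)) \<le> (2 + norm x) ^ N * B js * norm (x' - x))"
    by (intro choice allI)
  then obtain B where B: "\<And>js. 0 \<le> B js" "\<And>js x x' y. norm (x' - x) \<le> 1 \<Longrightarrow>
      (1 + norm y) ^ N * cmod (partial_derivs js \<psi> (x' - y) - partial_derivs js \<psi> (x - y)) \<le> (2 + norm x) ^ N * B js * norm (x' - x)"
    by blast
  define K where "K = (\<Sum>js | length js \<le> N. B js)"
  have BK: "B js \<le> K" if "length js \<le> N" for js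
    unfolding K_def using that B(1) finite_index_lists by (intro member_le_sum) auto
  have bound: "cmod (convolve \<psi> u x' - convolve \<psi> u x) \<le> C * ((2 + norm x) ^ N * K) * norm (x' - x)" if x': "norm (x' - x) \<le> 1" for x x'
  proof -
    let ?g = "\<lambda>y. 1 * \<psi> (x' - y) + (-1) * \<psi> (x - y)"
    have "convolve \<psi> u x' - convolve \<psi> u x = u ?g"
      unfolding convolve_def tempered_linear[OF u schwartz_reflect[OF \<psi>] schwartz_reflect[OF \<psi>]] by simp
    also have "cmod (u ?g) \<le> C * schwartz_seminorm N ?g"
      by (intro C schwartz_linear schwartz_reflect \<psi>)
    also have "schwartz_seminorm N ?g \<le> (2 + norm x) ^ N * K * norm (x' - x)"
    proof (rule schwartz_seminorm_le)
      fix js :: "'n list" and y assume js: "length js \<le> N"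
      have "partial_derivs js ?g y = (-1) ^ length js * (partial_derivs js \<psi> (x' - y) - partial_derivs js \<psi> (x - y))"
        unfolding partial_derivs_linear[OF schwartz_reflect[OF \<psi>] schwartz_reflect[OF \<psi>]] partial_derivs_reflect[OF \<psi>]
        by (simp add: algebra_simps)
      then have "(1 + norm y) ^ N * cmod (partial_derivs js ?g y) = (1 + norm y) ^ N * cmod (partial_derivs js \<psi> (x' - y) - partial_derivs js \<psi> (x - y))"
        by (simp add: norm_mult norm_power)
      also have "\<dots> \<le> (2 + norm x) ^ N * B js * norm (x' - x)" by (rule B(2)[OF x'])
      also have "\<dots> \<le> (2 + norm x) ^ N * K * norm (x' - x)" by (intro mult_right_mono mult_left_mono BK js) auto
      finally show "(1 + norm y) ^ N * cmod (partial_derivs js ?g y) \<le> (2 + norm x) ^ N * K * norm (x' - x)" .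
    qed
    finally show ?thesis using C(1) by (simp add: mult_left_mono mult.assoc)
  qed
  have "(convolve \<psi> u \<longlongrightarrow> convolve \<psi> u x) (at x)" for x
  proof -
    have "((\<lambda>x'. C * ((2 + norm x) ^ N * K) * norm (x' - x)) \<longlongrightarrow> C * ((2 + norm x) ^ N * K) * norm (x - x)) (at x)"
      by (intro tendsto_intros)
    then have "((\<lambda>x'. C * ((2 + norm x) ^ N * K) * norm (x' - x)) \<longlongrightarrow> 0) (at x)" by simp
    moreover have "\<forall>\<^sub>F x' in at x. norm (convolve \<psi> u x' - convolve \<psi> u x) \<le> C * ((2 + norm x) ^ N * K) * norm (x' - x)"
      unfolding eventually_at by (intro exI[of _ 1]) (auto intro!: bound simp: dist_norm)
    ultimately have "((\<lambda>x'. convolve \<psi> u x' - convolve \<psi> u x) \<longlongrightarrow> 0) (at x)"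
      by (rule Lim_null_comparison[rotated])
    then show ?thesis by (simp add: LIM_zero_iff)
  qed
  then show ?thesis by (auto simp: continuous_on_def intro: tendsto_within_subset)
qed

section \<open>The Littlewood-Paley pieces\<close>

lemma schwartz_lp_piece:
  fixes \<Phi> \<phi> :: "real ^ 'n::finite \<Rightarrow> complex"
  assumes "\<Phi> \<in> schwartz" "\<phi> \<in> schwartz"
  shows "lp_piece \<Phi> \<phi> k \<in> schwartz"
proof (cases "k = 0")
  case False
  have "(\<lambda>x. \<phi> (0 + 2 ^ k *\<^sub>R x)) \<in> schwartz" by (intro schwartz_affine assms) auto
  from schwartz_linear[OF this this, of "2 ^ (k * CARD('n))" 0] show ?thesis
    using False by (simp add: lp_piece_def)
qed (use assms in \<open>simp add: lp_piece_def\<close>)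

text \<open>Both generators have their spectrum in the ball of radius 2, so the formula with step 1
  / 2 applies to them; dilating by 2^k shrinks the step to 2 powr (- k - 1).\<close>

lemma lp_piece_sampling_formula:
  fixes \<Phi> \<phi> :: "real ^ 'n::finite \<Rightarrow> complex" and c t :: "nat \<Rightarrow> real"
  assumes lp: "littlewood_paley_pair \<Phi> \<phi>"
    and c: "summable (\<lambda>n. \<bar>c n\<bar>)"
    and one: "\<And>\<theta>. \<bar>\<theta>\<bar> \<le> 1 \<Longrightarrow> (\<lambda>n. of_real (c n) * exp (- \<i> * of_real (t n * \<theta>))) sums (1 :: complex)"
  shows "(\<lambda>n. of_real (c n) * lp_piece \<Phi> \<phi> k (z - (t n / 2 ^ (k + 1)) *\<^sub>R axis i 1)) sums lp_piece \<Phi> \<phi> k z"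
proof (cases "k = 0")
  case True
  have "\<Phi> \<in> schwartz" "supp (fourier \<Phi>) \<subseteq> {\<xi>. norm \<xi> \<le> 2}" using lp by (auto simp: littlewood_paley_pair_def)
  from schwartz_sampling_formula[OF this c one] show ?thesis using True by (simp add: lp_piece_def)
next
  case False
  have "\<phi> \<in> schwartz" "supp (fourier \<phi>) \<subseteq> {\<xi>. norm \<xi> \<le> 2}" using lp by (auto simp: littlewood_paley_pair_def)
  from sums_mult[OF schwartz_sampling_formula[OF this c one, of "2 ^ k *\<^sub>R z" i], of "2 ^ (k * CARD('n))"]
  show ?thesis using False by (simp add: lp_piece_def scaleR_diff_right mult_ac)
qed

lemma ennreal_norm_suminf_le:
  fixes f :: "nat \<Rightarrow> complex"
  assumes "f sums s"
  shows "ennreal (cmod s) \<le> (\<Sum>n. ennreal (cmod (f n)))"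
proof -
  have lim: "(\<lambda>L. ennreal (cmod (\<Sum>n<L. f n))) \<longlonglongrightarrow> ennreal (cmod s)"
    using assms unfolding sums_def by (intro tendsto_ennrealI tendsto_norm)
  have "ennreal (cmod (\<Sum>n<L. f n)) \<le> (\<Sum>n. ennreal (cmod (f n)))" for L
  proof -
    have "ennreal (cmod (\<Sum>n<L. f n)) \<le> ennreal (\<Sum>n<L. cmod (f n))" by (intro ennreal_leI norm_sum)
    also have "\<dots> = (\<Sum>n<L. ennreal (cmod (f n)))" by simp
    also have "\<dots> \<le> (\<Sum>n. ennreal (cmod (f n)))" by (intro sum_le_suminf) auto
    finally show ?thesis .
  qed
  then show ?thesis by (intro LIMSEQ_le_const2[OF lim] exI allI impI)
qed

text \<open>\<open>A\<close> must be independent of \<open>u\<close>, of the scale and of the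
  offset. The weights themselves depend on \<tau> and, through \<open>N\<close>, on the order of
  \<open>u\<close>, but their decay constant of order \<open>M\<close> does not, and only that
  constant survives in the bound.\<close>

lemma lp_piece_sampling_dominated:
  fixes \<Phi> \<phi> :: "real ^ 'n::finite \<Rightarrow> complex"
  assumes lp: "littlewood_paley_pair \<Phi> \<phi>" and a: "0 < a" "a \<le> 1"
  obtains A where "0 < A"
    and "\<And>u. u \<in> tempered_distributions \<Longrightarrow>
      sampling_dominated A (\<lambda>k x. ennreal_powr (ennreal (cmod (convolve (lp_piece \<Phi> \<phi> k) u x))) a)"
proof -
  \<comment> \<open>This makes M a exceed 2, so that (1 + |t|) powr (M a) dominates 1 + t^2 once
    a-th powers are taken.\<close>
  obtain M :: nat where M: "2 / a < real M" using reals_Archimedean2 by blast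
  have \<psi>: "lp_piece \<Phi> \<phi> k \<in> schwartz" for k
    using lp by (intro schwartz_lp_piece) (auto simp: littlewood_paley_pair_def)
  obtain C where C: "0 < C" and samp: "\<And>(N :: nat) \<tau> t. \<lbrakk>0 \<le> \<tau>; \<tau> < 1; \<And>n. t n = of_int (int_decode n) + \<tau>\<rbrakk> \<Longrightarrow>
      \<exists>c :: nat \<Rightarrow> real. (\<forall>n. \<bar>c n\<bar> * (1 + \<bar>t n\<bar>) ^ M \<le> C) \<and> summable (\<lambda>n. \<bar>c n\<bar> * (1 + \<bar>t n\<bar>) ^ N) \<and>
        (\<forall>\<theta>. \<bar>\<theta>\<bar> \<le> 1 \<longrightarrow> (\<lambda>n. of_real (c n) * exp (- \<i> * of_real (t n * \<theta>))) sums 1)"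
    by (rule sampling_sequence[of M]) blast
  show ?thesis
  proof (rule that[of "C powr a"])
    show "0 < C powr a" using C by simp
    fix u :: "(real ^ 'n \<Rightarrow> complex) \<Rightarrow> complex" assume u: "u \<in> tempered_distributions"
    obtain N D where D: "0 \<le> D" "\<And>f. f \<in> schwartz \<Longrightarrow> cmod (u f) \<le> D * schwartz_seminorm N f"
      by (rule tempered_order[OF u], rule that)
    let ?f = "\<lambda>k. convolve (lp_piece \<Phi> \<phi> k) u"
    show "sampling_dominated (C powr a) (\<lambda>k x. ennreal_powr (ennreal (cmod (?f k x))) a)"
      unfolding sampling_dominated_def
    proof (intro conjI allI ballI)
      fix k
      have [measurable]: "?f k \<in> borel_measurable borel"
        by (intro borel_measurable_continuous_onI continuous_convolve u \<psi>)
      show "(\<lambda>x. ennreal_powr (ennreal (cmod (?f k x))) a) \<in> borel_measurable borel" by measurable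
    next
      fix k i x and \<tau> :: real assume \<tau>: "\<tau> \<in> {0..<1}"
      define t where "t n = of_int (int_decode n) + \<tau>" for n
      obtain c :: "nat \<Rightarrow> real" where c: "\<And>n. \<bar>c n\<bar> * (1 + \<bar>t n\<bar>) ^ M \<le> C" "summable (\<lambda>n. \<bar>c n\<bar> * (1 + \<bar>t n\<bar>) ^ N)"
        "\<And>\<theta>. \<bar>\<theta>\<bar> \<le> 1 \<Longrightarrow> (\<lambda>n. of_real (c n) * exp (- \<i> * of_real (t n * \<theta>))) sums (1 :: complex)"
        using samp[of \<tau> t N] \<tau> t_def by auto
      have abs_c: "summable (\<lambda>n. \<bar>c n\<bar>)"
      proof (rule summable_comparison_test'[OF c(2)])
        fix n
        have "1 \<le> (1 + \<bar>t n\<bar>) ^ N" by (intro one_le_power) auto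
        from mult_left_mono[OF this, of "\<bar>c n\<bar>"] show "norm \<bar>c n\<bar> \<le> \<bar>c n\<bar> * (1 + \<bar>t n\<bar>) ^ N" by simp
      qed
      let ?s = "\<lambda>n. t n / 2 ^ (k + 1)"
      have s: "\<bar>?s n\<bar> \<le> \<bar>t n\<bar>" for n
      proof -
        have "(1::real) \<le> 2 ^ (k + 1)" by (intro one_le_power) auto
        from divide_left_mono[OF this, of "\<bar>t n\<bar>"] show ?thesis by (simp add: abs_divide)
      qed
      have "(\<lambda>n. of_real (c n) * ?f k (x - ?s n *\<^sub>R axis i 1)) sums ?f k x"
      proof (rule convolve_sampling_formula[OF u D \<psi>])
        show "summable (\<lambda>n. \<bar>c n\<bar> * (1 + \<bar>?s n\<bar>) ^ N)"
          by (rule summable_comparison_test'[OF c(2)]) (use s in \<open>auto intro!: mult_left_mono power_mono\<close>)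
        show "(\<lambda>n. of_real (c n) * partial_derivs js (lp_piece \<Phi> \<phi> k) (z - ?s n *\<^sub>R axis i 1)) sums partial_derivs js (lp_piece \<Phi> \<phi> k) z" for js z
          by (rule sampling_formula_partial_derivs[OF \<psi> abs_c lp_piece_sampling_formula[OF lp abs_c c(3)]])
      qed
      then have "ennreal (cmod (?f k x)) \<le> (\<Sum>n. ennreal (cmod (of_real (c n) * ?f k (x - ?s n *\<^sub>R axis i 1))))"
        by (rule ennreal_norm_suminf_le)
      then have "ennreal_powr (ennreal (cmod (?f k x))) a \<le> (\<Sum>n. ennreal_powr (ennreal (cmod (of_real (c n) * ?f k (x - ?s n *\<^sub>R axis i 1)))) a)"
        using a by (intro order_trans[OF ennreal_powr_mono ennreal_powr_suminf_le]) auto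
      also have "\<dots> \<le> (\<Sum>n. ennreal (C powr a / (1 + (t n)\<^sup>2)) * ennreal_powr (ennreal (cmod (?f k (x - ?s n *\<^sub>R axis i 1)))) a)"
      proof (intro suminf_le)
        fix n
        have "\<bar>c n\<bar> powr a \<le> C powr a / (1 + (t n)\<^sup>2)"
        proof -
          let ?y = "1 + \<bar>t n\<bar>"
          have "(\<bar>c n\<bar> * ?y ^ M) powr a \<le> C powr a" using a by (intro powr_mono2 c(1)) auto
          moreover have "(\<bar>c n\<bar> * ?y ^ M) powr a = \<bar>c n\<bar> powr a * ?y powr (real M * a)"
            by (simp add: powr_mult powr_realpow[symmetric] powr_powr)
          moreover have "?y powr 2 \<le> ?y powr (real M * a)" using M a by (intro powr_mono) (auto simp: field_simps)
          moreover have "1 + (t n)\<^sup>2 \<le> ?y powr 2" by (simp add: power2_sum)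
          ultimately have 1: "\<bar>c n\<bar> powr a * ?y powr (real M * a) \<le> C powr a" and 2: "1 + (t n)\<^sup>2 \<le> ?y powr (real M * a)"
            by simp_all
          have "\<bar>c n\<bar> powr a * (1 + (t n)\<^sup>2) \<le> C powr a"
            by (rule order_trans[OF mult_left_mono[OF 2] 1]) simp
          then show ?thesis by (simp add: pos_le_divide_eq add_pos_nonneg)
        qed
        then show "ennreal_powr (ennreal (cmod (of_real (c n) * ?f k (x - ?s n *\<^sub>R axis i 1)))) a \<le>
           ennreal (C powr a / (1 + (t n)\<^sup>2)) * ennreal_powr (ennreal (cmod (?f k (x - ?s n *\<^sub>R axis i 1)))) a"
          using a by (simp add: norm_mult ennreal_mult ennreal_powr_mult)
            (intro mult_right_mono, simp_all add: ennreal_powr_ennreal ennreal_leI)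
      qed auto
      finally show "ennreal_powr (ennreal (cmod (?f k x))) a \<le> (\<Sum>n. ennreal (C powr a / (1 + (of_int (int_decode n) + \<tau>)\<^sup>2)) *
         ennreal_powr (ennreal (cmod (?f k (x - ((of_int (int_decode n) + \<tau>) / 2 ^ (k + 1)) *\<^sub>R axis i 1)))) a)"
        unfolding t_def .
    qed
  qed
qed

section \<open>The embedding\<close>

text \<open>For finite \<beta> this is the subadditivity of the power a / \<beta> \<le> 1 over a
  series; for \<beta> = \<infinity> every term is below the sum.\<close>

lemma lq_norm_powr_le:
  fixes b :: "nat \<Rightarrow> ennreal"
  assumes a: "0 < a" and \<beta>: "\<beta> = \<infinity> \<or> a \<le> enn2real \<beta>"
  shows "ennreal_powr (lq_norm \<beta> b) a \<le> (\<Sum>k. ennreal_powr (b k) a)"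
proof (cases "\<beta> = \<infinity>")
  case True
  then show ?thesis
    using a by (auto simp: lq_norm_def ennreal_powr_SUP intro!: SUP_least ennreal_suminf_ge)
next
  case False
  then obtain c where c: "\<beta> = ennreal c" "0 \<le> c" by (cases \<beta>) auto
  with False \<beta> a have ac: "a \<le> c" "0 < c" by auto
  have "ennreal_powr (lq_norm \<beta> b) a = ennreal_powr (\<Sum>k. ennreal_powr (b k) c) (a / c)"
    using c by (simp add: lq_norm_nat Lp_norm_ennreal ennreal_powr_powr nn_integral_count_space_nat)
  also have "\<dots> \<le> (\<Sum>k. ennreal_powr (ennreal_powr (b k) c) (a / c))"
    using a ac by (intro ennreal_powr_suminf_le) auto
  finally show ?thesis using ac by (simp add: ennreal_powr_powr)
qed

lemma SUP_le_lq_norm: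
  fixes b :: "nat \<Rightarrow> ennreal"
  assumes "0 < \<theta>"
  shows "(SUP k. b k) \<le> lq_norm \<theta> b"
proof (cases "\<theta> = \<infinity>")
  case False
  then obtain c where c: "\<theta> = ennreal c" "0 < c" using assms by (cases \<theta>) auto
  show ?thesis
  proof (rule SUP_least)
    fix k
    have "b k = ennreal_powr (ennreal_powr (b k) c) (1 / c)" using c by (simp add: ennreal_powr_powr)
    also have "\<dots> \<le> ennreal_powr (\<Sum>k. ennreal_powr (b k) c) (1 / c)"
      using c by (intro ennreal_powr_mono ennreal_suminf_ge) auto
    also have "\<dots> = lq_norm \<theta> b"
      using c by (simp add: lq_norm_nat Lp_norm_ennreal nn_integral_count_space_nat)
    finally show "b k \<le> lq_norm \<theta> b" .
  qed
qed (simp add: lq_norm_def)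

text \<open>A minimum of finitely many positive bounds. The summand 1 in the denominator of
  \<open>?d\<close> makes the last inequality strict.\<close>

lemma small_exponent_exists:
  fixes q r \<alpha> :: "real ^ 'n::finite"
  assumes q: "\<And>i. 0 < q $ i" and r: "\<And>i. 0 < r $ i" and \<beta>: "0 < \<beta>"
  obtains a where "0 < a" "a \<le> 1" "\<beta> = \<infinity> \<or> a \<le> enn2real \<beta>" "\<And>i. a \<le> q $ i" "\<And>i. a \<le> r $ i"
    "\<And>i. a * (\<alpha> $ i + 1 / q $ i) < 1"
proof -
  define b where "b = (if \<beta> = \<infinity> then 1 else enn2real \<beta>)"
  have b: "0 < b" using \<beta> by (cases \<beta>) (auto simp: b_def)
  let ?d = "\<lambda>i. 1 / (1 + \<bar>\<alpha> $ i + 1 / q $ i\<bar>)"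
  define S where "S = {1, b} \<union> range (($) q) \<union> range (($) r) \<union> range ?d"
  have S: "finite S" "S \<noteq> {}" by (auto simp: S_def)
  define a where "a = Min S"
  have le: "a \<le> x" if "x \<in> S" for x unfolding a_def using S that by (intro Min_le)
  have "0 < x" if "x \<in> S" for x using that q r b by (auto simp: S_def add_pos_nonneg)
  then have a: "0 < a" unfolding a_def using S by simp
  have "a * (\<alpha> $ i + 1 / q $ i) < 1" for i
  proof -
    have "a \<le> ?d i" by (rule le) (simp add: S_def)
    then have "a * (1 + \<bar>\<alpha> $ i + 1 / q $ i\<bar>) \<le> 1" by (simp add: pos_le_divide_eq add_pos_nonneg)
    moreover have "a * (\<alpha> $ i + 1 / q $ i) \<le> a * \<bar>\<alpha> $ i + 1 / q $ i\<bar>" using a by (intro mult_left_mono) auto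
    ultimately show ?thesis using a by (simp add: distrib_left)
  qed
  moreover have "\<beta> = \<infinity> \<or> a \<le> enn2real \<beta>" using le[of b] by (auto simp: S_def b_def split: if_splits)
  ultimately show ?thesis using a le by (intro that[of a]) (auto simp: S_def)
qed

theorem theorem5p21:
  fixes \<Phi> \<phi> :: "real ^ 'n::{finite,linorder} \<Rightarrow> complex"
    and p q r \<alpha>1 \<alpha>2 :: "real ^ 'n::{finite,linorder}"
    and s1 s2 :: real
    and \<theta> \<beta> :: ennreal
  assumes "littlewood_paley_pair \<Phi> \<phi>"
    and "\<And>i. 0 < q $ i"
    and "\<And>i. q $ i < p $ i"
    and "\<And>i. 0 < r $ i"
    and "0 < \<theta>" and "0 < \<beta>"
    and "\<And>i. \<alpha>1 $ i \<le> \<alpha>2 $ i"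
    and "\<And>i. - 1 / p $ i < \<alpha>1 $ i"
    and "s1 - (\<Sum>i\<in>UNIV. 1 / p $ i) - (\<Sum>i\<in>UNIV. \<alpha>1 $ i)
         \<le> s2 - (\<Sum>i\<in>UNIV. 1 / q $ i) - (\<Sum>i\<in>UNIV. \<alpha>2 $ i)"
  shows "continuously_embedded
           (herz_TL_space \<Phi> \<phi> \<alpha>2 q r s2 \<theta>) (herz_TL_norm \<Phi> \<phi> \<alpha>2 q r s2 \<theta>)
           (herz_TL_space \<Phi> \<phi> \<alpha>1 p r s1 \<beta>) (herz_TL_norm \<Phi> \<phi> \<alpha>1 p r s1 \<beta>)"
proof -
  note lp = assms(1) and q = assms(2) and qp = assms(3) and r = assms(4) and \<alpha> = assms(7,8) and s = assms(9)
  have p: "0 < p $ i" for i using q[of i] qp[of i] by simp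
  obtain a where a: "0 < a" "a \<le> 1" "\<beta> = \<infinity> \<or> a \<le> enn2real \<beta>" "\<And>i. a \<le> q $ i" "\<And>i. a \<le> r $ i"
    "\<And>i. a * (\<alpha>2 $ i + 1 / q $ i) < 1"
    by (rule small_exponent_exists[OF q r assms(6)]) (rule that)
  define P Q R A1 A2 where defs: "P = (1 / a) *\<^sub>R p" "Q = (1 / a) *\<^sub>R q" "R = (1 / a) *\<^sub>R r" "A1 = a *\<^sub>R \<alpha>1" "A2 = a *\<^sub>R \<alpha>2"
  define js where "js = sorted_list_of_set (UNIV :: 'n set)"
  have js: "distinct js" "js \<noteq> []" "set js = UNIV" by (auto simp: js_def)
  obtain A where A: "0 < A" and dominated: "\<And>u. u \<in> tempered_distributions \<Longrightarrow>
      sampling_dominated A (\<lambda>k x. ennreal_powr (ennreal (cmod (convolve (lp_piece \<Phi> \<phi> k) u x))) a)"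
    by (rule lp_piece_sampling_dominated[OF lp a(1,2)]) (rule that)
  \<comment> \<open>The gap between the differential dimensions: the hypothesis on the smoothness
    parameters reads s1 \<le> s2 - \<Delta>. Reciprocal exponents and weights all scale by
    \<open>a\<close>, so after rescaling the gap is a \<Delta>.\<close>
  define \<Delta> where "\<Delta> = (\<Sum>i\<in>UNIV. 1 / q $ i) - (\<Sum>i\<in>UNIV. 1 / p $ i) + (\<Sum>i\<in>UNIV. \<alpha>2 $ i) - (\<Sum>i\<in>UNIV. \<alpha>1 $ i)"
  have sum_js: "(\<Sum>i\<leftarrow>js. 1 / Q $ i - 1 / P $ i + A2 $ i - A1 $ i) = a * \<Delta>"
    using js by (simp add: sum_list_distinct_conv_sum_set defs \<Delta>_def sum.distrib sum_subtractf distrib_left right_diff_distrib sum_distrib_left)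
  obtain C where C: "0 < C" and embed: "\<And>(F :: nat \<Rightarrow> real ^ 'n::{finite,linorder} \<Rightarrow> ennreal) \<sigma> x. sampling_dominated A F \<Longrightarrow>
    iterated_herz_norm A1 (ennreal_vec P) (ennreal_vec R) js
      (\<lambda>y. \<Sum>k. ennreal (2 powr (real k * (\<sigma> - a * \<Delta>))) * F k y) x
    \<le> ennreal C * iterated_herz_norm A2 (ennreal_vec Q) (ennreal_vec R) js (\<lambda>y. SUP k. ennreal (2 powr (real k * \<sigma>)) * F k y) x"
  proof -
    have "\<exists>C>0. \<forall>(F :: nat \<Rightarrow> real ^ 'n::{finite,linorder} \<Rightarrow> ennreal) \<sigma> x. sampling_dominated A F \<longrightarrow>
      iterated_herz_norm A1 (ennreal_vec P) (ennreal_vec R) js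
        (\<lambda>y. \<Sum>k. ennreal (2 powr (real k * (\<sigma> - (\<Sum>i\<leftarrow>js. 1 / Q $ i - 1 / P $ i + A2 $ i - A1 $ i)))) * F k y) x
      \<le> ennreal C * iterated_herz_norm A2 (ennreal_vec Q) (ennreal_vec R) js (\<lambda>y. SUP k. ennreal (2 powr (real k * \<sigma>)) * F k y) x"
    proof (rule iterated_herz_norm_embedding[OF _ _ _ _ _ _ A js(1,2)])
      fix i
      show "1 \<le> Q $ i" "1 \<le> R $ i" "Q $ i < P $ i" "A1 $ i \<le> A2 $ i"
        using a(1) a(4)[of i] a(5)[of i] qp[of i] \<alpha>(1)[of i] by (auto simp: defs field_simps)
      have "a * (- 1 / p $ i) < a * \<alpha>1 $ i" using a(1) \<alpha>(2) by (intro mult_strict_left_mono)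
      then show "- 1 / P $ i < A1 $ i" by (simp add: defs)
      show "A2 $ i < 1 - 1 / Q $ i" using a(6)[of i] by (simp add: defs distrib_left)
    qed
    then show ?thesis using that unfolding sum_js by blast
  qed
  have bound: "herz_TL_norm \<Phi> \<phi> \<alpha>1 p r s1 \<beta> f \<le> ennreal (C powr (1 / a)) * herz_TL_norm \<Phi> \<phi> \<alpha>2 q r s2 \<theta> f"
    if f: "f \<in> tempered_distributions" for f
  proof -
    let ?b = "\<lambda>s k x. ennreal (2 powr (real k * s) * cmod (convolve (lp_piece \<Phi> \<phi> k) f x))"
    let ?F = "\<lambda>k x. ennreal_powr (ennreal (cmod (convolve (lp_piece \<Phi> \<phi> k) f x))) a"
    have powr_b: "ennreal_powr (?b s k x) a = ennreal (2 powr (real k * (a * s))) * ?F k x" for s k x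
      using a(1) by (simp add: ennreal_mult ennreal_powr_mult ennreal_powr_ennreal powr_powr mult_ac)
    have nonneg: "0 \<le> P $ i" "0 \<le> Q $ i" "0 \<le> R $ i" for i
      using a(1) p[of i] q[of i] r[of i] by (auto simp: defs)
    have "ennreal_powr (herz_TL_norm \<Phi> \<phi> \<alpha>1 p r s1 \<beta> f) a
      = iterated_herz_norm A1 (ennreal_vec P) (ennreal_vec R) js (\<lambda>x. ennreal_powr (lq_norm \<beta> (\<lambda>k. ?b s1 k x)) a) 0"
      unfolding herz_TL_norm_def mixed_herz_norm_def js_def[symmetric] defs
      by (rule iterated_herz_norm_powr[OF p r a(1)])
    also have "\<dots> \<le> iterated_herz_norm A1 (ennreal_vec P) (ennreal_vec R) js (\<lambda>y. \<Sum>k. ennreal (2 powr (real k * (a * s2 - a * \<Delta>))) * ?F k y) 0"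
    proof (intro iterated_herz_norm_mono nonneg)
      fix x
      have "ennreal_powr (lq_norm \<beta> (\<lambda>k. ?b s1 k x)) a \<le> (\<Sum>k. ennreal_powr (?b s1 k x) a)"
        by (rule lq_norm_powr_le[OF a(1,3)])
      also have "\<dots> \<le> (\<Sum>k. ennreal (2 powr (real k * (a * s2 - a * \<Delta>))) * ?F k x)"
      proof (intro suminf_le)
        fix k
        have "s1 \<le> s2 - \<Delta>" using s by (simp add: \<Delta>_def)
        then have "a * s1 \<le> a * s2 - a * \<Delta>" using a(1) by (simp add: right_diff_distrib[symmetric])
        then have "2 powr (real k * (a * s1)) \<le> 2 powr (real k * (a * s2 - a * \<Delta>))"
          by (intro powr_mono mult_left_mono) auto
        then show "ennreal_powr (?b s1 k x) a \<le> ennreal (2 powr (real k * (a * s2 - a * \<Delta>))) * ?F k x"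
          unfolding powr_b by (intro mult_right_mono ennreal_leI) auto
      qed auto
      finally show "ennreal_powr (lq_norm \<beta> (\<lambda>k. ?b s1 k x)) a \<le> (\<Sum>k. ennreal (2 powr (real k * (a * s2 - a * \<Delta>))) * ?F k x)" .
    qed
    also have "\<dots> \<le> ennreal C * iterated_herz_norm A2 (ennreal_vec Q) (ennreal_vec R) js (\<lambda>y. SUP k. ennreal (2 powr (real k * (a * s2))) * ?F k y) 0"
      by (rule embed[OF dominated[OF f]])
    also have "\<dots> \<le> ennreal C * iterated_herz_norm A2 (ennreal_vec Q) (ennreal_vec R) js (\<lambda>x. ennreal_powr (lq_norm \<theta> (\<lambda>k. ?b s2 k x)) a) 0"
    proof (intro mult_left_mono iterated_herz_norm_mono nonneg)
      fix x
      have "(SUP k. ennreal (2 powr (real k * (a * s2))) * ?F k x) = ennreal_powr (SUP k. ?b s2 k x) a"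
        unfolding powr_b[symmetric] using a(1) by (simp add: ennreal_powr_SUP)
      also have "\<dots> \<le> ennreal_powr (lq_norm \<theta> (\<lambda>k. ?b s2 k x)) a"
        using a(1) by (intro ennreal_powr_mono SUP_le_lq_norm assms(5)) auto
      finally show "(SUP k. ennreal (2 powr (real k * (a * s2))) * ?F k x) \<le> ennreal_powr (lq_norm \<theta> (\<lambda>k. ?b s2 k x)) a" .
    qed auto
    also have "\<dots> = ennreal C * ennreal_powr (herz_TL_norm \<Phi> \<phi> \<alpha>2 q r s2 \<theta> f) a"
      unfolding herz_TL_norm_def mixed_herz_norm_def js_def[symmetric] defs
      by (subst iterated_herz_norm_powr[OF q r a(1)]) (rule refl)
    finally have "herz_TL_norm \<Phi> \<phi> \<alpha>1 p r s1 \<beta> f \<le> ennreal_powr (ennreal C * ennreal_powr (herz_TL_norm \<Phi> \<phi> \<alpha>2 q r s2 \<theta> f) a) (1 / a)"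
      unfolding ennreal_powr_le_iff[OF a(1)] .
    also have "\<dots> = ennreal (C powr (1 / a)) * herz_TL_norm \<Phi> \<phi> \<alpha>2 q r s2 \<theta> f"
      using a(1) C by (simp add: ennreal_powr_mult ennreal_powr_powr ennreal_powr_ennreal)
    finally show ?thesis .
  qed
  show ?thesis
    unfolding continuously_embedded_def
  proof (intro conjI exI[of _ "C powr (1 / a)"] ballI)
    show "herz_TL_space \<Phi> \<phi> \<alpha>2 q r s2 \<theta> \<subseteq> herz_TL_space \<Phi> \<phi> \<alpha>1 p r s1 \<beta>"
    proof
      fix f assume "f \<in> herz_TL_space \<Phi> \<phi> \<alpha>2 q r s2 \<theta>"
      then have f: "f \<in> tempered_distributions" "herz_TL_norm \<Phi> \<phi> \<alpha>2 q r s2 \<theta> f < \<infinity>" by (auto simp: herz_TL_space_def)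
      have "ennreal (C powr (1 / a)) * herz_TL_norm \<Phi> \<phi> \<alpha>2 q r s2 \<theta> f < \<infinity>"
        using f(2) by (simp add: ennreal_mult_less_top)
      then show "f \<in> herz_TL_space \<Phi> \<phi> \<alpha>1 p r s1 \<beta>"
        using f(1) bound[OF f(1)] by (auto simp: herz_TL_space_def intro: le_less_trans)
    qed
    show "0 < C powr (1 / a)" using C by simp
    show "herz_TL_norm \<Phi> \<phi> \<alpha>1 p r s1 \<beta> f \<le> ennreal (C powr (1 / a)) * herz_TL_norm \<Phi> \<phi> \<alpha>2 q r s2 \<theta> f"
      if "f \<in> herz_TL_space \<Phi> \<phi> \<alpha>2 q r s2 \<theta>" for f
      using that by (intro bound) (simp add: herz_TL_space_def)
  qed
qed

end
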